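(* Let $k\geq 2$ and let $\mathcal{X}$ be a finite $k$-cube complex. Then there is a $k$-graph $\Lambda_{\mathrm{DG}(\mathcal{X})}$ with vertex set equal to the vertex set of $\mathcal{X}$ and whose $1$-skeleton contains two edges for each geometric edge of $\mathcal{X}$, in a colour preserving and orientation reversing assignment (that is, the two edges have the colour of the geometric edge and opposite orientations). Further, $\Lambda_{\mathrm{DG}(\mathcal{X})}$ is row-finite.
   Context: A $k$-cube complex is a CW complex (cube complex) $\mathcal{X}$ whose universal cover is a Cartesian product $T_1\times\dots\times T_k$ of $k$ trees, each of finite constant valency, with its product cubical structure. $\mathcal{X}$ is taken to be finite, and the deck transformations do not interchange the tree factors, so that every geometric edge of $\mathcal{X}$ has a well-defined direction (colour) $i\in\{1,\dots,k\}$. The digraph $\mathrm{DG}(\mathcal{X})$ has as vertex set $V$ the vertices of $\mathcal{X}$ and edge set $E=E_1\sqcup\dots\sqcup E_k$, where $E_i$ is the set of oriented edges of $\mathcal{X}$ in direction $i$ (so each geometric edge gives two oppositely oriented edges of the same colour); for a directed path $xy$ ($t(x)=o(y)$) with $x\in E_i$, $y\in E_j$, $i\ne j$, one sets $\phi(xy)=y'x'$, where $y'x'$ ($y'\in E_j$, $x'\in E_i$) is the opposite boundary path, with same origin and terminus, in the unique geometric square of $\mathcal{X}$ having $xy$ as two consecutive boundary edges. $\Lambda_{\mathrm{DG}(\mathcal{X})}$ is the quotient of the free category on this directed graph (objects $V$; morphisms finite directed paths; the path $x_1\cdots x_m$ is the morphism $x_m\circ\cdots\circ x_1$ from $o(x_1)$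 to $t(x_m)$) by the congruence generated by $xy\sim\phi(xy)$ for all bicoloured paths $xy$ of length two; the degree functor $d$ sends the class of an edge in $E_i$ to the generator $e_i\in\mathbb{N}^k$. Its $1$-skeleton is the coloured edge set $E_1\sqcup\dots\sqcup E_k$. A $k$-graph is a countable small category $\Lambda$ with a functor $d:\Lambda\to\mathbb{N}^k$ such that whenever $d(\pi)=m+n$ there are unique $\mu,\nu$ with $\pi=\mu\nu$, $d(\mu)=m$, $d(\nu)=n$. Vertices are the morphisms of degree $0$ (identities/objects). $\Lambda$ is row-finite if for every vertex $v$ and $n\in\mathbb{N}^k$ the set $v\Lambda^n$ of morphisms of degree $n$ with range $v$ is finite. *)

theory Defs
  imports "HOL-Analysis.Analysis" "HOL-Combinatorics.Permutations" "Graph_Theory.Pair_Digraph"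
    "Graph_Theory.Digraph_Component"
begin

section \<open>Cube complexes\<close>

definition cube :: "nat \<Rightarrow> (nat \<Rightarrow> real) set" where
  "cube n = (\<Pi>\<^sub>E i\<in>{..<n}. {0..1})"

definition open_cube :: "nat \<Rightarrow> (nat \<Rightarrow> real) set" where
  "open_cube n = (\<Pi>\<^sub>E i\<in>{..<n}. {0<..<1})"

text \<open>The isometries of the standard cube: permute the coordinates and reflect those in \<open>F\<close>.\<close>

definition cube_syms :: "nat \<Rightarrow> ((nat \<Rightarrow> real) \<Rightarrow> (nat \<Rightarrow> real)) set" where
  "cube_syms n = {\<lambda>x\<in>cube n. \<lambda>i\<in>{..<n}. if i \<in> F then 1 - x (\<pi> i) else x (\<pi> i) | \<pi> F.
     \<pi> permutes {..<n}}"

text \<open>\<open>cube_face n q i \<epsilon>\<close> is the restriction of a map \<open>q\<close> on the \<open>(n+1)\<close>-cube to its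
  face \<open>x i = \<epsilon>\<close>, parametrised by the \<open>n\<close>-cube.\<close>

definition cube_face ::
  "nat \<Rightarrow> ((nat \<Rightarrow> real) \<Rightarrow> 'a) \<Rightarrow> nat \<Rightarrow> real \<Rightarrow> (nat \<Rightarrow> real) \<Rightarrow> 'a" where
  "cube_face n q i \<epsilon> =
     compose (cube n) q (\<lambda>x. \<lambda>j\<in>{..<Suc n}. if j < i then x j else if j = i then \<epsilon> else x (j - 1))"

text \<open>A cube structure on a space is given by all the characteristic maps of its cells.  A cell is
  not given a preferred parametrisation: its characteristic maps form one orbit of the symmetry group
  of the standard cube.  In particular an (unoriented) 1-cell has two characteristic maps,
  which are its two orientations.\<close>

record 'a cube_complex =
  underlying :: "'a set"
  charmaps :: "nat \<Rightarrow> ((nat \<Rightarrow> real) \<Rightarrow> 'a) set"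

text \<open>The conditions below are those of Hatcher's description of a \<open>\<Delta>\<close>-complex, with cubes instead of
  simplices: the open cells partition the space, each attaching map is on every face a
  characteristic map of lower dimension, and the topology is the weak one.  They imply that the
  space is a (Hausdorff, closure-finite) CW complex.  Cells may be glued to themselves.\<close>

definition is_cube_complex :: "'a::topological_space cube_complex \<Rightarrow> bool" where
  "is_cube_complex X \<longleftrightarrow>
     (\<forall>n. \<forall>q\<in>charmaps X n. q \<in> cube n \<rightarrow>\<^sub>E underlying X \<and> continuous_on (cube n) q \<and>
        inj_on q (open_cube n)) \<and>
     (\<forall>n. \<forall>q\<in>charmaps X n. \<forall>g\<in>cube_syms n. compose (cube n) q g \<in> charmaps X n) \<and>
     (\<forall>n. \<forall>q\<in>charmaps X (Suc n). \<forall>i\<le>n. \<forall>\<epsilon>\<in>{0, 1}. cube_face n q i \<epsilon> \<in> charmaps X n) \<and>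
     (\<forall>x\<in>underlying X. \<exists>n. \<exists>q\<in>charmaps X n. x \<in> q ` open_cube n) \<and>
     (\<forall>m n. \<forall>q\<in>charmaps X m. \<forall>r\<in>charmaps X n. q ` open_cube m \<inter> r ` open_cube n \<noteq> {} \<longrightarrow>
        m = n \<and> (\<exists>g\<in>cube_syms n. r = compose (cube n) q g)) \<and>
     (\<forall>U\<subseteq>underlying X. openin (top_of_set (underlying X)) U \<longleftrightarrow>
        (\<forall>n. \<forall>q\<in>charmaps X n. openin (top_of_set (cube n)) (cube n \<inter> q -` U)))"

definition finite_cube_complex :: "'a cube_complex \<Rightarrow> bool" where
  "finite_cube_complex X \<longleftrightarrow> finite (SIGMA n:UNIV. charmaps X n)"

definition vertices :: "'a cube_complex \<Rightarrow> 'a set" where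
  "vertices X = (\<lambda>q. q (\<lambda>_. undefined)) ` charmaps X 0"

definition open_cells :: "'a cube_complex \<Rightarrow> nat \<Rightarrow> 'a set set" where
  "open_cells X n = (\<lambda>q. q ` open_cube n) ` charmaps X n"

text \<open>Oriented edges are the elements of \<^term>\<open>charmaps X 1\<close>.\<close>

definition origin :: "((nat \<Rightarrow> real) \<Rightarrow> 'a) \<Rightarrow> 'a" where
  "origin e = e (\<lambda>i\<in>{..<1}. 0)"

definition terminus :: "((nat \<Rightarrow> real) \<Rightarrow> 'a) \<Rightarrow> 'a" where
  "terminus e = e (\<lambda>i\<in>{..<1}. 1)"

definition reverse :: "((nat \<Rightarrow> real) \<Rightarrow> 'a) \<Rightarrow> (nat \<Rightarrow> real) \<Rightarrow> 'a" where
  "reverse e = compose (cube 1) e (\<lambda>x. \<lambda>i\<in>{..<1}. 1 - x i)"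


section \<open>Products of trees\<close>

text \<open>An undirected tree as a symmetric digraph.  In such a digraph \<open>u, v, u\<close>
  is a cycle of length two, hence the bound on the length.  The tree need not be finite.\<close>

definition is_tree :: "'v pair_pre_digraph \<Rightarrow> bool" where
  "is_tree T \<longleftrightarrow> pair_bidirected_digraph T \<and> Digraph_Component.connected (with_proj T) \<and>
     (\<nexists>c. pre_digraph.cycle (with_proj T) c \<and> 3 \<le> length c)"

definition constant_valency :: "'v pair_pre_digraph \<Rightarrow> bool" where
  "constant_valency T \<longleftrightarrow>
     (\<exists>q. \<forall>v\<in>pverts T. finite (out_arcs (with_proj T) v) \<and> out_degree (with_proj T) v = q)"

text \<open>Geometric realisation in barycentric coordinates, inside the space of functions on vertices with
  the product topology.  For locally finite graphs this is the CW topology.\<close>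

definition edge_point :: "'v \<Rightarrow> 'v \<Rightarrow> real \<Rightarrow> 'v \<Rightarrow> real" where
  "edge_point u w t = (\<lambda>z. (1 - t) * indicator {u} z + t * indicator {w} z)"

definition realization :: "'v pair_pre_digraph \<Rightarrow> ('v \<Rightarrow> real) set" where
  "realization T = {indicator {u} | u. u \<in> pverts T} \<union>
     {edge_point u w t | u w t. (u, w) \<in> parcs T \<and> t \<in> {0..1}}"

text \<open>The cells of the product: in the directions \<open>\<iota> ` {..<n}\<close> one moves along an (oriented)
  edge from \<open>u j\<close> to \<open>w j\<close>, driven by the corresponding cube coordinate; in the other
  directions one stays at the vertex \<open>u j\<close>.\<close>

definition tree_product ::
  "nat \<Rightarrow> (nat \<Rightarrow> 'v pair_pre_digraph) \<Rightarrow> (nat \<Rightarrow> 'v \<Rightarrow> real) cube_complex" where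
  "tree_product k T =
    \<lparr>underlying = (\<Pi>\<^sub>E j\<in>{..<k}. realization (T j)),
     charmaps = (\<lambda>n. {\<lambda>x\<in>cube n. \<lambda>j\<in>{..<k}.
         if j \<in> \<iota> ` {..<n} then edge_point (u j) (w j) (x (inv_into {..<n} \<iota> j)) else indicator {u j}
       | \<iota> u w. inj_on \<iota> {..<n} \<and> \<iota> ` {..<n} \<subseteq> {..<k} \<and>
           (\<forall>j\<in>\<iota> ` {..<n}. (u j, w j) \<in> parcs (T j)) \<and>
           (\<forall>j\<in>{..<k} - \<iota> ` {..<n}. u j \<in> pverts (T j))})\<rparr>"

text \<open>The edges of the product in direction \<open>i\<close>: the other coordinates are constant.\<close>

definition tree_product_edges ::
  "nat \<Rightarrow> (nat \<Rightarrow> 'v pair_pre_digraph) \<Rightarrow> nat \<Rightarrow> ((nat \<Rightarrow> real) \<Rightarrow> nat \<Rightarrow> 'v \<Rightarrow> real) set" where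
  "tree_product_edges k T i = {e \<in> charmaps (tree_product k T) 1.
     \<forall>x\<in>cube 1. \<forall>y\<in>cube 1. \<forall>j\<in>{..<k} - {i}. e x j = e y j}"


section \<open>\<open>k\<close>-cube complexes\<close>

definition universal_cover ::
  "'b::topological_space set \<Rightarrow> ('b \<Rightarrow> 'a::topological_space) \<Rightarrow> 'a set \<Rightarrow> bool" where
  "universal_cover C p S \<longleftrightarrow> simply_connected C \<and> covering_space C p S"

definition deck_transformation ::
  "'b::topological_space set \<Rightarrow> ('b \<Rightarrow> 'a) \<Rightarrow> ('b \<Rightarrow> 'b) \<Rightarrow> bool" where
  "deck_transformation C p g \<longleftrightarrow> (\<exists>h. homeomorphism C C g h) \<and> (\<forall>x\<in>C. p (g x) = p x)"

text \<open>The cover \<open>p\<close> and the identification of its total space with the product of the trees \<open>T 0, \<dots>, T (k-1)\<close>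
  are part of the data, since they determine the numbering of the directions.  The equation on \<open>charmaps\<close>
  says that the cube structure of the cover is the one lifted from \<open>X\<close>.  The last condition says that
  every deck transformation acts on each tree factor separately, i.e. does not interchange factors.\<close>

definition k_cube_complex :: "nat \<Rightarrow> 'a::topological_space cube_complex \<Rightarrow>
    (nat \<Rightarrow> 'v pair_pre_digraph) \<Rightarrow> ((nat \<Rightarrow> 'v \<Rightarrow> real) \<Rightarrow> 'a) \<Rightarrow> bool" where
  "k_cube_complex k X T p \<longleftrightarrow>
     is_cube_complex X \<and>
     (\<forall>i<k. is_tree (T i) \<and> constant_valency (T i)) \<and>
     universal_cover (underlying (tree_product k T)) p (underlying X) \<and>
     (\<forall>n. charmaps X n = (\<lambda>q. compose (cube n) p q) ` charmaps (tree_product k T) n) \<and>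
     (\<forall>g. deck_transformation (underlying (tree_product k T)) p g \<longrightarrow>
        (\<forall>i<k. \<forall>x\<in>underlying (tree_product k T). \<forall>y\<in>underlying (tree_product k T).
           x i = y i \<longrightarrow> g x i = g y i))"

definition oriented_edges :: "nat \<Rightarrow> (nat \<Rightarrow> 'v pair_pre_digraph) \<Rightarrow> ((nat \<Rightarrow> 'v \<Rightarrow> real) \<Rightarrow> 'a) \<Rightarrow> nat \<Rightarrow>
    ((nat \<Rightarrow> real) \<Rightarrow> 'a) set" where
  "oriented_edges k T p i = (\<lambda>q. compose (cube 1) p q) ` tree_product_edges k T i"


section \<open>Small categories and \<open>k\<close>-graphs\<close>

record ('o, 'm) category =
  Ob :: "'o set"
  Mor :: "'m set"
  src :: "'m \<Rightarrow> 'o"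
  rng :: "'m \<Rightarrow> 'o"
  comp :: "'m \<Rightarrow> 'm \<Rightarrow> 'm"
  ident :: "'o \<Rightarrow> 'm"

text \<open>\<open>comp C f g\<close> is \<open>f \<circ> g\<close>, defined when \<open>src C f = rng C g\<close>; this is the product \<open>fg\<close> of
  the \<open>k\<close>-graph literature.\<close>

locale small_category =
  fixes C :: "('o, 'm) category"
  assumes src_Ob: "f \<in> Mor C \<Longrightarrow> src C f \<in> Ob C"
    and rng_Ob: "f \<in> Mor C \<Longrightarrow> rng C f \<in> Ob C"
    and ident_Mor: "v \<in> Ob C \<Longrightarrow> ident C v \<in> Mor C"
    and src_ident: "v \<in> Ob C \<Longrightarrow> src C (ident C v) = v"
    and rng_ident: "v \<in> Ob C \<Longrightarrow> rng C (ident C v) = v"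
    and comp_Mor: "\<lbrakk>f \<in> Mor C; g \<in> Mor C; src C f = rng C g\<rbrakk> \<Longrightarrow> comp C f g \<in> Mor C"
    and src_comp: "\<lbrakk>f \<in> Mor C; g \<in> Mor C; src C f = rng C g\<rbrakk> \<Longrightarrow> src C (comp C f g) = src C g"
    and rng_comp: "\<lbrakk>f \<in> Mor C; g \<in> Mor C; src C f = rng C g\<rbrakk> \<Longrightarrow> rng C (comp C f g) = rng C f"
    and comp_ident: "f \<in> Mor C \<Longrightarrow> comp C f (ident C (src C f)) = f"
    and ident_comp: "f \<in> Mor C \<Longrightarrow> comp C (ident C (rng C f)) f = f"
    and comp_assoc: "\<lbrakk>f \<in> Mor C; g \<in> Mor C; h \<in> Mor C; src C f = rng C g; src C g = rng C h\<rbrakk>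
      \<Longrightarrow> comp C (comp C f g) h = comp C f (comp C g h)"

definition degrees :: "nat \<Rightarrow> (nat \<Rightarrow> nat) set" where
  "degrees k = {m. \<forall>i\<ge>k. m i = 0}"

definition unit_degree :: "nat \<Rightarrow> nat \<Rightarrow> nat" where
  "unit_degree i = (\<lambda>j. if j = i then 1 else 0)"

locale k_graph = small_category C for k :: nat and C :: "('o, 'm) category" +
  fixes d :: "'m \<Rightarrow> nat \<Rightarrow> nat"
  assumes countable_Mor: "countable (Mor C)"
    and deg_degrees: "f \<in> Mor C \<Longrightarrow> d f \<in> degrees k"
    and deg_ident: "v \<in> Ob C \<Longrightarrow> d (ident C v) = (\<lambda>_. 0)"
    and deg_comp: "\<lbrakk>f \<in> Mor C; g \<in> Mor C; src C f = rng C g\<rbrakk> \<Longrightarrow> d (comp C f g) = (\<lambda>i. d f i + d g i)"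
    and factorization: "\<lbrakk>f \<in> Mor C; m \<in> degrees k; n \<in> degrees k; d f = (\<lambda>i. m i + n i)\<rbrakk> \<Longrightarrow>
      \<exists>!(g, h). g \<in> Mor C \<and> h \<in> Mor C \<and> src C g = rng C h \<and> f = comp C g h \<and> d g = m \<and> d h = n"

definition row_finite :: "nat \<Rightarrow> ('o, 'm) category \<Rightarrow> ('m \<Rightarrow> nat \<Rightarrow> nat) \<Rightarrow> bool" where
  "row_finite k C d \<longleftrightarrow>
     (\<forall>v\<in>Ob C. \<forall>n\<in>degrees k. finite {f \<in> Mor C. rng C f = v \<and> d f = n})"


section \<open>Quotients of free categories\<close>

text \<open>A path is kept together with its two end points, so that empty paths are distinguished.\<close>

definition free_category :: "('v, 'e) pre_digraph \<Rightarrow> ('v, 'v \<times> 'e list \<times> 'v) category" where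
  "free_category G =
    \<lparr>Ob = verts G,
     Mor = {(u, xs, v). pre_digraph.awalk G u xs v},
     src = (\<lambda>(u, xs, v). u),
     rng = (\<lambda>(u, xs, v). v),
     comp = (\<lambda>(u', ys, v') (u, xs, v). (u, xs @ ys, v')),
     ident = (\<lambda>v. (v, [], v))\<rparr>"

inductive_set congruence :: "('o, 'm) category \<Rightarrow> ('m \<times> 'm) set \<Rightarrow> ('m \<times> 'm) set"
  for C :: "('o, 'm) category" and R :: "('m \<times> 'm) set" where
  base: "(f, g) \<in> R \<Longrightarrow> (f, g) \<in> congruence C R"
| refl: "f \<in> Mor C \<Longrightarrow> (f, f) \<in> congruence C R"
| sym: "(f, g) \<in> congruence C R \<Longrightarrow> (g, f) \<in> congruence C R"
| trans: "(f, g) \<in> congruence C R \<Longrightarrow> (g, h) \<in> congruence C R \<Longrightarrow> (f, h) \<in> congruence C R"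
| comp: "(f, f') \<in> congruence C R \<Longrightarrow> (g, g') \<in> congruence C R \<Longrightarrow> src C f = rng C g \<Longrightarrow>
    (comp C f g, comp C f' g') \<in> congruence C R"

definition quotient_category :: "('o, 'm) category \<Rightarrow> ('m \<times> 'm) set \<Rightarrow> ('o, 'm set) category" where
  "quotient_category C r =
    \<lparr>Ob = Ob C,
     Mor = Mor C // r,
     src = (\<lambda>A. the_elem (src C ` A)),
     rng = (\<lambda>A. the_elem (rng C ` A)),
     comp = (\<lambda>A B. \<Union>f\<in>A. \<Union>g\<in>B. r `` {comp C f g}),
     ident = (\<lambda>v. r `` {ident C v})\<rparr>"


section \<open>The digraph and the category of a \<open>k\<close>-cube complex\<close>

definition DG :: "nat \<Rightarrow> 'a cube_complex \<Rightarrow> (nat \<Rightarrow> 'v pair_pre_digraph) \<Rightarrow> ((nat \<Rightarrow> 'v \<Rightarrow> real) \<Rightarrow> 'a) \<Rightarrow>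
    ('a, (nat \<Rightarrow> real) \<Rightarrow> 'a) pre_digraph" where
  "DG k X T p =
    \<lparr>verts = vertices X, arcs = (\<Union>i<k. oriented_edges k T p i), tail = origin, head = terminus\<rparr>"

text \<open>For a path \<open>x y\<close> the sides of a square \<open>q\<close> with \<open>x = q(\<cdot>,0)\<close>, \<open>y = q(1,\<cdot>)\<close> give the opposite path
  \<open>y' = q(0,\<cdot>)\<close>, \<open>x' = q(\<cdot>,1)\<close>.\<close>

definition DG_phi :: "'a cube_complex \<Rightarrow> ((nat \<Rightarrow> real) \<Rightarrow> 'a) \<Rightarrow> ((nat \<Rightarrow> real) \<Rightarrow> 'a) \<Rightarrow>
    ((nat \<Rightarrow> real) \<Rightarrow> 'a) \<times> ((nat \<Rightarrow> real) \<Rightarrow> 'a)" where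
  "DG_phi X x y = (THE (y', x'). \<exists>q\<in>charmaps X 2.
     cube_face 1 q 1 0 = x \<and> cube_face 1 q 0 1 = y \<and>
     cube_face 1 q 0 0 = y' \<and> cube_face 1 q 1 1 = x')"

definition DG_relations :: "nat \<Rightarrow> 'a cube_complex \<Rightarrow> (nat \<Rightarrow> 'v pair_pre_digraph) \<Rightarrow>
    ((nat \<Rightarrow> 'v \<Rightarrow> real) \<Rightarrow> 'a) \<Rightarrow>
    (('a \<times> ((nat \<Rightarrow> real) \<Rightarrow> 'a) list \<times> 'a) \<times> ('a \<times> ((nat \<Rightarrow> real) \<Rightarrow> 'a) list \<times> 'a)) set" where
  "DG_relations k X T p =
    {((origin x, [x, y], terminus y), (origin x, [y', x'], terminus y)) | x y y' x' i j.
       i < k \<and> j < k \<and> i \<noteq> j \<and> x \<in> oriented_edges k T p i \<and> y \<in> oriented_edges k T p j \<and>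
       terminus x = origin y \<and> (y', x') = DG_phi X x y}"

definition DG_congruence :: "nat \<Rightarrow> 'a cube_complex \<Rightarrow> (nat \<Rightarrow> 'v pair_pre_digraph) \<Rightarrow>
    ((nat \<Rightarrow> 'v \<Rightarrow> real) \<Rightarrow> 'a) \<Rightarrow>
    (('a \<times> ((nat \<Rightarrow> real) \<Rightarrow> 'a) list \<times> 'a) \<times> ('a \<times> ((nat \<Rightarrow> real) \<Rightarrow> 'a) list \<times> 'a)) set" where
  "DG_congruence k X T p = congruence (free_category (DG k X T p)) (DG_relations k X T p)"

definition Lambda_DG :: "nat \<Rightarrow> 'a cube_complex \<Rightarrow> (nat \<Rightarrow> 'v pair_pre_digraph) \<Rightarrow>
    ((nat \<Rightarrow> 'v \<Rightarrow> real) \<Rightarrow> 'a) \<Rightarrow> ('a, ('a \<times> ((nat \<Rightarrow> real) \<Rightarrow> 'a) list \<times> 'a) set) category" where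
  "Lambda_DG k X T p = quotient_category (free_category (DG k X T p)) (DG_congruence k X T p)"

definition edge_class :: "nat \<Rightarrow> 'a cube_complex \<Rightarrow> (nat \<Rightarrow> 'v pair_pre_digraph) \<Rightarrow>
    ((nat \<Rightarrow> 'v \<Rightarrow> real) \<Rightarrow> 'a) \<Rightarrow> ((nat \<Rightarrow> real) \<Rightarrow> 'a) \<Rightarrow> ('a \<times> ((nat \<Rightarrow> real) \<Rightarrow> 'a) list \<times> 'a) set" where
  "edge_class k X T p x = DG_congruence k X T p `` {(origin x, [x], terminus x)}"

end

theory Submission
  imports Defs
begin

text \<open>A morphism of the quotient category lifts, from any chosen lift of its origin, to a path in the
  product of trees, and a path there is determined up to the square relations by its \<open>k\<close> projections
  to walks in the trees.  Factorising a morphism of degree \<open>m + n\<close> therefore means cutting each of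
  these walks, which can be done in exactly one way.  Two lifts of the same point differ by a deck
  transformation (the product of trees is simply connected), and since deck transformations act on each factor
  separately, colours, squares and projections do not depend on the lift.\<close>

section \<open>Lifting to covering spaces\<close>

text \<open>Moving a lift by deck transformations requires one between any two points of a fibre,
  which is the purpose of the lifting theory. Its continuity needs local path connectedness of the
  complex, and this comes from the weak topology. A deck transformation is a priori only a
  homeomorphism. It maps cells to cells because every lift of a characteristic map is again a
  characteristic map: the lift meets some open cell of the product, and characteristic maps of
  \<open>X\<close> whose open cells overlap differ by a symmetry of the cube. Restricted to vertices
  it becomes one map per tree. The delicate direction of the combinatorics is that congruent paths
  have equal projections, as a path in \<open>X\<close> carries no tree coordinates. These exist
  only relative to a lift of the origin, so the invariant is stated for all lifts at once. The
  locale \<open>coloured_cover\<close> separates the two halves: topology proves its axioms, and the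
  \<open>k\<close>-graph is built from them alone.\<close>

text \<open>The lifting theorems of HOL-Analysis are restricted to normed vector spaces, while the
  complexes here live in arbitrary topological spaces.\<close>

lemma covering_space_sheets:
  assumes "covering_space C p S" "x \<in> S"
  obtains W \<V> where "x \<in> W" "openin (top_of_set S) W" "\<Union>\<V> = C \<inter> p -` W"
    "\<And>V. V \<in> \<V> \<Longrightarrow> openin (top_of_set C) V" "pairwise disjnt \<V>"
    "\<And>V. V \<in> \<V> \<Longrightarrow> \<exists>q. homeomorphism V W p q"
  using assms unfolding covering_space_def by metis

text \<open>Agreement of the two lifts is locally constant. Near \<open>z\<close> they stay in
  sheets \<open>V1\<close> and \<open>V2\<close>; if they agree at one such point, disjointness of
  the sheets gives \<open>V1 = V2\<close>, and \<open>p\<close> is injective on a sheet.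
  Connectedness of \<open>T\<close> spreads the agreement from \<open>a\<close>.\<close>

lemma covering_space_lifts_agree:
  assumes cov: "covering_space C p S" and "Topological_Spaces.connected T"
    and g1: "continuous_on T g1" "g1 \<in> T \<rightarrow> C" and g2: "continuous_on T g2" "g2 \<in> T \<rightarrow> C"
    and pg: "\<And>x. x \<in> T \<Longrightarrow> p (g1 x) = p (g2 x)" and "a \<in> T" "g1 a = g2 a" "x \<in> T"
  shows "g1 x = g2 x"
  using \<open>Topological_Spaces.connected T\<close> \<open>a \<in> T\<close> \<open>x \<in> T\<close> \<open>g1 a = g2 a\<close>
proof (rule connected_induction_simple[where P="\<lambda>x. g1 x = g2 x"])
  fix z assume z: "z \<in> T"
  then have "p (g1 z) \<in> S"
    using g1(2) covering_space_imp_surjective[OF cov] by auto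
  then obtain W \<V> where W: "p (g1 z) \<in> W" "\<Union>\<V> = C \<inter> p -` W"
    and \<V>: "\<And>V. V \<in> \<V> \<Longrightarrow> openin (top_of_set C) V" "pairwise disjnt \<V>"
      "\<And>V. V \<in> \<V> \<Longrightarrow> \<exists>q. homeomorphism V W p q"
    by (rule covering_space_sheets[OF cov]) blast
  have "g1 z \<in> \<Union>\<V>" "g2 z \<in> \<Union>\<V>"
    using W z g1(2) g2(2) pg by auto
  then obtain V1 V2 where V: "V1 \<in> \<V>" "V2 \<in> \<V>" "g1 z \<in> V1" "g2 z \<in> V2"
    by blast
  let ?N = "(T \<inter> g1 -` V1) \<inter> (T \<inter> g2 -` V2)"
  have "openin (top_of_set T) ?N"
    using V g1 g2 \<V>(1) by (intro openin_Int continuous_openin_preimage) auto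
  moreover have "g1 y = g2 y" if "x \<in> ?N" "y \<in> ?N" "g1 x = g2 x" for x y
  proof -
    have "V1 = V2"
      using that V \<V>(2) by (auto simp: pairwise_def disjnt_def)
    moreover obtain q where "homeomorphism V1 W p q"
      using V(1) \<V>(3) by blast
    ultimately show ?thesis
      using that pg by (metis IntE homeomorphism_apply1 vimageE)
  qed
  ultimately show "\<exists>N. openin (top_of_set T) N \<and> z \<in> N \<and> (\<forall>x\<in>N. \<forall>y\<in>N. g1 x = g2 x \<longrightarrow> g1 y = g2 y)"
    using V z by (intro exI[of _ ?N]) auto
qed

section \<open>Lifting maps of the unit square\<close>

definition liftable ::
  "'b::topological_space set \<Rightarrow> ('b \<Rightarrow> 'a) \<Rightarrow> ('c::topological_space \<Rightarrow> 'a) \<Rightarrow> 'c set \<Rightarrow> bool" where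
  "liftable C p h B \<longleftrightarrow> (\<forall>c\<in>B. \<forall>y\<in>C. p y = h c \<longrightarrow>
     (\<exists>g. continuous_on B g \<and> g \<in> B \<rightarrow> C \<and> g c = y \<and> (\<forall>z\<in>B. p (g z) = h z)))"

lemma liftableE:
  assumes "liftable C p h B" "c \<in> B" "y \<in> C" "p y = h c"
  obtains g where "continuous_on B g" "g \<in> B \<rightarrow> C" "g c = y" "\<And>z. z \<in> B \<Longrightarrow> p (g z) = h z"
  using assms unfolding liftable_def by blast

text \<open>Since \<open>liftable\<close> allows every base point and every point above it, the lift
  over the second piece can start at whatever value the first lift takes on the overlap. The lifts
  then agree on the connected set \<open>A \<inter> B\<close>, and closedness of the pieces makes
  the glued map continuous.\<close>

lemma liftable_Un:
  assumes cov: "covering_space C p S" and A: "liftable C p h A" and B: "liftable C p h B"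
    and "closed A" "closed B" "Topological_Spaces.connected (A \<inter> B)" "A \<inter> B \<noteq> {}"
  shows "liftable C p h (A \<union> B)"
proof -
  \<comment> \<open>The base point may lie in either piece, so the claim is proved for generic
    \<open>A\<close> and \<open>B\<close> and used in both orders.\<close>
  have *: "\<exists>g. continuous_on (A \<union> B) g \<and> g \<in> A \<union> B \<rightarrow> C \<and> g c = y \<and> (\<forall>z\<in>A \<union> B. p (g z) = h z)"
    if AB: "liftable C p h A" "liftable C p h B" "closed A" "closed B" "Topological_Spaces.connected (A \<inter> B)" "A \<inter> B \<noteq> {}"
      and c: "c \<in> A" "y \<in> C" "p y = h c" for A B c y
  proof -
    obtain g1 where g1: "continuous_on A g1" "g1 \<in> A \<rightarrow> C" "g1 c = y" "\<And>z. z \<in> A \<Longrightarrow> p (g1 z) = h z"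
      using AB(1) c unfolding liftable_def by metis
    obtain b where b: "b \<in> A" "b \<in> B" using AB by blast
    then have "g1 b \<in> C" "p (g1 b) = h b" using g1 by auto
    then obtain g2 where g2: "continuous_on B g2" "g2 \<in> B \<rightarrow> C" "g2 b = g1 b"
      "\<And>z. z \<in> B \<Longrightarrow> p (g2 z) = h z"
      using AB(2) b unfolding liftable_def by metis
    have eq: "g1 z = g2 z" if "z \<in> A \<inter> B" for z
      by (rule covering_space_lifts_agree[OF cov \<open>Topological_Spaces.connected (A \<inter> B)\<close>, of _ _ b])
        (use g1 g2 b that in \<open>auto intro: continuous_on_subset simp: Pi_iff\<close>)
    let ?g = "\<lambda>z. if z \<in> A then g1 z else g2 z"
    have "continuous_on (A \<union> B) ?g"
      using eq by (intro continuous_on_If) (auto simp: AB g1 g2)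
    then show ?thesis
      using g1 g2 c by (intro exI[of _ ?g]) (auto simp: Pi_iff)
  qed
  show ?thesis
    unfolding liftable_def
    using *[of A B] *[of B A] assms(2-) by (metis Int_commute Un_commute UnE)
qed

lemma liftable_evenly_covered:
  assumes "\<Union>\<V> = C \<inter> p -` W" "\<And>V. V \<in> \<V> \<Longrightarrow> \<exists>q. homeomorphism V W p q"
    and h: "continuous_on B h" "h \<in> B \<rightarrow> W"
  shows "liftable C p h B"
  unfolding liftable_def
proof (intro ballI impI)
  fix c y assume c: "c \<in> B" "y \<in> C" "p y = h c"
  then have "y \<in> \<Union>\<V>" using assms by auto
  then obtain V q where V: "V \<in> \<V>" "y \<in> V" "homeomorphism V W p q"
    using assms(2) by blast
  have "V \<subseteq> C" using V assms(1) by blast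
  show "\<exists>g. continuous_on B g \<and> g \<in> B \<rightarrow> C \<and> g c = y \<and> (\<forall>z\<in>B. p (g z) = h z)"
  proof (intro exI[of _ "q \<circ> h"] conjI)
    show "continuous_on B (q \<circ> h)"
      using h V(3) by (intro continuous_on_compose2[OF homeomorphism_cont2[OF V(3)]]
        continuous_on_compose continuous_on_subset[OF homeomorphism_cont2[OF V(3)]]) auto
      have "q w \<in> V" "p (q w) = w" if "w \<in> W" for w
      using V(3) that by (auto simp: homeomorphism_def)
    then show "q \<circ> h \<in> B \<rightarrow> C" "\<forall>z\<in>B. p ((q \<circ> h) z) = h z"
      using h(2) \<open>V \<subseteq> C\<close> by (auto simp: Pi_iff)
    show "(q \<circ> h) c = y"
      using V c by (metis comp_apply homeomorphism_apply1)
  qed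
qed

text \<open>Bisection replaces a Lebesgue number. Small rectangles land in an evenly covered set and
  lift by a local inverse of \<open>p\<close>; bisecting the second coordinate joins them to thin
  strips, and bisecting the first joins the strips to the square. The overlaps are segments, hence
  connected.\<close>

lemma liftable_unit_square:
  fixes h :: "real \<times> real \<Rightarrow> 'a::topological_space"
  assumes cov: "covering_space C p S"
    and h: "continuous_on ({0..1} \<times> {0..1}) h" "h \<in> {0..1} \<times> {0..1} \<rightarrow> S"
  shows "liftable C p h ({0..1} \<times> {0..1})"
proof -
  have near: "\<exists>d>0. \<forall>a b t u. 0 \<le> a \<and> a \<le> x \<and> x \<le> b \<and> b \<le> 1 \<and> b - a < d \<and>
      0 \<le> t \<and> t \<le> y \<and> y \<le> u \<and> u \<le> 1 \<and> u - t < d \<longrightarrow> liftable C p h ({a..b} \<times> {t..u})"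
    if xy: "x \<in> {0..1}" "y \<in> {0..1}" for x y
  proof -
    have "h (x, y) \<in> S" using h xy by auto
    then obtain W \<V> where W: "h (x, y) \<in> W" "openin (top_of_set S) W" "\<Union>\<V> = C \<inter> p -` W"
      and \<V>: "\<And>V. V \<in> \<V> \<Longrightarrow> \<exists>q. homeomorphism V W p q"
      by (rule covering_space_sheets[OF cov]) blast
    have "openin (top_of_set ({0..1} \<times> {0..1})) (({0..1} \<times> {0..1}) \<inter> h -` W)"
      using h W by (intro continuous_openin_preimage)
    moreover have "(x, y) \<in> ({0..1} \<times> {0..1}) \<inter> h -` W"
      using xy W by auto
    ultimately have "\<exists>e>0. \<forall>z\<in>{0..1} \<times> {0..1}. dist z (x, y) < e \<longrightarrow> z \<in> ({0..1} \<times> {0..1}) \<inter> h -` W"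
      unfolding openin_euclidean_subtopology_iff by (elim conjE) (rule bspec)
    then obtain e where e: "e > 0" "\<And>z. z \<in> {0..1} \<times> {0..1} \<Longrightarrow> dist z (x, y) < e \<Longrightarrow> h z \<in> W"
      by blast
    \<comment> \<open>\<open>e / 2\<close> because the product distance is at most the sum of the
      two coordinate distances.\<close>
    have "liftable C p h ({a..b} \<times> {t..u})"
      if ab: "0 \<le> a" "a \<le> x" "x \<le> b" "b \<le> 1" "b - a < e / 2"
        "0 \<le> t" "t \<le> y" "y \<le> u" "u \<le> 1" "u - t < e / 2" for a b t u
    proof (rule liftable_evenly_covered[OF W(3) \<V>])
      show "continuous_on ({a..b} \<times> {t..u}) h"
        using ab by (intro continuous_on_subset[OF h(1)]) auto
      show "h \<in> {a..b} \<times> {t..u} \<rightarrow> W"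
      proof
        fix z assume z: "z \<in> {a..b} \<times> {t..u}"
        have "dist z (x, y) \<le> dist (fst z) x + dist (snd z) y"
          unfolding dist_prod_def by (simp add: sqrt_sum_squares_le_sum)
        also have "\<dots> < e" using z ab by (auto simp: dist_real_def)
        finally show "h z \<in> W" using z ab by (intro e(2)) auto
      qed
    qed
    then show ?thesis using e(1) by (intro exI[of _ "e / 2"]) auto
  qed
  have strip: "\<exists>d>0. \<forall>a b. 0 \<le> a \<and> a \<le> x \<and> x \<le> b \<and> b \<le> 1 \<and> b - a < d \<longrightarrow>
      liftable C p h ({a..b} \<times> {0..1})" if x: "x \<in> {0..1}" for x
  proof -
    \<comment> \<open>The width \<open>d\<close> is bound inside \<open>P\<close>, so joining two
      intervals may shrink it to a minimum. The guards make \<open>P\<close> trivial for intervals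
      that leave the unit interval, which the local case of \<open>Bolzano\<close> also
      produces.\<close>
    define P where "P t u \<longleftrightarrow> (0 \<le> t \<longrightarrow> u \<le> 1 \<longrightarrow> (\<exists>d>0. \<forall>a b. 0 \<le> a \<and> a \<le> x \<and> x \<le> b \<and> b \<le> 1 \<and>
      b - a < d \<longrightarrow> liftable C p h ({a..b} \<times> {t..u})))" for t u
    have "(0::real) \<le> 1" by simp
    then have "P 0 1"
    proof (induct rule: Bolzano)
      case (trans r s t)
      show ?case
        unfolding P_def
      proof (intro impI)
        assume "0 \<le> r" "t \<le> 1"
        then have "s \<le> 1" "0 \<le> s" using trans(3,4) by auto
        obtain d1 where d1: "d1 > 0"
          "\<forall>a b. 0 \<le> a \<and> a \<le> x \<and> x \<le> b \<and> b \<le> 1 \<and> b - a < d1 \<longrightarrow> liftable C p h ({a..b} \<times> {r..s})"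
          using trans(1)[unfolded P_def, rule_format, OF \<open>0 \<le> r\<close> \<open>s \<le> 1\<close>] by (elim exE conjE)
        obtain d2 where d2: "d2 > 0"
          "\<forall>a b. 0 \<le> a \<and> a \<le> x \<and> x \<le> b \<and> b \<le> 1 \<and> b - a < d2 \<longrightarrow> liftable C p h ({a..b} \<times> {s..t})"
          using trans(2)[unfolded P_def, rule_format, OF \<open>0 \<le> s\<close> \<open>t \<le> 1\<close>] by (elim exE conjE)
        have "liftable C p h ({a..b} \<times> {r..t})"
          if ab: "0 \<le> a \<and> a \<le> x \<and> x \<le> b \<and> b \<le> 1 \<and> b - a < min d1 d2" for a b
        proof -
          have I: "({a..b} \<times> {r..s}) \<inter> ({a..b} \<times> {s..t}) = {a..b} \<times> {s}"
            using trans by auto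
          have "liftable C p h (({a..b} \<times> {r..s}) \<union> ({a..b} \<times> {s..t}))"
          proof (rule liftable_Un[OF cov])
            show "liftable C p h ({a..b} \<times> {r..s})" using d1(2) ab by simp
            show "liftable C p h ({a..b} \<times> {s..t})" using d2(2) ab by simp
          qed (use ab in \<open>auto simp: I intro!: closed_Times connected_Times\<close>)
          also have "({a..b} \<times> {r..s}) \<union> ({a..b} \<times> {s..t}) = {a..b} \<times> {r..t}"
            using trans by auto
          finally show ?thesis .
        qed
        then show "\<exists>d>0. \<forall>a b. 0 \<le> a \<and> a \<le> x \<and> x \<le> b \<and> b \<le> 1 \<and> b - a < d \<longrightarrow>
            liftable C p h ({a..b} \<times> {r..t})"
          using d1(1) d2(1) by (intro exI[of _ "min d1 d2"]) simp
      qed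
    next
      case (local y)
      then have "y \<in> {0..1}" by simp
      from near[OF x this] obtain d where d: "d > 0" "\<forall>a b t u. 0 \<le> a \<and> a \<le> x \<and> x \<le> b \<and> b \<le> 1 \<and> b - a < d \<and>
        0 \<le> t \<and> t \<le> y \<and> y \<le> u \<and> u \<le> 1 \<and> u - t < d \<longrightarrow> liftable C p h ({a..b} \<times> {t..u})"
        by (elim exE conjE)
      have "P t u" if "t \<le> y \<and> y \<le> u \<and> u - t < d" for t u
        unfolding P_def using d that by blast
      then show ?case using d(1) by blast
    qed
    then show ?thesis unfolding P_def by simp
  qed
  define P where "P a b \<longleftrightarrow> (0 \<le> a \<longrightarrow> b \<le> 1 \<longrightarrow> liftable C p h ({a..b} \<times> {0..1}))" for a b
  have "(0::real) \<le> 1" by simp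
  then have "P 0 1"
  proof (induct rule: Bolzano)
    case (trans a b c)
    show ?case
      unfolding P_def
    proof (intro impI)
      assume "0 \<le> a" "c \<le> 1"
      have I: "({a..b} \<times> {0..1::real}) \<inter> ({b..c} \<times> {0..1}) = {b} \<times> {0..1}"
        using trans by auto
      have "liftable C p h (({a..b} \<times> {0..1}) \<union> ({b..c} \<times> {0..1}))"
        using trans \<open>0 \<le> a\<close> \<open>c \<le> 1\<close> by (intro liftable_Un[OF cov])
          (auto simp: I P_def intro!: closed_Times connected_Times)
      also have "({a..b} \<times> {0..1}) \<union> ({b..c} \<times> {0..1}) = {a..c} \<times> {0..1::real}"
        using trans by auto
      finally show "liftable C p h ({a..c} \<times> {0..1})" .
    qed
  next
    case (local x)
    then show ?case
      unfolding P_def using strip[of x] by (metis atLeastAtMost_iff)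
  qed
  then show ?thesis unfolding P_def by simp
qed

text \<open>A path is lifted as the homotopy \<open>\<gamma> \<circ> fst\<close>, constant in the
  second coordinate; one side of the lifted square is the lifted path.\<close>

lemma covering_space_path_lift:
  assumes cov: "covering_space C p S" and "path \<gamma>" "path_image \<gamma> \<subseteq> S" "b \<in> C" "p b = \<gamma> 0"
  obtains \<beta> where "path \<beta>" "path_image \<beta> \<subseteq> C" "\<beta> 0 = b" "\<And>t. t \<in> {0..1} \<Longrightarrow> p (\<beta> t) = \<gamma> t"
proof -
  have "continuous_on ({0..1} \<times> {0..1::real}) (\<gamma> \<circ> fst)"
    by (rule continuous_on_compose) (use assms in \<open>auto simp: path_def intro: continuous_on_fst\<close>)
  moreover have "\<gamma> \<circ> fst \<in> {0..1} \<times> {0..1::real} \<rightarrow> S"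
    using assms by (auto simp: path_image_def)
  ultimately have lift: "liftable C p (\<gamma> \<circ> fst) ({0..1} \<times> {0..1::real})"
    by (rule liftable_unit_square[OF cov])
  have "(0, 0) \<in> {0..1::real} \<times> {0..1::real}" "p b = (\<gamma> \<circ> fst) (0, 0)" using assms by auto
  from this(1) \<open>b \<in> C\<close> this(2) obtain g where g: "continuous_on ({0..1} \<times> {0..1::real}) g" "g \<in> {0..1} \<times> {0..1} \<rightarrow> C"
    "g (0, 0) = b" "\<And>z. z \<in> {0..1} \<times> {0..1} \<Longrightarrow> p (g z) = (\<gamma> \<circ> fst) z"
    by (rule liftableE[OF lift]) blast
  show thesis
  proof
    show "path (\<lambda>t. g (t, 0))"
      unfolding path_def by (rule continuous_on_compose2[OF g(1)]) (auto intro!: continuous_intros)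
    show "path_image (\<lambda>t. g (t, 0)) \<subseteq> C" using g(2) by (auto simp: path_image_def)
    show "p (g (t, 0)) = \<gamma> t" if "t \<in> {0..1}" for t using g(4)[of "(t,0)"] that by auto
  qed (use g in auto)
qed

text \<open>Simple connectedness makes any two loops freely homotopic, in particular the constant
  loops at \<open>x\<close> and \<open>y\<close>; the track of the base point under such a homotopy
  is the required path.\<close>

lemma simply_connected_obtain_path:
  assumes "simply_connected S" "x \<in> S" "y \<in> S"
  obtains \<gamma> where "path \<gamma>" "path_image \<gamma> \<subseteq> S" "\<gamma> 0 = x" "\<gamma> 1 = y"
proof -
  have "homotopic_loops S (\<lambda>_. x) (\<lambda>_. y)"
    by (rule assms(1)[unfolded simply_connected_def, rule_format])
      (use assms in \<open>auto simp: path_def path_image_def pathstart_def pathfinish_def\<close>)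
  then obtain h where h: "continuous_on ({0..1::real} \<times> {0..1::real}) h" "h \<in> ({0..1} \<times> {0..1}) \<rightarrow> S"
    "\<forall>t\<in>{0..1}. h (0, t) = x" "\<forall>t\<in>{0..1}. h (1, t) = y"
    unfolding homotopic_loops by blast
  show thesis
  proof
    show "path (\<lambda>s. h (s, 0))"
      unfolding path_def by (rule continuous_on_compose2[OF h(1)]) (auto intro!: continuous_intros)
  qed (use h in \<open>auto simp: path_image_def\<close>)
qed

text \<open>Path components of open sets are open: by the weak topology it suffices to look at
  preimages under each \<open>r\<close>, and there a path connected neighbourhood inside the
  preimage of \<open>U\<close> has its image in a single path component of \<open>U\<close>.\<close>

lemma locally_path_connected_weak_topology:
  assumes D: "\<And>D r. (D, r) \<in> K \<Longrightarrow> locally path_connected D \<and> continuous_on D r \<and> r \<in> D \<rightarrow> S"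
    and weak: "\<And>U. U \<subseteq> S \<Longrightarrow> (\<And>D r. (D, r) \<in> K \<Longrightarrow> openin (top_of_set D) (D \<inter> r -` U)) \<Longrightarrow>
      openin (top_of_set S) U"
  shows "locally path_connected S"
  unfolding locally_path_connected_open_path_component
proof (intro allI impI, elim conjE)
  fix U x assume U: "openin (top_of_set S) U" "x \<in> U"
  show "openin (top_of_set S) (path_component_set U x)"
  proof (rule weak)
    show "path_component_set U x \<subseteq> S"
      using U path_component_subset openin_imp_subset by (metis order_trans)
    fix D r assume K: "(D, r) \<in> K"
    show "openin (top_of_set D) (D \<inter> r -` path_component_set U x)"
    proof (subst openin_subopen, intro ballI)
      fix z assume z: "z \<in> D \<inter> r -` path_component_set U x"
      then have "r z \<in> U" using path_component_subset by blast
      moreover have "openin (top_of_set D) (D \<inter> r -` U)"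
        using D[OF K] U by (intro continuous_openin_preimage) auto
      ultimately obtain V where V: "openin (top_of_set D) V" "path_connected V" "z \<in> V" "V \<subseteq> D \<inter> r -` U"
        using D[OF K] z unfolding locally_path_connected by (metis IntD1 IntI vimageI)
      have "path_connected (r ` V)"
        using V D[OF K] by (intro path_connected_continuous_image) (auto intro: continuous_on_subset)
      then have "r ` V \<subseteq> path_component_set U (r z)"
        using V by (intro path_component_maximal) auto
      also have "\<dots> = path_component_set U x"
        using z path_component_eq by fastforce
      finally show "\<exists>V. openin (top_of_set D) V \<and> z \<in> V \<and> V \<subseteq> D \<inter> r -` path_component_set U x"
        using V by blast
    qed
  qed
qed

lemma continuous_on_locally:
  assumes "\<And>x. x \<in> S \<Longrightarrow> \<exists>M. openin (top_of_set S) M \<and> x \<in> M \<and> continuous_on M f"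
  shows "continuous_on S f"
  unfolding continuous_on_topological
proof (intro ballI allI impI)
  fix x B assume x: "x \<in> S" "open B" "f x \<in> B"
  then obtain M where M: "openin (top_of_set S) M" "x \<in> M" "continuous_on M f"
    using assms by blast
  obtain O1 where O1: "open O1" "M = S \<inter> O1"
    using M(1) unfolding openin_open by blast
  obtain O2 where O2: "open O2" "x \<in> O2" "\<forall>y\<in>M. y \<in> O2 \<longrightarrow> f y \<in> B"
    using M x unfolding continuous_on_topological by metis
  show "\<exists>A. open A \<and> x \<in> A \<and> (\<forall>y\<in>S. y \<in> A \<longrightarrow> f y \<in> B)"
    using O1 O2 M(2) by (intro exI[of _ "O1 \<inter> O2"]) auto
qed

text \<open>Contract \<open>\<alpha>\<close> to a point, project the homotopy, and lift it from
  \<open>\<beta> 0\<close>. The side \<open>s = 0\<close> of the lift is \<open>\<beta>\<close>, and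
  the side \<open>s = 1\<close> is constant because it lies over a point.\<close>

lemma lift_of_loop_closed:
  assumes cov: "covering_space C p S" and sc: "simply_connected C"
    and \<alpha>: "path \<alpha>" "path_image \<alpha> \<subseteq> C" "\<alpha> 1 = \<alpha> 0"
    and \<beta>: "path \<beta>" "path_image \<beta> \<subseteq> C" "\<And>t. t \<in> {0..1} \<Longrightarrow> p (\<beta> t) = p (\<alpha> t)"
  shows "\<beta> 1 = \<beta> 0"
proof -
  have "\<alpha> 0 \<in> C" using \<alpha>(2) by (auto simp: path_image_def)
  then have "homotopic_loops C \<alpha> (\<lambda>_. \<alpha> 0)"
    by (intro sc[unfolded simply_connected_def, rule_format])
      (use \<alpha> in \<open>auto simp: path_def path_image_def pathstart_def pathfinish_def\<close>)
  then obtain h where h: "continuous_on ({0..1::real} \<times> {0..1::real}) h" "h \<in> ({0..1} \<times> {0..1}) \<rightarrow> C"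
    "\<forall>t\<in>{0..1}. h (0, t) = \<alpha> t" "\<forall>t\<in>{0..1}. h (1, t) = \<alpha> 0" "\<forall>s\<in>{0..1}. h (s, 1) = h (s, 0)"
    unfolding homotopic_loops pathstart_def pathfinish_def comp_apply by blast
  have ph: "continuous_on ({0..1} \<times> {0..1}) (p \<circ> h)" "p \<circ> h \<in> {0..1} \<times> {0..1} \<rightarrow> S"
    using h(2) covering_space_imp_surjective[OF cov]
    by (auto simp: o_def intro: continuous_on_compose2[OF covering_space_imp_continuous[OF cov] h(1)])
  have "(0, 0) \<in> {0..1::real} \<times> {0..1::real}" "\<beta> 0 \<in> C" "p (\<beta> 0) = (p \<circ> h) (0, 0)"
    using h \<beta> by (auto simp: path_image_def)
  then obtain g where g: "continuous_on ({0..1} \<times> {0..1::real}) g" "g \<in> {0..1} \<times> {0..1} \<rightarrow> C"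
    "g (0, 0) = \<beta> 0" "\<And>z. z \<in> {0..1} \<times> {0..1} \<Longrightarrow> p (g z) = (p \<circ> h) z"
    by (rule liftableE[OF liftable_unit_square[OF cov ph]]) blast
  have line: "continuous_on {0..1} (\<lambda>t. g (s, t))" "continuous_on {0..1} (\<lambda>t. g (t, s))"
    if "s \<in> {0..1}" for s
    using that by (auto intro!: continuous_intros continuous_on_compose2[OF g(1)])
  have C: "g (s, t) \<in> C" "p (g (s, t)) = p (h (s, t))" if "s \<in> {0..1}" "t \<in> {0..1}" for s t
    using that g(2) g(4)[of "(s, t)"] by auto
  have conn: "Topological_Spaces.connected {0..1::real}" by simp
  have 1: "g (0, t) = \<beta> t" if "t \<in> {0..1}" for t
    using conn by (rule covering_space_lifts_agree[OF cov, of "{0..1}" "\<lambda>t. g (0, t)" \<beta> 0])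
      (use line C \<beta> h g(3) that in \<open>auto simp: path_def path_image_def\<close>)
  have 2: "g (1, t) = g (1, 0)" if "t \<in> {0..1}" for t
    using conn by (rule covering_space_lifts_agree[OF cov, of "{0..1}" "\<lambda>t. g (1, t)" "\<lambda>t. g (1, 0)" 0])
      (use line C h that in auto)
  \<comment> \<open>These two sides lie over the same path, since the homotopy runs through loops.
    They are compared from \<open>s = 1\<close>, where both take the value of the constant side;
    reaching \<open>s = 0\<close> closes \<open>\<beta>\<close>.\<close>
  have 3: "g (s, 1) = g (s, 0)" if "s \<in> {0..1}" for s
    using conn by (rule covering_space_lifts_agree[OF cov, of "{0..1}" "\<lambda>s. g (s, 1)" "\<lambda>s. g (s, 0)" 1])
      (use line C h that 2[of 1] in auto)
  show ?thesis using 1[of 0] 1[of 1] 3[of 0] by simp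
qed

section \<open>Deck transformations from path components of the fibre product\<close>

definition fibre_product :: "'b set \<Rightarrow> ('b \<Rightarrow> 'a) \<Rightarrow> ('b \<times> 'b) set" where
  "fibre_product C p = {(x, y). x \<in> C \<and> y \<in> C \<and> p x = p y}"

text \<open>A path in the fibre product is a pair of lifts of one path in the base. Join
  \<open>a\<close> to \<open>x\<close>, project, and lift again from \<open>b\<close>; the end of
  the second lift is the partner of \<open>x\<close>.\<close>

lemma fibre_product_component_total:
  assumes cov: "covering_space C p S" and sc: "simply_connected C"
    and ab: "(a, b) \<in> fibre_product C p" and x: "x \<in> C"
  shows "\<exists>y. path_component (fibre_product C p) (a, b) (x, y)"
proof -
  obtain \<alpha> where \<alpha>: "path \<alpha>" "path_image \<alpha> \<subseteq> C" "\<alpha> 0 = a" "\<alpha> 1 = x"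
    using simply_connected_obtain_path[OF sc _ x, of a] ab by (auto simp: fibre_product_def)
  have "path (p \<circ> \<alpha>)"
    using \<alpha> covering_space_imp_continuous[OF cov] by (auto intro!: path_continuous_image intro: continuous_on_subset)
  moreover have "path_image (p \<circ> \<alpha>) \<subseteq> S"
    using \<alpha> covering_space_imp_surjective[OF cov] by (auto simp: path_image_def)
  moreover have "b \<in> C" "p b = (p \<circ> \<alpha>) 0"
    using ab \<alpha> by (auto simp: fibre_product_def)
  ultimately obtain \<beta> where \<beta>: "path \<beta>" "path_image \<beta> \<subseteq> C" "\<beta> 0 = b"
    "\<And>t. t \<in> {0..1} \<Longrightarrow> p (\<beta> t) = (p \<circ> \<alpha>) t"
    by (rule covering_space_path_lift[OF cov]) blast
  have "path_component (fibre_product C p) (a, b) (x, \<beta> 1)"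
    unfolding path_component_def
  proof (intro exI conjI)
    show "path (\<lambda>t. (\<alpha> t, \<beta> t))"
      using \<alpha> \<beta> by (auto simp: path_def intro: continuous_on_Pair)
    show "path_image (\<lambda>t. (\<alpha> t, \<beta> t)) \<subseteq> fibre_product C p"
      using \<alpha> \<beta> by (auto simp: path_image_def fibre_product_def)
  qed (use \<alpha> \<beta> in \<open>auto simp: pathstart_def pathfinish_def\<close>)
  then show ?thesis ..
qed

text \<open>Along a path from \<open>(x, y)\<close> to \<open>(x, y')\<close> the first coordinate
  is a loop, and the second is another lift of its projection, hence a loop too.\<close>

lemma fibre_product_component_unique:
  assumes cov: "covering_space C p S" and sc: "simply_connected C"
    and y: "path_component (fibre_product C p) (a, b) (x, y)"
      "path_component (fibre_product C p) (a, b) (x, y')"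
  shows "y = y'"
proof -
  have "path_component (fibre_product C p) (x, y) (x, y')"
    using y path_component_trans path_component_sym by meson
  then obtain \<gamma> where \<gamma>: "path \<gamma>" "path_image \<gamma> \<subseteq> fibre_product C p" "\<gamma> 0 = (x, y)" "\<gamma> 1 = (x, y')"
    unfolding path_component_def pathstart_def pathfinish_def by metis
  have Z: "\<gamma> t \<in> fibre_product C p" if "t \<in> {0..1}" for t
    using \<gamma>(2) that by (auto simp: path_image_def)
  have "snd (\<gamma> 1) = snd (\<gamma> 0)"
  proof (rule lift_of_loop_closed[OF cov sc])
    show "path (\<lambda>t. fst (\<gamma> t))" "path (\<lambda>t. snd (\<gamma> t))"
      using \<gamma>(1) unfolding path_def by (auto intro: continuous_on_fst continuous_on_snd)
    show "path_image (\<lambda>t. fst (\<gamma> t)) \<subseteq> C" "path_image (\<lambda>t. snd (\<gamma> t)) \<subseteq> C"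
      using Z by (fastforce simp: path_image_def fibre_product_def)+
    show "p (snd (\<gamma> t)) = p (fst (\<gamma> t))" if "t \<in> {0..1}" for t
      using Z[OF that] by (auto simp: fibre_product_def)
  qed (use \<gamma> in simp)
  with \<gamma> show ?thesis by simp
qed

text \<open>This relates the component of \<open>(b, a)\<close> to the converse of that of
  \<open>(a, b)\<close>, so that the maps which they define are mutually inverse.\<close>

lemma fibre_product_component_swap:
  assumes "path_component (fibre_product C p) (a, b) (x, y)"
  shows "path_component (fibre_product C p) (b, a) (y, x)"
proof -
  obtain \<gamma> where \<gamma>: "path \<gamma>" "path_image \<gamma> \<subseteq> fibre_product C p" "\<gamma> 0 = (a, b)" "\<gamma> 1 = (x, y)"
    using assms unfolding path_component_def pathstart_def pathfinish_def by metis
  show ?thesis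
    unfolding path_component_def
  proof (intro exI conjI)
    show "path (\<lambda>t. prod.swap (\<gamma> t))"
      using \<gamma> unfolding path_def prod.swap_def
      by (intro continuous_on_Pair continuous_on_fst continuous_on_snd)
    show "path_image (\<lambda>t. prod.swap (\<gamma> t)) \<subseteq> fibre_product C p"
      using \<gamma> by (force simp: path_image_def fibre_product_def)
  qed (use \<gamma> in \<open>auto simp: pathstart_def pathfinish_def\<close>)
qed

text \<open>Near \<open>x0\<close> the map is \<open>q2 \<circ> p\<close>, with \<open>q2\<close>
  inverse to \<open>p\<close> on the sheet of \<open>g x0\<close>. A path inside \<open>W\<close>
  from \<open>p x0\<close> to \<open>p x\<close> lifts to both sheets and keeps the pair in its
  component; local path connectedness supplies such paths for all \<open>x\<close> near
  \<open>x0\<close>.\<close>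

lemma fibre_product_component_graph_continuous:
  assumes cov: "covering_space C p S" and sc: "simply_connected C" and lpc: "locally path_connected S"
    and g: "\<And>x. x \<in> C \<Longrightarrow> path_component (fibre_product C p) (a, b) (x, g x)"
  shows "continuous_on C g"
proof (rule continuous_on_locally)
  fix x0 assume x0: "x0 \<in> C"
  have gx0: "(x0, g x0) \<in> fibre_product C p" using g[OF x0] path_component_mem(2) by metis
  have "p x0 \<in> S" using x0 covering_space_imp_surjective[OF cov] by blast
  then obtain W \<V> where W: "p x0 \<in> W" "openin (top_of_set S) W" "\<Union>\<V> = C \<inter> p -` W"
    and \<V>: "\<And>V. V \<in> \<V> \<Longrightarrow> openin (top_of_set C) V" "\<And>V. V \<in> \<V> \<Longrightarrow> \<exists>q. homeomorphism V W p q"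
    by (rule covering_space_sheets[OF cov]) blast
  have "x0 \<in> \<Union>\<V>" "g x0 \<in> \<Union>\<V>"
    using W gx0 by (auto simp: fibre_product_def)
  then obtain V1 V2 where V: "V1 \<in> \<V>" "V2 \<in> \<V>" "x0 \<in> V1" "g x0 \<in> V2" by blast
  obtain q1 q2 where q: "homeomorphism V1 W p q1" "homeomorphism V2 W p q2"
    using V \<V> by blast
  obtain N where N: "openin (top_of_set S) N" "path_connected N" "p x0 \<in> N" "N \<subseteq> W"
    using lpc W unfolding locally_path_connected by meson
  have VC: "V1 \<subseteq> C" "V2 \<subseteq> C" using V W by blast+
  let ?M = "V1 \<inter> (C \<inter> p -` N)"
  have M: "openin (top_of_set C) ?M"
    using V \<V> N cov covering_space_imp_surjective[OF cov]
    by (intro openin_Int continuous_openin_preimage[of _ _ S] covering_space_imp_continuous[OF cov]) auto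
  have eq: "g x = q2 (p x)" if x: "x \<in> ?M" for x
  proof -
    obtain \<delta> where \<delta>: "path \<delta>" "path_image \<delta> \<subseteq> N" "\<delta> 0 = p x0" "\<delta> 1 = p x"
      using N x unfolding path_connected_def pathstart_def pathfinish_def by blast
    have \<delta>W: "\<delta> t \<in> W" if "t \<in> {0..1}" for t
      using that \<delta>(2) N(4) by (auto simp: path_image_def image_subset_iff)
    have "path_component (fibre_product C p) (x0, g x0) (x, q2 (p x))"
      unfolding path_component_def
    proof (intro exI conjI)
      show "path (\<lambda>t. (q1 (\<delta> t), q2 (\<delta> t)))"
        unfolding path_def
        by (intro continuous_on_Pair continuous_on_compose2[OF homeomorphism_cont2[OF q(1)]]
            continuous_on_compose2[OF homeomorphism_cont2[OF q(2)]] \<delta>(1)[unfolded path_def])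
          (use \<delta>W in auto)
      have "q1 w \<in> V1" "q2 w \<in> V2" "p (q1 w) = w" "p (q2 w) = w" if "w \<in> W" for w
        using that homeomorphism_image2[OF q(1)] homeomorphism_image2[OF q(2)]
          homeomorphism_apply2[OF q(1)] homeomorphism_apply2[OF q(2)] by auto
      then show "path_image (\<lambda>t. (q1 (\<delta> t), q2 (\<delta> t))) \<subseteq> fibre_product C p"
        using \<delta>W VC by (auto simp: path_image_def fibre_product_def)
      have "p x0 = p (g x0)" using gx0 by (simp add: fibre_product_def)
      then have "q2 (p x0) = g x0"
        using homeomorphism_apply1[OF q(2) V(4)] by simp
      moreover have "q1 (p x0) = x0" "q1 (p x) = x"
        using homeomorphism_apply1[OF q(1)] V x by auto
      ultimately show "pathstart (\<lambda>t. (q1 (\<delta> t), q2 (\<delta> t))) = (x0, g x0)"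
        "pathfinish (\<lambda>t. (q1 (\<delta> t), q2 (\<delta> t))) = (x, q2 (p x))"
        using \<delta> by (auto simp: pathstart_def pathfinish_def)
    qed
    with g[OF x0] have "path_component (fibre_product C p) (a, b) (x, q2 (p x))"
      by (rule path_component_trans)
    then show ?thesis
      using fibre_product_component_unique[OF cov sc g] x by blast
  qed
  have "continuous_on ?M (\<lambda>x. q2 (p x))"
    by (rule continuous_on_compose2[OF homeomorphism_cont2[OF q(2)]])
      (use N in \<open>auto intro: continuous_on_subset[OF covering_space_imp_continuous[OF cov]]\<close>)
  then have "continuous_on ?M g"
    by (rule continuous_on_eq) (rule eq[symmetric])
  then show "\<exists>M. openin (top_of_set C) M \<and> x0 \<in> M \<and> continuous_on M g"
    using M V N x0 by blast
qed

text \<open>The graph of the deck transformation is the path component of \<open>(a, b)\<close> in the fibre product.\<close>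

lemma simply_connected_cover_deck_transitive:
  assumes cov: "covering_space C p S" and sc: "simply_connected C" and lpc: "locally path_connected S"
    and ab: "a \<in> C" "b \<in> C" "p a = p b"
  obtains g where "deck_transformation C p g" "continuous_on C g" "g \<in> C \<rightarrow> C" "g a = b"
proof -
  let ?Z = "fibre_product C p"
  have Z: "(a, b) \<in> ?Z" "(b, a) \<in> ?Z" using ab by (auto simp: fibre_product_def)
  obtain g where g: "\<And>x. x \<in> C \<Longrightarrow> path_component ?Z (a, b) (x, g x)"
    using fibre_product_component_total[OF cov sc Z(1)] by metis
  obtain h where h: "\<And>x. x \<in> C \<Longrightarrow> path_component ?Z (b, a) (x, h x)"
    using fibre_product_component_total[OF cov sc Z(2)] by metis
  have gC: "g x \<in> C" "p (g x) = p x" if "x \<in> C" for x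
    using path_component_mem(2)[OF g[OF that]] by (auto simp: fibre_product_def)
  have hC: "h x \<in> C" if "x \<in> C" for x
    using path_component_mem(2)[OF h[OF that]] by (auto simp: fibre_product_def)
  have hg: "h (g x) = x" if "x \<in> C" for x
    using fibre_product_component_unique[OF cov sc h[OF gC(1)[OF that]]
      fibre_product_component_swap[OF g[OF that]]] .
  have gh: "g (h x) = x" if "x \<in> C" for x
    using fibre_product_component_unique[OF cov sc g[OF hC[OF that]]
      fibre_product_component_swap[OF h[OF that]]] .
  have cont: "continuous_on C g" "continuous_on C h"
    using fibre_product_component_graph_continuous[OF cov sc lpc] g h by blast+
  have "homeomorphism C C g h"
    using cont gC hC hg gh by (auto intro!: homeomorphismI)
  moreover have "g a = b"
    using fibre_product_component_unique[OF cov sc g[OF ab(1)]] Z by (simp add: path_component_refl)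
  ultimately show thesis
    using that[of g] cont gC unfolding deck_transformation_def by blast
qed

section \<open>Cells of a product of trees\<close>

text \<open>Straight segments stay in the box by convexity of each factor, and they are continuous
  in the product topology because every coordinate is.\<close>

lemma path_connected_box:
  fixes Y :: "'i \<Rightarrow> real set"
  assumes "\<And>i. convex (Y i)"
  shows "path_connected {x. \<forall>i. x i \<in> Y i}"
  unfolding path_connected_def
proof (intro ballI)
  fix x y assume xy: "x \<in> {x. \<forall>i. x i \<in> Y i}" "y \<in> {x. \<forall>i. x i \<in> Y i}"
  have *: "(1 - t) * x i + t * y i \<in> Y i" if "t \<in> {0..1}" for t i
    using convexD[OF assms, of "x i" i "y i" "1 - t" t] xy that by simp
  show "\<exists>g. path g \<and> path_image g \<subseteq> {x. \<forall>i. x i \<in> Y i} \<and> pathstart g = x \<and> pathfinish g = y"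
  proof (intro exI conjI)
    show "path (\<lambda>t i. (1 - t) * x i + t * y i)"
      unfolding path_def by (intro continuous_on_coordinatewise_then_product continuous_intros)
    show "path_image (\<lambda>t i. (1 - t) * x i + t * y i) \<subseteq> {x. \<forall>i. x i \<in> Y i}"
      unfolding path_image_def using * by blast
  qed (simp_all add: pathstart_def pathfinish_def)
qed

text \<open>The value \<open>undefined\<close> off \<open>I\<close> counts as a one-point factor,
  which turns a set of extensional functions into a box over the whole index type.\<close>

lemma PiE_eq_box: "(\<Pi>\<^sub>E i\<in>I. A i) = {x. \<forall>i. x i \<in> (if i \<in> I then A i else {undefined})}"
proof (rule set_eqI)
  fix x
  have "x i \<in> (if i \<in> I then A i else {undefined}) \<longleftrightarrow> (i \<in> I \<longrightarrow> x i \<in> A i) \<and> (i \<notin> I \<longrightarrow> x i = undefined)" for i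
    by simp
  then show "x \<in> Pi\<^sub>E I A \<longleftrightarrow> x \<in> {x. \<forall>i. x i \<in> (if i \<in> I then A i else {undefined})}"
    unfolding PiE_iff extensional_def mem_Collect_eq by blast
qed

lemma cube_eq_box: "cube n = {x. \<forall>i. x i \<in> (if i < n then {0..1} else {undefined})}"
  unfolding cube_def PiE_eq_box by simp

lemma connected_cube: "Topological_Spaces.connected (cube n)"
  unfolding cube_eq_box by (intro path_connected_imp_connected path_connected_box) auto

text \<open>A basic neighbourhood shrinks to a box whose factors are open intervals or the whole
  line; cut with the cube, each factor is convex.\<close>

lemma locally_path_connected_cube: "locally path_connected (cube n)"
  unfolding locally_path_connected
proof (intro allI impI, elim conjE)
  fix V x assume "openin (top_of_set (cube n)) V" and x: "x \<in> V"
  then obtain U where U: "open U" "V = cube n \<inter> U" unfolding openin_open by blast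
  have "openin (product_topology (\<lambda>i. euclidean) UNIV) U" "x \<in> U"
    using U x unfolding open_fun_def by auto
  from product_topology_open_contains_basis[OF this]
  obtain Y where Y: "x \<in> (\<Pi>\<^sub>E i\<in>UNIV. Y i)" "\<And>i. open (Y i)" "finite {i. Y i \<noteq> UNIV}" "(\<Pi>\<^sub>E i\<in>UNIV. Y i) \<subseteq> U"
    by auto
  have "\<forall>i. \<exists>e>0. ball (x i) e \<subseteq> Y i"
    using Y(1,2) by (metis PiE_E UNIV_I open_contains_ball)
  then obtain e where e: "\<And>i. e i > 0" "\<And>i. ball (x i) (e i) \<subseteq> Y i" by metis
  \<comment> \<open>Full factors stay full: the box is open only if finitely many coordinates are
    restricted.\<close>
  define Z where "Z i = (if Y i = UNIV then UNIV else ball (x i) (e i))" for i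
  have Z: "open (Pi\<^sub>E UNIV Z)"
    by (rule open_PiE) (auto simp: Z_def intro: finite_subset[OF _ Y(3)])
  have ZY: "Pi\<^sub>E UNIV Z \<subseteq> U"
    using Y(4) e(2) by (fastforce simp: Z_def PiE_iff split: if_splits)
  have "path_connected {y. \<forall>i. y i \<in> (if i < n then {0..1} else {undefined}) \<inter> Z i}"
    by (intro path_connected_box convex_Int) (auto simp: Z_def)
  also have "{y. \<forall>i. y i \<in> (if i < n then {0..1} else {undefined}) \<inter> Z i} = cube n \<inter> Pi\<^sub>E UNIV Z"
    by (auto simp: cube_eq_box PiE_iff)
  finally have "path_connected (cube n \<inter> Pi\<^sub>E UNIV Z)" .
  moreover have "openin (top_of_set (cube n)) (cube n \<inter> Pi\<^sub>E UNIV Z)"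
    using Z by (auto simp: openin_open)
  moreover have "x \<in> cube n \<inter> Pi\<^sub>E UNIV Z" using x U e(1) by (auto simp: Z_def)
  ultimately show "\<exists>W. openin (top_of_set (cube n)) W \<and> path_connected W \<and> x \<in> W \<and> W \<subseteq> V"
    using ZY U by (intro exI[of _ "cube n \<inter> Pi\<^sub>E UNIV Z"]) auto
qed

lemma cube_complexD:
  assumes X: "is_cube_complex X"
  shows charmap_PiE: "q \<in> charmaps X n \<Longrightarrow> q \<in> cube n \<rightarrow>\<^sub>E underlying X"
    and charmap_continuous: "q \<in> charmaps X n \<Longrightarrow> continuous_on (cube n) q"
    and charmap_inj: "q \<in> charmaps X n \<Longrightarrow> inj_on q (open_cube n)"
    and charmap_overlap: "q \<in> charmaps X m \<Longrightarrow> r \<in> charmaps X n \<Longrightarrow>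
      q ` open_cube m \<inter> r ` open_cube n \<noteq> {} \<Longrightarrow> m = n \<and> (\<exists>g\<in>cube_syms n. r = compose (cube n) q g)"
    and weak_topology: "U \<subseteq> underlying X \<Longrightarrow>
      (\<And>n q. q \<in> charmaps X n \<Longrightarrow> openin (top_of_set (cube n)) (cube n \<inter> q -` U)) \<Longrightarrow>
      openin (top_of_set (underlying X)) U"
  using X[unfolded is_cube_complex_def, THEN conjunct1]
    X[unfolded is_cube_complex_def, THEN conjunct2, THEN conjunct2, THEN conjunct2, THEN conjunct2, THEN conjunct1]
    X[unfolded is_cube_complex_def, THEN conjunct2, THEN conjunct2, THEN conjunct2, THEN conjunct2, THEN conjunct2]
  by simp_all

lemma cube_complex_locally_path_connected:
  assumes X: "is_cube_complex X"
  shows "locally path_connected (underlying X)"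
proof (rule locally_path_connected_weak_topology[where K="{(cube n, q) | n q. q \<in> charmaps X n}"])
  fix D r assume "(D, r) \<in> {(cube n, q) | n q. q \<in> charmaps X n}"
  then obtain n where "D = cube n" "r \<in> charmaps X n" by blast
  then show "locally path_connected D \<and> continuous_on D r \<and> r \<in> D \<rightarrow> underlying X"
    using locally_path_connected_cube charmap_PiE[OF X] charmap_continuous[OF X]
    by (simp add: PiE_def)
next
  fix U assume U: "U \<subseteq> underlying X"
    "\<And>D r. (D, r) \<in> {(cube n, q) | n q. q \<in> charmaps X n} \<Longrightarrow> openin (top_of_set D) (D \<inter> r -` U)"
  show "openin (top_of_set (underlying X)) U"
    using U(1) by (rule weak_topology[OF X]) (rule U(2), blast)
qed

section \<open>Symmetries of the cube and cells of a product of trees\<close>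

definition cube_sym :: "nat \<Rightarrow> (nat \<Rightarrow> nat) \<Rightarrow> nat set \<Rightarrow> (nat \<Rightarrow> real) \<Rightarrow> (nat \<Rightarrow> real)" where
  "cube_sym n \<pi> F = (\<lambda>x\<in>cube n. \<lambda>i\<in>{..<n}. if i \<in> F then 1 - x (\<pi> i) else x (\<pi> i))"

lemma cube_syms_eq: "cube_syms n = {cube_sym n \<pi> F | \<pi> F. \<pi> permutes {..<n}}"
  unfolding cube_syms_def cube_sym_def ..

lemma open_cube_subset_cube: "open_cube n \<subseteq> cube n"
  unfolding open_cube_def cube_def by (rule PiE_mono) auto

lemma cube_sym_in_cube:
  assumes \<pi>: "\<pi> permutes {..<n}" and x: "x \<in> cube n"
  shows "cube_sym n \<pi> F x \<in> cube n"
proof -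
  have "\<pi> i \<in> {..<n}" if "i \<in> {..<n}" for i using that permutes_in_image[OF \<pi>, of i] by simp
  then have "x (\<pi> i) \<in> {0..1}" if "i \<in> {..<n}" for i
    using that x unfolding cube_def by (metis PiE_mem)
  then show ?thesis using x by (auto simp: cube_sym_def cube_def)
qed

lemma cube_sym_in_open_cube:
  assumes \<pi>: "\<pi> permutes {..<n}" and x: "x \<in> open_cube n"
  shows "cube_sym n \<pi> F x \<in> open_cube n"
proof -
  have "\<pi> i \<in> {..<n}" if "i \<in> {..<n}" for i using that permutes_in_image[OF \<pi>, of i] by simp
  then have "x (\<pi> i) \<in> {0<..<1}" if "i \<in> {..<n}" for i
    using that x unfolding open_cube_def by (metis PiE_mem)
  moreover have "x \<in> cube n" using x open_cube_subset_cube by blast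
  ultimately show ?thesis by (auto simp: cube_sym_def open_cube_def)
qed

definition product_cell ::
  "nat \<Rightarrow> nat \<Rightarrow> (nat \<Rightarrow> nat) \<Rightarrow> (nat \<Rightarrow> 'v) \<Rightarrow> (nat \<Rightarrow> 'v) \<Rightarrow> (nat \<Rightarrow> real) \<Rightarrow> nat \<Rightarrow> 'v \<Rightarrow> real" where
  "product_cell k n \<iota> u w = (\<lambda>x\<in>cube n. \<lambda>j\<in>{..<k}.
     if j \<in> \<iota> ` {..<n} then edge_point (u j) (w j) (x (inv_into {..<n} \<iota> j)) else indicator {u j})"

lemma charmaps_tree_product:
  "charmaps (tree_product k T) n = {product_cell k n \<iota> u w | \<iota> u w.
     inj_on \<iota> {..<n} \<and> \<iota> ` {..<n} \<subseteq> {..<k} \<and> (\<forall>j\<in>\<iota> ` {..<n}. (u j, w j) \<in> parcs (T j)) \<and>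
     (\<forall>j\<in>{..<k} - \<iota> ` {..<n}. u j \<in> pverts (T j))}"
  by (simp add: tree_product_def product_cell_def)

lemma product_cell_in_charmaps:
  assumes "inj_on \<iota> {..<n}" "\<iota> ` {..<n} \<subseteq> {..<k}" "\<And>j. j \<in> \<iota> ` {..<n} \<Longrightarrow> (u j, w j) \<in> parcs (T j)"
    "\<And>j. j \<in> {..<k} - \<iota> ` {..<n} \<Longrightarrow> u j \<in> pverts (T j)"
  shows "product_cell k n \<iota> u w \<in> charmaps (tree_product k T) n"
  unfolding charmaps_tree_product mem_Collect_eq
  using assms by (intro exI[of _ \<iota>] exI[of _ u] exI[of _ w] conjI ballI) simp_all

lemma product_cellE:
  assumes "q \<in> charmaps (tree_product k T) n"
  obtains \<iota> u w where "q = product_cell k n \<iota> u w" "inj_on \<iota> {..<n}" "\<iota> ` {..<n} \<subseteq> {..<k}"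
    "\<And>j. j \<in> \<iota> ` {..<n} \<Longrightarrow> (u j, w j) \<in> parcs (T j)" "\<And>j. j \<in> {..<k} - \<iota> ` {..<n} \<Longrightarrow> u j \<in> pverts (T j)"
  using assms unfolding charmaps_tree_product mem_Collect_eq
  by (elim exE conjE) (rule that; (assumption | (drule(1) bspec, assumption)))

lemma edge_point_0 [simp]: "edge_point u w 0 = indicator {u}"
  and edge_point_1 [simp]: "edge_point u w 1 = indicator {w}"
  by (auto simp: edge_point_def)

lemma edge_point_flip: "edge_point u w (1 - t) = edge_point w u t"
  by (auto simp: edge_point_def)

lemma indicator_singleton_eq [simp]: "(indicator {u} :: 'v \<Rightarrow> real) = indicator {w} \<longleftrightarrow> u = w"
  by (metis indicator_simps(1,2) insertI1 singletonD zero_neq_one)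

lemma continuous_on_product_cell: "continuous_on (cube n) (product_cell k n \<iota> u w)"
proof (intro continuous_on_coordinatewise_then_product)
  fix j z
  have c: "continuous_on (cube n) (\<lambda>x::nat \<Rightarrow> real. x i)" for i
    by (rule continuous_on_subset[OF continuous_on_product_coordinates]) auto
  have "continuous_on (cube n) (\<lambda>x. if j < k then if j \<in> \<iota> ` {..<n} then
      (1 - x (inv_into {..<n} \<iota> j)) * indicator {u j} z + x (inv_into {..<n} \<iota> j) * indicator {w j} z
      else indicator {u j} z else undefined z)"
    by (cases "j < k"; cases "j \<in> \<iota> ` {..<n}"; simp only: if_True if_False; intro continuous_intros c)
  then show "continuous_on (cube n) (\<lambda>x. product_cell k n \<iota> u w x j z)"
    by (rule continuous_on_eq) (auto simp: product_cell_def edge_point_def)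
qed

lemma product_cell_in_underlying:
  assumes "inj_on \<iota> {..<n}" "\<And>j. j \<in> \<iota> ` {..<n} \<Longrightarrow> (u j, w j) \<in> parcs (T j)"
    "\<And>j. j \<in> {..<k} - \<iota> ` {..<n} \<Longrightarrow> u j \<in> pverts (T j)" "x \<in> cube n"
  shows "product_cell k n \<iota> u w x \<in> underlying (tree_product k T)"
proof -
  have "x (inv_into {..<n} \<iota> j) \<in> {0..1}" if "j \<in> \<iota> ` {..<n}" for j
    using inv_into_into[OF that] assms(4) by (auto simp: cube_def PiE_iff)
  then have "(if j \<in> \<iota> ` {..<n} then edge_point (u j) (w j) (x (inv_into {..<n} \<iota> j)) else indicator {u j})
      \<in> realization (T j)" if "j \<in> {..<k}" for j
    using assms(2)[of j] assms(3)[of j] that unfolding realization_def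
    by (cases "j \<in> \<iota> ` {..<n}"; simp only: if_True if_False) blast+
  then show ?thesis
    using assms(4) unfolding tree_product_def product_cell_def by simp
qed

text \<open>The cell moves exactly in the coordinates \<open>J\<close> where \<open>f\<close> is not
  a vertex of the tree. There the edge parameter is neither 0 nor 1, as those values give vertices,
  so it is interior; an enumeration of \<open>J\<close> supplies the directions.\<close>

lemma tree_product_open_cells_cover:
  assumes f: "f \<in> underlying (tree_product k T)"
    and verts: "\<And>i a b. i < k \<Longrightarrow> (a, b) \<in> parcs (T i) \<Longrightarrow> a \<in> pverts (T i) \<and> b \<in> pverts (T i)"
  obtains n q x where "q \<in> charmaps (tree_product k T) n" "x \<in> open_cube n" "q x = f"
proof -
  define J where "J = {j. j < k \<and> \<not> (\<exists>u\<in>pverts (T j). f j = indicator {u})}"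
  have ext: "f j = undefined" if "j \<ge> k" for j
    using f that by (auto simp: tree_product_def PiE_iff extensional_def)
  have real: "f j \<in> realization (T j)" if "j < k" for j
    using f that by (auto simp: tree_product_def)
  have "\<exists>u w t. (u, w) \<in> parcs (T j) \<and> t \<in> {0<..<1} \<and> f j = edge_point u w t" if j: "j \<in> J" for j
  proof -
    have "j < k" using j by (simp add: J_def)
    then obtain u w t where uwt: "(u, w) \<in> parcs (T j)" "t \<in> {0..1}" "f j = edge_point u w t"
      using j real[of j] unfolding J_def realization_def by blast
    then have "t \<noteq> 0" "t \<noteq> 1"
      using j verts[OF \<open>j < k\<close>] by (auto simp: J_def)
    then have "t \<in> {0<..<1}" using uwt(2) by simp
    then show ?thesis using uwt by blast
  qed
  then obtain u w t where uwt: "\<And>j. j \<in> J \<Longrightarrow> (u j, w j) \<in> parcs (T j) \<and> t j \<in> {0<..<1} \<and> f j = edge_point (u j) (w j) (t j)"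
    by metis
  have "\<forall>j\<in>{..<k} - J. \<exists>a\<in>pverts (T j). f j = indicator {a}"
    by (auto simp: J_def)
  then obtain a where a: "\<And>j. j \<in> {..<k} - J \<Longrightarrow> a j \<in> pverts (T j) \<and> f j = indicator {a j}"
    by metis
  have "finite J" "J \<subseteq> {..<k}" by (auto simp: J_def)
  then obtain \<iota> where \<iota>: "bij_betw \<iota> {..<card J} J"
    using ex_bij_betw_nat_finite by (metis atLeast0LessThan)
  let ?n = "card J"
  let ?u = "\<lambda>j. if j \<in> J then u j else a j"
  have \<iota>J: "inj_on \<iota> {..<?n}" "\<iota> ` {..<?n} = J" using \<iota> by (auto simp: bij_betw_def)
  define x where "x = (\<lambda>i\<in>{..<?n}. t (\<iota> i))"
  have "\<iota> i \<in> J" if "i \<in> {..<?n}" for i using that \<iota>J(2) by blast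
  then have x: "x \<in> open_cube ?n"
    using uwt unfolding x_def open_cube_def by simp
  show thesis
  proof
    show "product_cell k ?n \<iota> ?u w \<in> charmaps (tree_product k T) ?n"
    proof (rule product_cell_in_charmaps[OF \<iota>J(1)], unfold \<iota>J(2))
      show "(?u j, w j) \<in> parcs (T j)" if "j \<in> J" for j using uwt[OF that] that by simp
      show "?u j \<in> pverts (T j)" if "j \<in> {..<k} - J" for j using a[OF that] that by simp
    qed fact
    show "x \<in> open_cube ?n" by (rule x)
    show "product_cell k ?n \<iota> ?u w x = f"
    proof
      fix j
      have "inv_into {..<?n} \<iota> j < ?n" "\<iota> (inv_into {..<?n} \<iota> j) = j" if "j \<in> J"
        using \<iota>J that inv_into_into[of j \<iota> "{..<?n}"] f_inv_into_f[of j \<iota> "{..<?n}"] by auto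
      then have "x (inv_into {..<?n} \<iota> j) = t j" if "j \<in> J"
        using that by (simp add: x_def)
      moreover have "x \<in> cube ?n" using x open_cube_subset_cube by blast
      moreover have "j \<in> J \<or> j \<in> {..<k} - J \<or> j \<ge> k" by auto
      ultimately show "product_cell k ?n \<iota> ?u w x j = f j"
        using uwt[of j] a[of j] ext[of j] \<open>J \<subseteq> {..<k}\<close> unfolding product_cell_def \<iota>J(2)
        by auto
    qed
  qed
qed

text \<open>A permutation of the cube coordinates is absorbed by renumbering the directions, a
  reflection by exchanging the ends of an edge, which again gives an arc by symmetry.\<close>

lemma tree_product_charmaps_cube_syms:
  assumes q: "q \<in> charmaps (tree_product k T) n" and g: "g \<in> cube_syms n"
    and sym: "\<And>i a b. i < k \<Longrightarrow> (a, b) \<in> parcs (T i) \<Longrightarrow> (b, a) \<in> parcs (T i)"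
  shows "compose (cube n) q g \<in> charmaps (tree_product k T) n"
proof -
  obtain \<pi> F where g: "g = cube_sym n \<pi> F" and \<pi>: "\<pi> permutes {..<n}"
    using g unfolding cube_syms_eq by blast
  obtain \<iota> u w where q: "q = product_cell k n \<iota> u w" and \<iota>: "inj_on \<iota> {..<n}" "\<iota> ` {..<n} \<subseteq> {..<k}"
    and arcs: "\<And>j. j \<in> \<iota> ` {..<n} \<Longrightarrow> (u j, w j) \<in> parcs (T j)"
    and vs: "\<And>j. j \<in> {..<k} - \<iota> ` {..<n} \<Longrightarrow> u j \<in> pverts (T j)"
    using q by (rule product_cellE) blast
  define I where "I = inv_into {..<n} \<iota>"
  \<comment> \<open>The inverse occurs because direction \<open>j\<close> is now driven by the cube
    coordinate \<open>\<pi> (I j)\<close>.\<close>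
  let ?\<iota> = "\<iota> \<circ> inv \<pi>"
  let ?u = "\<lambda>j. if j \<in> \<iota> ` {..<n} \<and> I j \<in> F then w j else u j"
  let ?w = "\<lambda>j. if j \<in> \<iota> ` {..<n} \<and> I j \<in> F then u j else w j"
  have img: "?\<iota> ` {..<n} = \<iota> ` {..<n}"
    using permutes_image[OF permutes_inv[OF \<pi>]] by (metis image_comp)
  have inj: "inj_on ?\<iota> {..<n}"
    using \<iota>(1) \<pi> by (intro comp_inj_on) (auto simp: permutes_image[OF permutes_inv[OF \<pi>]]
      intro: inj_on_subset[OF permutes_inj[OF permutes_inv[OF \<pi>]]])
  have Ij: "I j < n" "\<iota> (I j) = j" if "j \<in> \<iota> ` {..<n}" for j
    using inv_into_into[OF that] f_inv_into_f[OF that] by (auto simp: I_def)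
  have inv: "inv_into {..<n} ?\<iota> j = \<pi> (I j)" if "j \<in> \<iota> ` {..<n}" for j
  proof (rule inv_into_f_eq[OF inj])
    show "\<pi> (I j) \<in> {..<n}" using Ij[OF that] permutes_in_image[OF \<pi>] by simp
    show "?\<iota> (\<pi> (I j)) = j" using Ij[OF that] \<pi> by (simp add: permutes_inverses)
  qed
  have "compose (cube n) q g = product_cell k n ?\<iota> ?u ?w"
  proof
    fix x
    show "compose (cube n) q g x = product_cell k n ?\<iota> ?u ?w x"
    proof (cases "x \<in> cube n")
      case True
      have "cube_sym n \<pi> F x (I j) = (if I j \<in> F then 1 - x (\<pi> (I j)) else x (\<pi> (I j)))"
        if "j \<in> \<iota> ` {..<n}" for j
        using True Ij[OF that] by (simp add: cube_sym_def)
      then show ?thesis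
        using True cube_sym_in_cube[OF \<pi> True] unfolding compose_def g q product_cell_def img
        by (auto simp: inv edge_point_flip I_def[symmetric] fun_eq_iff)
    qed (simp add: compose_def product_cell_def)
  qed
  moreover have "product_cell k n ?\<iota> ?u ?w \<in> charmaps (tree_product k T) n"
  proof (rule product_cell_in_charmaps[OF inj], unfold img)
    show "(?u j, ?w j) \<in> parcs (T j)" if "j \<in> \<iota> ` {..<n}" for j
      using that arcs[OF that] sym[of j "u j" "w j"] \<iota>(2) by (simp add: subset_iff)
    show "?u j \<in> pverts (T j)" if "j \<in> {..<k} - \<iota> ` {..<n}" for j
      using that vs[OF that] by simp
  qed (rule \<iota>(2))
  ultimately show ?thesis by simp
qed

section \<open>Words up to commutation of colours\<close>

text \<open>The list omits the starting vertex, so its length is the number of steps.\<close>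

fun walk :: "('v \<times> 'v) set \<Rightarrow> 'v \<Rightarrow> 'v list \<Rightarrow> bool" where
  "walk A a [] \<longleftrightarrow> True"
| "walk A a (b # bs) \<longleftrightarrow> (a, b) \<in> A \<and> walk A b bs"

lemma walk_append: "walk A a (xs @ ys) \<longleftrightarrow> walk A a xs \<and> walk A (last (a # xs)) ys"
  by (induction xs arbitrary: a) auto

text \<open>A letter \<open>(i, b)\<close> means: move coordinate \<open>i\<close> to the tree
  vertex \<open>b\<close>. Together with a starting tuple, a word thus encodes an edge path in the
  product of trees.\<close>

definition proj :: "nat \<Rightarrow> (nat \<times> 'v) list \<Rightarrow> 'v list" where
  "proj i s = map snd (filter (\<lambda>x. fst x = i) s)"

lemma proj_simps [simp]:
  "proj i [] = []"
  "proj i ((j, b) # s) = (if j = i then b # proj i s else proj i s)"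
  "proj i (s @ t) = proj i s @ proj i t"
  by (auto simp: proj_def)

lemma proj_eq_Nil: "proj i s = [] \<longleftrightarrow> i \<notin> fst ` set s"
  by (auto simp: proj_def filter_empty_conv)

lemma all_proj_Nil: "(\<And>i. proj i s = []) \<Longrightarrow> s = []"
  by (cases s) (auto simp: proj_eq_Nil)

text \<open>Splitting at the first letter of colour \<open>i\<close> leaves only letters of other
  colours in front, past which it can be commuted.\<close>

lemma proj_eq_Cons:
  "proj i s = b # bs \<Longrightarrow> \<exists>a c. s = a @ (i, b) # c \<and> i \<notin> fst ` set a"
proof (induction s)
  case (Cons x s)
  obtain j c where x: "x = (j, c)" by (cases x)
  show ?case
  proof (cases "j = i")
    case True
    then show ?thesis using Cons.prems x by (intro exI[of _ "[]"] exI[of _ s]) simp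
  next
    case False
    then obtain a d where "s = a @ (i, b) # d" "i \<notin> fst ` set a"
      using Cons x by auto
    then show ?thesis using False x by (intro exI[of _ "x # a"] exI[of _ d]) auto
  qed
qed simp

text \<open>Every family of tree walks is the family of projections of some word: walk in direction 0 first,
  then in direction 1, and so on.\<close>

definition merge :: "nat \<Rightarrow> (nat \<Rightarrow> 'v list) \<Rightarrow> (nat \<times> 'v) list" where
  "merge n w = concat (map (\<lambda>i. map (Pair i) (w i)) [0..<n])"

lemma merge_Suc: "merge (Suc n) w = merge n w @ map (Pair n) (w n)"
  by (simp add: merge_def)

lemma proj_map_Pair: "proj i (map (Pair j) xs) = (if i = j then xs else [])"
  by (induction xs) auto

lemma proj_merge: "proj i (merge n w) = (if i < n then w i else [])"
  by (induction n) (auto simp: merge_Suc proj_map_Pair less_Suc_eq merge_def[of 0])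

lemma colours_merge: "fst ` set (merge n w) \<subseteq> {..<n}"
  by (auto simp: merge_def)

fun endpoint :: "(nat \<Rightarrow> 'v) \<Rightarrow> (nat \<times> 'v) list \<Rightarrow> nat \<Rightarrow> 'v" where
  "endpoint u [] = u"
| "endpoint u ((i, b) # s) = endpoint (u(i := b)) s"

lemma endpoint_append [simp]: "endpoint u (s @ t) = endpoint (endpoint u s) t"
  by (induction s arbitrary: u) (auto simp: split_paired_all)

lemma endpoint_eq_last: "endpoint u s i = last (u i # proj i s)"
  by (induction s arbitrary: u) (auto simp: split_paired_all)

lemma length_eq_sum_proj:
  assumes "fst ` set s \<subseteq> {..<k}"
  shows "length s = (\<Sum>i<k. length (proj i s))"
  using assms
proof (induction s)
  case (Cons x s)
  obtain j c where x: "x = (j, c)" by (cases x)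
  have "(\<Sum>i<k. length (proj i (x # s))) = (\<Sum>i<k. (if i = j then 1 else 0) + length (proj i s))"
    unfolding x by (intro sum.cong) auto
  also have "\<dots> = 1 + length s" using Cons x by (simp add: sum.distrib)
  finally show ?case by simp
qed simp

text \<open>The contract between topology and combinatorics. Tuples in \<open>V\<close> are vertices
  of the product of trees; \<open>vtx\<close> and \<open>edge\<close> project them and the edges
  leaving them to \<open>G\<close>. \<open>edge_lift\<close> and \<open>edge_inj\<close> give unique
  lifting of coloured edges at any chosen tuple, and \<open>R_intro\<close> turns each square into a
  commutation. \<open>R_lift\<close> is the converse: seen from any tuple above its origin, a
  relation is such a commutation.\<close>

locale coloured_cover =
  fixes k :: nat and A :: "nat \<Rightarrow> ('v \<times> 'v) set" and V :: "(nat \<Rightarrow> 'v) set"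
    and vtx :: "(nat \<Rightarrow> 'v) \<Rightarrow> 'o" and edge :: "(nat \<Rightarrow> 'v) \<Rightarrow> nat \<Rightarrow> 'v \<Rightarrow> 'e"
    and G :: "('o, 'e) pre_digraph" and E :: "nat \<Rightarrow> 'e set"
    and R :: "(('o \<times> 'e list \<times> 'o) \<times> ('o \<times> 'e list \<times> 'o)) set"
  assumes upd: "u \<in> V \<Longrightarrow> i < k \<Longrightarrow> (u i, b) \<in> A i \<Longrightarrow> u(i := b) \<in> V"
    and verts_G: "verts G = vtx ` V"
    and arcs_G: "arcs G = (\<Union>i<k. E i)"
    and edge_E: "u \<in> V \<Longrightarrow> i < k \<Longrightarrow> (u i, b) \<in> A i \<Longrightarrow> edge u i b \<in> E i"
    and tail_edge: "u \<in> V \<Longrightarrow> i < k \<Longrightarrow> (u i, b) \<in> A i \<Longrightarrow> tail G (edge u i b) = vtx u"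
    and head_edge: "u \<in> V \<Longrightarrow> i < k \<Longrightarrow> (u i, b) \<in> A i \<Longrightarrow> head G (edge u i b) = vtx (u(i := b))"
    and edge_inj: "u \<in> V \<Longrightarrow> i < k \<Longrightarrow> (u i, b) \<in> A i \<Longrightarrow> i' < k \<Longrightarrow> (u i', b') \<in> A i' \<Longrightarrow>
      edge u i b = edge u i' b' \<Longrightarrow> i = i' \<and> b = b'"
    and edge_lift: "i < k \<Longrightarrow> e \<in> E i \<Longrightarrow> u \<in> V \<Longrightarrow> tail G e = vtx u \<Longrightarrow>
      \<exists>b. (u i, b) \<in> A i \<and> e = edge u i b"
    and tail_E: "i < k \<Longrightarrow> e \<in> E i \<Longrightarrow> tail G e \<in> vtx ` V"
    and finite_verts: "finite (verts G)" and finite_arcs: "finite (arcs G)"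
    and R_intro: "u \<in> V \<Longrightarrow> i < k \<Longrightarrow> j < k \<Longrightarrow> i \<noteq> j \<Longrightarrow> (u i, b) \<in> A i \<Longrightarrow> (u j, c) \<in> A j \<Longrightarrow>
      ((vtx u, [edge u i b, edge (u(i := b)) j c], vtx (u(i := b, j := c))),
       (vtx u, [edge u j c, edge (u(j := c)) i b], vtx (u(i := b, j := c)))) \<in> R"
    and R_src: "r \<in> R \<Longrightarrow> fst (fst r) \<in> vtx ` V"
    and R_lift: "r \<in> R \<Longrightarrow> u \<in> V \<Longrightarrow> fst (fst r) = vtx u \<Longrightarrow>
      \<exists>i j b c. i < k \<and> j < k \<and> i \<noteq> j \<and> (u i, b) \<in> A i \<and> (u j, c) \<in> A j \<and>
      r = ((vtx u, [edge u i b, edge (u(i := b)) j c], vtx (u(i := b, j := c))),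
       (vtx u, [edge u j c, edge (u(j := c)) i b], vtx (u(i := b, j := c))))"
begin

section \<open>Words in the product and their images in the digraph\<close>

fun valid :: "(nat \<Rightarrow> 'v) \<Rightarrow> (nat \<times> 'v) list \<Rightarrow> bool" where
  "valid u [] \<longleftrightarrow> True"
| "valid u ((i, b) # s) \<longleftrightarrow> i < k \<and> (u i, b) \<in> A i \<and> valid (u(i := b)) s"

fun word :: "(nat \<Rightarrow> 'v) \<Rightarrow> (nat \<times> 'v) list \<Rightarrow> 'e list" where
  "word u [] = []"
| "word u ((i, b) # s) = edge u i b # word (u(i := b)) s"

definition mor :: "(nat \<Rightarrow> 'v) \<Rightarrow> (nat \<times> 'v) list \<Rightarrow> 'o \<times> 'e list \<times> 'o" where
  "mor u s = (vtx u, word u s, vtx (endpoint u s))"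

abbreviation "F \<equiv> free_category G"
abbreviation "cgr \<equiv> congruence F R"
abbreviation "\<Lambda> \<equiv> quotient_category F cgr"

lemma F_simps: "Ob F = verts G" "src F f = fst f" "rng F f = snd (snd f)" "ident F v = (v, [], v)"
  "comp F f g = (fst g, fst (snd g) @ fst (snd f), snd (snd f))"
  "(a, xs, b) \<in> Mor F \<longleftrightarrow> pre_digraph.awalk G a xs b"
  by (auto simp: free_category_def split: prod.splits)

lemma valid_append [simp]: "valid u (s @ t) \<longleftrightarrow> valid u s \<and> valid (endpoint u s) t"
  by (induction s arbitrary: u) (auto simp: split_paired_all)

lemma word_append [simp]: "word u (s @ t) = word u s @ word (endpoint u s) t"
  by (induction s arbitrary: u) (auto simp: split_paired_all)

text \<open>A letter of colour \<open>i\<close> tests and changes coordinate \<open>i\<close> only,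
  so the conditions on a word decouple into one walk per tree.\<close>

lemma valid_iff: "valid u s \<longleftrightarrow> fst ` set s \<subseteq> {..<k} \<and> (\<forall>i<k. walk (A i) (u i) (proj i s))"
proof (induction s arbitrary: u)
  case (Cons x s)
  obtain i b where x: "x = (i, b)" by (cases x)
  have "walk (A j) (u j) (proj j ((i, b) # s)) \<longleftrightarrow>
      (j = i \<longrightarrow> (u i, b) \<in> A i) \<and> walk (A j) ((u(i := b)) j) (proj j s)" for j
    by simp
  then have walks: "(\<forall>j<k. walk (A j) (u j) (proj j ((i, b) # s))) \<longleftrightarrow>
      (i < k \<longrightarrow> (u i, b) \<in> A i) \<and> (\<forall>j<k. walk (A j) ((u(i := b)) j) (proj j s))"
    by blast
  have colours: "fst ` set ((i, b) # s) \<subseteq> {..<k} \<longleftrightarrow> i < k \<and> fst ` set s \<subseteq> {..<k}" by simp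
  show ?case unfolding x valid.simps Cons.IH walks colours by blast
qed simp

lemma valid_proj_eq_Nil: "valid u s \<Longrightarrow> \<not> i < k \<Longrightarrow> proj i s = []"
  unfolding valid_iff proj_eq_Nil by auto

lemma endpoint_in_V: "u \<in> V \<Longrightarrow> valid u s \<Longrightarrow> endpoint u s \<in> V"
  by (induction s arbitrary: u) (auto simp: split_paired_all intro: upd)

lemma mor_in_Mor:
  assumes "u \<in> V" "valid u s"
  shows "mor u s \<in> Mor F"
proof -
  have "set (word u s) \<subseteq> arcs G \<and> pre_digraph.cas G (vtx u) (word u s) (vtx (endpoint u s))"
    using assms
  proof (induction s arbitrary: u)
    case (Cons x s)
    obtain i b where x: "x = (i, b)" by (cases x)
    have u: "u \<in> V" "i < k" "(u i, b) \<in> A i" "valid (u(i := b)) s" using Cons.prems unfolding x by auto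
    then have "edge u i b \<in> arcs G" using edge_E[OF u(1-3)] unfolding arcs_G by blast
    moreover have "set (word (u(i := b)) s) \<subseteq> arcs G \<and>
        pre_digraph.cas G (vtx (u(i := b))) (word (u(i := b)) s) (vtx (endpoint (u(i := b)) s))"
      using upd[OF u(1-3)] u(4) by (rule Cons.IH)
    ultimately show ?case
      using u unfolding x by (simp add: pre_digraph.cas.simps tail_edge head_edge)
  qed (simp add: pre_digraph.cas.simps)
  then show ?thesis
    using assms by (simp add: mor_def F_simps pre_digraph.awalk_def verts_G)
qed

lemma cas_lift:
  "u \<in> V \<Longrightarrow> set xs \<subseteq> arcs G \<Longrightarrow> pre_digraph.cas G (vtx u) xs w \<Longrightarrow>
    \<exists>s. valid u s \<and> xs = word u s \<and> w = vtx (endpoint u s)"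
proof (induction xs arbitrary: u)
  case Nil
  then show ?case by (intro exI[of _ "[]"]) (simp add: pre_digraph.cas.simps)
next
  case (Cons e xs)
  then have e: "tail G e = vtx u" "pre_digraph.cas G (head G e) xs w" "set xs \<subseteq> arcs G"
    by (simp_all add: pre_digraph.cas.simps)
  obtain i where i: "i < k" "e \<in> E i" using Cons.prems(2) unfolding arcs_G by auto
  obtain b where b: "(u i, b) \<in> A i" "e = edge u i b"
    using edge_lift[OF i Cons.prems(1) e(1)] by blast
  have "pre_digraph.cas G (vtx (u(i := b))) xs w"
    using e(2) head_edge[OF Cons.prems(1) i(1) b(1)] b(2) by simp
  from Cons.IH[OF upd[OF Cons.prems(1) i(1) b(1)] e(3) this]
  obtain s where "valid (u(i := b)) s" "xs = word (u(i := b)) s" "w = vtx (endpoint (u(i := b)) s)"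
    by blast
  then show ?case using i(1) b by (intro exI[of _ "(i, b) # s"]) simp
qed

lemma Mor_lift:
  assumes "f \<in> Mor F" "u \<in> V" "fst f = vtx u"
  obtains s where "valid u s" "f = mor u s"
proof -
  obtain xs w where f: "f = (vtx u, xs, w)" using assms(3) by (cases f) auto
  then have "set xs \<subseteq> arcs G" "pre_digraph.cas G (vtx u) xs w"
    using assms(1) by (simp_all add: F_simps pre_digraph.awalk_def)
  from cas_lift[OF assms(2) this] show thesis using that f by (auto simp: mor_def)
qed

lemma Mor_src: "f \<in> Mor F \<Longrightarrow> fst f \<in> vtx ` V"
  by (cases f) (simp add: F_simps pre_digraph.awalk_def verts_G)

text \<open>At a fixed tuple an edge determines its colour and its target coordinate, so the lifted
  word is recovered letter by letter.\<close>

lemma word_inj: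
  "u \<in> V \<Longrightarrow> valid u s \<Longrightarrow> valid u s' \<Longrightarrow> word u s = word u s' \<Longrightarrow> s = s'"
proof (induction s arbitrary: u s')
  case Nil
  then show ?case by (cases s') auto
next
  case (Cons x s)
  obtain i b where x: "x = (i, b)" by (cases x)
  obtain j c t where s': "s' = (j, c) # t" using Cons.prems(4) x by (cases s') auto
  have ib: "i < k" "(u i, b) \<in> A i" "valid (u(i := b)) s" and jc: "j < k" "(u j, c) \<in> A j" "valid (u(j := c)) t"
    and eq: "edge u i b = edge u j c" "word (u(i := b)) s = word (u(j := c)) t"
    using Cons.prems unfolding x s' by auto
  have ij: "i = j" "b = c" using edge_inj[OF Cons.prems(1) ib(1,2) jc(1,2) eq(1)] by auto
  have "s = t"
    using upd[OF Cons.prems(1) ib(1,2)] ib(3) jc(3)[folded ij] eq(2)[folded ij] by (rule Cons.IH)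
  then show ?case using ij x s' by simp
qed

lemma mor_inj: "u \<in> V \<Longrightarrow> valid u s \<Longrightarrow> valid u s' \<Longrightarrow> mor u s = mor u s' \<Longrightarrow> s = s'"
  using word_inj by (simp add: mor_def)

lemma mor_append: "mor u (s @ t) = comp F (mor (endpoint u s) t) (mor u s)"
  by (simp add: mor_def F_simps)

lemma mor_ends [simp]: "fst (mor u s) = vtx u" "snd (snd (mor u s)) = vtx (endpoint u s)"
  by (simp_all add: mor_def)

lemma cong_mor_append:
  assumes "(mor u s, mor u s') \<in> cgr" "endpoint u s = endpoint u s'"
    "(mor (endpoint u s) t, mor (endpoint u s) t') \<in> cgr"
  shows "(mor u (s @ t), mor u (s' @ t')) \<in> cgr"
  using congruence.comp[OF assms(3,1)] assms(2) by (simp add: mor_append F_simps)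

lemma cong_refl: "u \<in> V \<Longrightarrow> valid u s \<Longrightarrow> (mor u s, mor u s) \<in> cgr"
  by (intro congruence.refl mor_in_Mor)

text \<open>Each letter passed has another colour, and the exchange is one relation of
  \<open>R\<close>. Validity and end point are carried through the induction because relations are
  available for valid words and composition needs matching ends.\<close>

lemma cong_move_to_front:
  "u \<in> V \<Longrightarrow> valid u (a @ [(i, b)]) \<Longrightarrow> i \<notin> fst ` set a \<Longrightarrow>
    valid u ((i, b) # a) \<and> endpoint u (a @ [(i, b)]) = endpoint u ((i, b) # a) \<and>
    (mor u (a @ [(i, b)]), mor u ((i, b) # a)) \<in> cgr"
proof (induction a arbitrary: u)
  case Nil
  then show ?case by (simp add: cong_refl)
next
  case (Cons x a)
  obtain j c where x: "x = (j, c)" by (cases x)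
  have ij: "i \<noteq> j" and a: "i \<notin> fst ` set a" using Cons.prems(3) x by auto
  have u: "u(j := c) \<in> V" "valid (u(j := c)) (a @ [(i, b)])" "j < k" "(u j, c) \<in> A j"
    using Cons.prems x upd by auto
  have IH: "valid (u(j := c)) ((i, b) # a) \<and>
      endpoint (u(j := c)) (a @ [(i, b)]) = endpoint (u(j := c)) ((i, b) # a) \<and>
      (mor (u(j := c)) (a @ [(i, b)]), mor (u(j := c)) ((i, b) # a)) \<in> cgr"
    using u(1,2) a by (rule Cons.IH)
  have i: "i < k" "(u i, b) \<in> A i" "valid (u(j := c, i := b)) a" using IH ij by auto
  have comm: "u(i := b, j := c) = u(j := c, i := b)" using ij by (simp add: fun_upd_twist)
  have valid: "valid u ([(j, c)] @ [(i, b)])" "valid u ((i, b) # x # a)"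
    using u i ij comm unfolding x by auto
  \<comment> \<open>First the letter passes \<open>a\<close> behind \<open>(j, c)\<close>; then a
    single square exchanges it with \<open>(j, c)\<close>.\<close>
  have "(mor u ([(j, c)] @ (a @ [(i, b)])), mor u ([(j, c)] @ ((i, b) # a))) \<in> cgr"
    using cong_refl[OF Cons.prems(1), of "[(j, c)]"] u IH by (intro cong_mor_append) auto
  moreover have "(mor u ([(j, c), (i, b)] @ a), mor u ([(i, b), (j, c)] @ a)) \<in> cgr"
  proof (rule cong_mor_append)
    show "(mor u [(j, c), (i, b)], mor u [(i, b), (j, c)]) \<in> cgr"
      using congruence.base[OF R_intro[OF Cons.prems(1) u(3) i(1) ij[symmetric] u(4) i(2)]]
      by (simp add: mor_def comm)
    show "endpoint u [(j, c), (i, b)] = endpoint u [(i, b), (j, c)]" by (simp add: comm)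
    show "(mor (endpoint u [(j, c), (i, b)]) a, mor (endpoint u [(j, c), (i, b)]) a) \<in> cgr"
      using i u(1) ij by (intro cong_refl) (auto intro!: upd)
  qed
  ultimately have "(mor u (x # a @ [(i, b)]), mor u ((i, b) # x # a)) \<in> cgr"
    unfolding x append.simps by (rule congruence.trans)
  then show ?case using valid(2) IH unfolding x by (simp add: comm)
qed

lemma endpoint_cong: "(\<And>i. proj i s = proj i s') \<Longrightarrow> endpoint u s = endpoint u s'"
  by (rule ext) (simp add: endpoint_eq_last)

text \<open>As in partially commutative monoids: the first letter of \<open>s\<close> is also the
  first of its colour in \<open>s'\<close>, so it moves to the front of \<open>s'\<close> through
  other colours, and the remaining words again have equal projections.\<close>

lemma cong_of_proj:
  "u \<in> V \<Longrightarrow> valid u s \<Longrightarrow> valid u s' \<Longrightarrow> (\<And>i. proj i s = proj i s') \<Longrightarrow> (mor u s, mor u s') \<in> cgr"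
proof (induction s arbitrary: u s')
  case Nil
  have "s' = []" by (rule all_proj_Nil) (use Nil in simp)
  then show ?case using Nil by (simp add: cong_refl)
next
  case (Cons x s)
  obtain i b where x: "x = (i, b)" by (cases x)
  have "proj i s' = b # proj i s" using Cons.prems(4)[of i] x by simp
  then obtain a c where s': "s' = a @ (i, b) # c" "i \<notin> fst ` set a"
    using proj_eq_Cons by metis
  have v: "valid u (a @ [(i, b)])" "valid (endpoint u (a @ [(i, b)])) c"
    using Cons.prems(3) unfolding s' by auto
  note move = cong_move_to_front[OF Cons.prems(1) v(1) s'(2)]
  have e: "endpoint u (a @ [(i, b)]) \<in> V" using Cons.prems(1) v(1) by (rule endpoint_in_V)
  have i: "i < k" "(u i, b) \<in> A i" "valid (u(i := b)) s" using Cons.prems(2) x by auto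
  have "(mor u s', mor u ((i, b) # a @ c)) \<in> cgr"
    using cong_mor_append[of u "a @ [(i, b)]" "(i, b) # a" c c] move cong_refl[OF e v(2)] unfolding s' by simp
  moreover have "(mor u ([(i, b)] @ s), mor u ([(i, b)] @ (a @ c))) \<in> cgr"
  proof (rule cong_mor_append)
    show "(mor u [(i, b)], mor u [(i, b)]) \<in> cgr" using Cons.prems(1) i by (intro cong_refl) auto
    have "valid (u(i := b)) (a @ c)" using move v(2) by simp
    moreover have "proj j s = proj j (a @ c)" for j
      using Cons.prems(4)[of j] s'(2)[folded proj_eq_Nil] unfolding x s'(1) by (auto split: if_splits)
    ultimately have "(mor (u(i := b)) s, mor (u(i := b)) (a @ c)) \<in> cgr"
      by (rule Cons.IH[OF upd[OF Cons.prems(1) i(1,2)] i(3)])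
    then show "(mor (endpoint u [(i, b)]) s, mor (endpoint u [(i, b)]) (a @ c)) \<in> cgr" by simp
  qed simp
  ultimately show ?case
    unfolding x by (metis append_Cons append_Nil congruence.sym congruence.trans)
qed

text \<open>The projections are compared at every lift of the common origin. In a composite the
  later factor is lifted at the end point of a lift of the earlier one, and that tuple cannot be
  prescribed.\<close>

definition equivalent :: "'o \<times> 'e list \<times> 'o \<Rightarrow> 'o \<times> 'e list \<times> 'o \<Rightarrow> bool" where
  "equivalent f g \<longleftrightarrow> f \<in> Mor F \<and> g \<in> Mor F \<and> fst f = fst g \<and> snd (snd f) = snd (snd g) \<and>
     (\<forall>u\<in>V. \<forall>s s'. fst f = vtx u \<longrightarrow> valid u s \<longrightarrow> valid u s' \<longrightarrow> f = mor u s \<longrightarrow> g = mor u s' \<longrightarrow>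
       (\<forall>i. proj i s = proj i s'))"

lemma equivalent_lift:
  assumes "f \<in> Mor F" "g \<in> Mor F" "u \<in> V" "fst f = vtx u" "equivalent f g"
  obtains s s' where "valid u s" "valid u s'" "f = mor u s" "g = mor u s'" "\<And>i. proj i s = proj i s'"
    "endpoint u s = endpoint u s'"
proof -
  obtain s where s: "valid u s" "f = mor u s" using Mor_lift[OF assms(1,3,4)] .
  have "fst g = vtx u" using assms(4,5) by (simp add: equivalent_def)
  with assms obtain s' where s': "valid u s'" "g = mor u s'" using Mor_lift by blast
  have "\<And>i. proj i s = proj i s'" using assms(3,4,5) s s' unfolding equivalent_def by blast
  then show thesis using that s s' endpoint_cong by blast
qed

text \<open>Lifts at a given tuple are unique by \<open>mor_inj\<close>, so one pair of lifts per
  tuple suffices.\<close>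

lemma equivalentI:
  assumes "f \<in> Mor F" "g \<in> Mor F" "fst f = fst g" "snd (snd f) = snd (snd g)"
    and "\<And>u. u \<in> V \<Longrightarrow> fst f = vtx u \<Longrightarrow>
      \<exists>s s'. valid u s \<and> valid u s' \<and> f = mor u s \<and> g = mor u s' \<and> (\<forall>i. proj i s = proj i s')"
  shows "equivalent f g"
  unfolding equivalent_def
proof (intro conjI assms ballI allI impI)
  fix u s s' i assume *: "u \<in> V" "fst f = vtx u" "valid u s" "valid u s'" "f = mor u s" "g = mor u s'"
  from assms(5)[OF *(1,2)] obtain t t' where t: "valid u t" "valid u t'" "f = mor u t" "g = mor u t'"
    "\<forall>i. proj i t = proj i t'" by blast
  then have "s = t" "s' = t'" using * mor_inj by metis+
  then show "proj i s = proj i s'" using t(5) by simp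
qed

text \<open>A relation exchanges two letters of different colours and so preserves all projections
  at every lift. For composites, equal projections of \<open>g\<close> and \<open>g'\<close> give
  equal end points, so \<open>f\<close> and \<open>f'\<close> are lifted at the same tuple and the
  projections concatenate.\<close>

lemma cong_equivalent: "(f, g) \<in> cgr \<Longrightarrow> equivalent f g"
proof (induction rule: congruence.induct)
  case (base f g)
  obtain u where u: "u \<in> V" "fst f = vtx u" using R_src[OF base] by auto
  have lift: "\<exists>s s'. valid u s \<and> valid u s' \<and> f = mor u s \<and> g = mor u s' \<and> (\<forall>i. proj i s = proj i s')"
    if u: "u \<in> V" "fst f = vtx u" for u
  proof -
    obtain i j b c where ij: "i < k" "j < k" "i \<noteq> j" "(u i, b) \<in> A i" "(u j, c) \<in> A j"
      "(f, g) = ((vtx u, [edge u i b, edge (u(i := b)) j c], vtx (u(i := b, j := c))),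
       (vtx u, [edge u j c, edge (u(j := c)) i b], vtx (u(i := b, j := c))))"
      using R_lift[OF base u(1)] u(2) by auto
    then have "f = mor u [(i, b), (j, c)]" "g = mor u [(j, c), (i, b)]"
      by (simp_all add: mor_def fun_upd_twist)
    then show ?thesis using ij by (intro exI[of _ "[(i, b), (j, c)]"] exI[of _ "[(j, c), (i, b)]"]) simp
  qed
  from lift[OF u] obtain s s' where s: "valid u s" "valid u s'" "f = mor u s" "g = mor u s'"
    "\<forall>i. proj i s = proj i s'" by blast
  show ?case
    using s mor_in_Mor[OF u(1)] lift endpoint_cong[of s s' u] by (intro equivalentI) auto
next
  case (refl f)
  show ?case
  proof (rule equivalentI)
    fix u assume u: "u \<in> V" "fst f = vtx u"
    obtain s where "valid u s" "f = mor u s" using Mor_lift[OF refl u] .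
    then show "\<exists>s s'. valid u s \<and> valid u s' \<and> f = mor u s \<and> f = mor u s' \<and> (\<forall>i. proj i s = proj i s')"
      by blast
  qed (use refl in simp_all)
next
  case (sym f g)
  then show ?case unfolding equivalent_def by (metis (no_types))
next
  case (trans f g h)
  then have Mor: "f \<in> Mor F" "g \<in> Mor F" "h \<in> Mor F" and eq: "equivalent f g" "equivalent g h"
    unfolding equivalent_def by blast+
  show ?case
  proof (rule equivalentI)
    fix u assume u: "u \<in> V" "fst f = vtx u"
    obtain s t where s: "valid u s" "valid u t" "f = mor u s" "g = mor u t" "\<And>i. proj i s = proj i t"
      using equivalent_lift[OF Mor(1,2) u eq(1)] by metis
    have "fst g = vtx u" using s by simp
    then obtain t' r where t: "valid u t'" "valid u r" "g = mor u t'" "h = mor u r" "\<And>i. proj i t' = proj i r"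
      using equivalent_lift[OF Mor(2,3) u(1) _ eq(2)] by metis
    have "t = t'" using s t mor_inj[OF u(1)] by metis
    then show "\<exists>s s'. valid u s \<and> valid u s' \<and> f = mor u s \<and> h = mor u s' \<and> (\<forall>i. proj i s = proj i s')"
      using s t by metis
  qed (use Mor eq in \<open>auto simp: equivalent_def\<close>)
next
  case (comp f f' g g')
  then have Mor: "f \<in> Mor F" "f' \<in> Mor F" "g \<in> Mor F" "g' \<in> Mor F"
    and eq: "equivalent f f'" "equivalent g g'" and fg: "fst f = snd (snd g)"
    unfolding equivalent_def F_simps by blast+
  have lift: "\<exists>s s'. valid u s \<and> valid u s' \<and> comp F f g = mor u s \<and> comp F f' g' = mor u s' \<and>
      (\<forall>i. proj i s = proj i s')" if u: "u \<in> V" "fst g = vtx u" for u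
  proof -
    obtain t t' where t: "valid u t" "valid u t'" "g = mor u t" "g' = mor u t'" "\<And>i. proj i t = proj i t'"
      "endpoint u t = endpoint u t'"
      using equivalent_lift[OF Mor(3,4) u eq(2)] by metis
    have "fst f = vtx (endpoint u t)" using fg t by simp
    then obtain r r' where r: "valid (endpoint u t) r" "valid (endpoint u t) r'" "f = mor (endpoint u t) r"
      "f' = mor (endpoint u t) r'" "\<And>i. proj i r = proj i r'"
      using equivalent_lift[OF Mor(1,2) endpoint_in_V[OF u(1) t(1)] _ eq(1)] by metis
    show ?thesis
      using t r by (intro exI[of _ "t @ r"] exI[of _ "t' @ r'"]) (simp add: mor_append)
  qed
  obtain u where u: "u \<in> V" "fst g = vtx u" using Mor_src[OF Mor(3)] by auto
  from lift[OF u] obtain s s' where s: "valid u s" "valid u s'" "comp F f g = mor u s" "comp F f' g' = mor u s'"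
    "\<forall>i. proj i s = proj i s'" by blast
  have "fst (comp F f g) = fst g" by (simp add: F_simps)
  then show ?case
    using s mor_in_Mor[OF u(1)] lift endpoint_cong[of s s' u] by (intro equivalentI) auto
qed

section \<open>Morphisms of the quotient as classes of lifted words\<close>

definition cell :: "(nat \<Rightarrow> 'v) \<Rightarrow> (nat \<times> 'v) list \<Rightarrow> ('o \<times> 'e list \<times> 'o) set" where
  "cell u s = cgr `` {mor u s}"

lemma class_eq: "(f, g) \<in> cgr \<Longrightarrow> cgr `` {f} = cgr `` {g}"
  using congruence.sym congruence.trans by fast

lemma cell_self: "u \<in> V \<Longrightarrow> valid u s \<Longrightarrow> mor u s \<in> cell u s"
  by (simp add: cell_def cong_refl)

lemma cell_mem:
  assumes "u \<in> V" "valid u s" "g \<in> cell u s"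
  obtains s' where "valid u s'" "g = mor u s'" "\<And>i. proj i s' = proj i s"
proof -
  have eq: "equivalent (mor u s) g" using assms(3) cong_equivalent by (simp add: cell_def)
  then have Mor: "mor u s \<in> Mor F" "g \<in> Mor F" by (simp_all add: equivalent_def)
  obtain t s' where t: "valid u t" "valid u s'" "mor u s = mor u t" "g = mor u s'" "\<And>i. proj i t = proj i s'"
    using equivalent_lift[OF Mor assms(1) _ eq] by (metis mor_ends(1))
  have "s = t" using mor_inj[OF assms(1,2) t(1,3)] .
  then show thesis using that[OF t(2,4)] t(5) by simp
qed

text \<open>Invariance (\<open>cong_equivalent\<close>) and completeness
  (\<open>cong_of_proj\<close>) of the projections combine: a morphism with origin
  \<open>vtx u\<close> amounts to a family of tree walks starting at \<open>u\<close>.\<close>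

lemma cell_eq_iff:
  assumes "u \<in> V" "valid u s" "valid u s'"
  shows "cell u s = cell u s' \<longleftrightarrow> (\<forall>i. proj i s = proj i s')"
proof
  assume "cell u s = cell u s'"
  then have "mor u s' \<in> cell u s" using cell_self[OF assms(1,3)] by simp
  then obtain t where t: "valid u t" "mor u s' = mor u t" "\<And>i. proj i t = proj i s"
    using cell_mem[OF assms(1,2)] by metis
  have "s' = t" using mor_inj[OF assms(1,3) t(1,2)] .
  then show "\<forall>i. proj i s = proj i s'" using t(3) by simp
next
  assume "\<forall>i. proj i s = proj i s'"
  then show "cell u s = cell u s'"
    unfolding cell_def by (intro class_eq cong_of_proj assms) blast
qed

lemma Mor_quotient: "Mor \<Lambda> = (\<lambda>f. cgr `` {f}) ` Mor F"
  by (auto simp: quotient_category_def quotient_def)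

lemma cell_in_Mor: "u \<in> V \<Longrightarrow> valid u s \<Longrightarrow> cell u s \<in> Mor \<Lambda>"
  unfolding Mor_quotient cell_def by (intro imageI mor_in_Mor)

lemma Mor_quotientE:
  assumes "M \<in> Mor \<Lambda>"
  obtains u s where "u \<in> V" "valid u s" "M = cell u s"
proof -
  obtain f where f: "f \<in> Mor F" "M = cgr `` {f}" using assms unfolding Mor_quotient by blast
  obtain u where u: "u \<in> V" "fst f = vtx u" using Mor_src[OF f(1)] by blast
  obtain s where "valid u s" "f = mor u s" using Mor_lift[OF f(1) u] .
  then show thesis using that[OF u(1)] f(2) by (simp add: cell_def)
qed

lemma src_cell:
  assumes "u \<in> V" "valid u s"
  shows "src \<Lambda> (cell u s) = vtx u"
proof -
  have "fst g = vtx u" if "g \<in> cell u s" for g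
    using cell_mem[OF assms that] by (metis mor_ends(1))
  then have "src F ` cell u s = {vtx u}" using cell_self[OF assms] by (force simp: F_simps)
  then show ?thesis by (simp add: quotient_category_def)
qed

lemma rng_cell:
  assumes "u \<in> V" "valid u s"
  shows "rng \<Lambda> (cell u s) = vtx (endpoint u s)"
proof -
  have "snd (snd g) = vtx (endpoint u s)" if "g \<in> cell u s" for g
    using cell_mem[OF assms that] endpoint_cong by (metis mor_ends(2))
  then have "rng F ` cell u s = {vtx (endpoint u s)}" using cell_self[OF assms] by (force simp: F_simps)
  then show ?thesis by (simp add: quotient_category_def)
qed

text \<open>Composition in the quotient is a union over all pairs of representatives. The congruence
  makes every pair contribute the same class, and nonempty factors make the union equal to
  it.\<close>

lemma comp_cell:
  assumes "u \<in> V" "valid u s" "valid (endpoint u s) t"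
  shows "comp \<Lambda> (cell (endpoint u s) t) (cell u s) = cell u (s @ t)"
proof -
  let ?A = "cell (endpoint u s) t" and ?B = "cell u s"
  have "cgr `` {comp F f g} = cell u (s @ t)" if "f \<in> ?A" "g \<in> ?B" for f g
  proof -
    have "(mor (endpoint u s) t, f) \<in> cgr" "(mor u s, g) \<in> cgr" using that by (auto simp: cell_def)
    then have "(comp F (mor (endpoint u s) t) (mor u s), comp F f g) \<in> cgr"
      by (rule congruence.comp) (simp add: F_simps)
    then show ?thesis unfolding cell_def mor_append by (rule class_eq[symmetric])
  qed
  moreover have "?A \<noteq> {}" "?B \<noteq> {}"
    using cell_self assms endpoint_in_V by blast+
  ultimately have "(\<Union>f\<in>?A. \<Union>g\<in>?B. cgr `` {comp F f g}) = cell u (s @ t)" by simp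
  then show ?thesis by (simp add: quotient_category_def)
qed

lemma Ob_quotient: "Ob \<Lambda> = vtx ` V"
  by (simp add: quotient_category_def F_simps verts_G)

lemma ident_cell: "u \<in> V \<Longrightarrow> ident \<Lambda> (vtx u) = cell u []"
  by (simp add: quotient_category_def F_simps cell_def mor_def)

lemma cell_lift:
  assumes "M \<in> Mor \<Lambda>" "u \<in> V" "src \<Lambda> M = vtx u"
  obtains s where "valid u s" "M = cell u s"
proof -
  obtain u' s' where u': "u' \<in> V" "valid u' s'" "M = cell u' s'" using assms(1) by (rule Mor_quotientE)
  have "fst (mor u' s') = vtx u" using src_cell[OF u'(1,2)] assms(3) u'(3) by simp
  then obtain s where "valid u s" "mor u' s' = mor u s"
    using Mor_lift[OF mor_in_Mor[OF u'(1,2)] assms(2)] by blast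
  then show thesis using that u'(3) by (simp add: cell_def)
qed

text \<open>The later morphism is lifted where the lift of the earlier one ends, which reduces
  composition to concatenation of words.\<close>

lemma composableE:
  assumes "f \<in> Mor \<Lambda>" "g \<in> Mor \<Lambda>" "src \<Lambda> f = rng \<Lambda> g"
  obtains u s t where "u \<in> V" "valid u s" "valid (endpoint u s) t" "g = cell u s" "f = cell (endpoint u s) t"
proof -
  obtain u s where u: "u \<in> V" "valid u s" "g = cell u s" using assms(2) by (rule Mor_quotientE)
  have "src \<Lambda> f = vtx (endpoint u s)" using assms(3) rng_cell[OF u(1,2)] u(3) by simp
  then obtain t where "valid (endpoint u s) t" "f = cell (endpoint u s) t"
    using cell_lift[OF assms(1) endpoint_in_V[OF u(1,2)]] by blast
  then show thesis using that u by blast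
qed

lemma small_category_quotient: "small_category \<Lambda>"
proof
  fix f assume "f \<in> Mor \<Lambda>"
  then obtain u s where u: "u \<in> V" "valid u s" "f = cell u s" by (rule Mor_quotientE)
  note e = endpoint_in_V[OF u(1,2)]
  show "src \<Lambda> f \<in> Ob \<Lambda>" using u by (simp add: src_cell Ob_quotient)
  show "rng \<Lambda> f \<in> Ob \<Lambda>" using u e by (simp add: rng_cell Ob_quotient)
  show "comp \<Lambda> f (ident \<Lambda> (src \<Lambda> f)) = f"
    using comp_cell[OF u(1), of "[]" s] u by (simp add: src_cell ident_cell)
  show "comp \<Lambda> (ident \<Lambda> (rng \<Lambda> f)) f = f"
    using comp_cell[OF u(1,2), of "[]"] u e by (simp add: rng_cell ident_cell)
next
  fix v assume "v \<in> Ob \<Lambda>"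
  then obtain u where "u \<in> V" "v = vtx u" by (auto simp: Ob_quotient)
  then show "ident \<Lambda> v \<in> Mor \<Lambda>" "src \<Lambda> (ident \<Lambda> v) = v" "rng \<Lambda> (ident \<Lambda> v) = v"
    by (simp_all add: ident_cell cell_in_Mor src_cell rng_cell)
next
  fix f g assume "f \<in> Mor \<Lambda>" "g \<in> Mor \<Lambda>" "src \<Lambda> f = rng \<Lambda> g"
  then obtain u s t where u: "u \<in> V" "valid u s" "valid (endpoint u s) t" "g = cell u s" "f = cell (endpoint u s) t"
    by (rule composableE)
  have st: "valid u (s @ t)" using u by simp
  show "comp \<Lambda> f g \<in> Mor \<Lambda>" "src \<Lambda> (comp \<Lambda> f g) = src \<Lambda> g" "rng \<Lambda> (comp \<Lambda> f g) = rng \<Lambda> f"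
    using u st endpoint_in_V by (simp_all add: comp_cell cell_in_Mor src_cell rng_cell)
next
  fix f g h assume Mor: "f \<in> Mor \<Lambda>" "g \<in> Mor \<Lambda>" "h \<in> Mor \<Lambda>" and fg: "src \<Lambda> f = rng \<Lambda> g" and gh: "src \<Lambda> g = rng \<Lambda> h"
  obtain u s t where u: "u \<in> V" "valid u s" "valid (endpoint u s) t" "h = cell u s" "g = cell (endpoint u s) t"
    using Mor(2,3) gh by (rule composableE)
  have st: "valid u (s @ t)" using u by simp
  have "src \<Lambda> f = vtx (endpoint u (s @ t))"
    using fg u endpoint_in_V by (simp add: rng_cell)
  then obtain r where r: "valid (endpoint u (s @ t)) r" "f = cell (endpoint u (s @ t)) r"
    using cell_lift[OF Mor(1) endpoint_in_V[OF u(1) st]] by blast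
  have "comp \<Lambda> (comp \<Lambda> f g) h = cell u (s @ t @ r)"
    using comp_cell[OF endpoint_in_V[OF u(1,2)] u(3), of r] comp_cell[OF u(1,2), of "t @ r"] u r by simp
  moreover have "comp \<Lambda> f (comp \<Lambda> g h) = cell u (s @ t @ r)"
    using comp_cell[OF u(1-3)] comp_cell[OF u(1) st r(1)] u r by simp
  ultimately show "comp \<Lambda> (comp \<Lambda> f g) h = comp \<Lambda> f (comp \<Lambda> g h)" by simp
qed

text \<open>Edges of each colour are counted in an arbitrary representative, so no lift has to be
  chosen. The value 0 from \<open>k\<close> on puts the function into
  \<open>degrees k\<close>.\<close>

definition degree :: "('o \<times> 'e list \<times> 'o) set \<Rightarrow> nat \<Rightarrow> nat" where
  "degree M = (\<lambda>i. if i < k then length (filter (\<lambda>e. e \<in> E i) (fst (snd (SOME f. f \<in> M)))) else 0)"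

text \<open>Different colours share no edge: a common one would lift at \<open>u\<close> in two
  directions, against \<open>edge_inj\<close>.\<close>

lemma edge_in_E_iff:
  assumes "u \<in> V" "j < k" "(u j, b) \<in> A j" "i < k"
  shows "edge u j b \<in> E i \<longleftrightarrow> j = i"
proof
  assume "edge u j b \<in> E i"
  then obtain b' where b': "(u i, b') \<in> A i" "edge u j b = edge u i b'"
    using edge_lift[OF assms(4) _ assms(1) tail_edge[OF assms(1-3)]] by blast
  then show "j = i" using edge_inj[OF assms(1-4) b'] by simp
next
  assume "j = i"
  then show "edge u j b \<in> E i" using edge_E[OF assms(1-3)] by simp
qed

lemma length_filter_word:
  "u \<in> V \<Longrightarrow> valid u s \<Longrightarrow> i < k \<Longrightarrow> length (filter (\<lambda>e. e \<in> E i) (word u s)) = length (proj i s)"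
proof (induction s arbitrary: u)
  case (Cons x s)
  obtain j b where x: "x = (j, b)" by (cases x)
  have u: "j < k" "(u j, b) \<in> A j" "valid (u(j := b)) s" using Cons.prems x by auto
  have "length (filter (\<lambda>e. e \<in> E i) (word (u(j := b)) s)) = length (proj i s)"
    using upd[OF Cons.prems(1) u(1,2)] u(3) Cons.prems(3) by (rule Cons.IH)
  then show ?case
    using edge_in_E_iff[OF Cons.prems(1) u(1,2) Cons.prems(3)] unfolding x by (cases "j = i") auto
qed simp

lemma degree_cell:
  assumes "u \<in> V" "valid u s"
  shows "degree (cell u s) = (\<lambda>i. length (proj i s))"
proof
  fix i
  have "(SOME f. f \<in> cell u s) \<in> cell u s" using cell_self[OF assms] by (rule someI)
  then obtain s' where s': "valid u s'" "(SOME f. f \<in> cell u s) = mor u s'" "\<And>i. proj i s' = proj i s"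
    using cell_mem[OF assms] by metis
  show "degree (cell u s) i = length (proj i s)"
    using length_filter_word[OF assms(1) s'(1)] valid_proj_eq_Nil[OF assms(2)] s'(3)
    unfolding degree_def s'(2) by (simp add: mor_def)
qed

lemma countable_Mor_quotient: "countable (Mor \<Lambda>)"
proof -
  have "Mor F \<subseteq> verts G \<times> lists (arcs G) \<times> range vtx"
  proof
    fix f assume f: "f \<in> Mor F"
    obtain u where u: "u \<in> V" "fst f = vtx u" using Mor_src[OF f] by blast
    obtain s where s: "valid u s" "f = mor u s" using Mor_lift[OF f u] .
    obtain a xs b where abc: "f = (a, xs, b)" by (cases f)
    then have "a \<in> verts G" "set xs \<subseteq> arcs G" using f by (simp_all add: F_simps pre_digraph.awalk_def)
    then show "f \<in> verts G \<times> lists (arcs G) \<times> range vtx" using s abc by (auto simp: mor_def)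
  qed
  moreover have "snd (snd f) \<in> verts G" if f: "f \<in> Mor F" for f
  proof -
    obtain u where u: "u \<in> V" "fst f = vtx u" using Mor_src[OF f] by blast
    obtain s where s: "valid u s" "f = mor u s" using Mor_lift[OF f u] .
    show ?thesis using s endpoint_in_V[OF u(1) s(1)] by (simp add: verts_G)
  qed
  ultimately have "Mor F \<subseteq> verts G \<times> lists (arcs G) \<times> verts G" by fastforce
  moreover have "countable (verts G \<times> lists (arcs G) \<times> verts G)"
    using finite_verts finite_arcs by (intro countable_SIGMA countable_lists) (auto intro: countable_finite)
  ultimately show ?thesis unfolding Mor_quotient by (intro countable_image) (rule countable_subset)
qed

section \<open>Unique factorisation and the axioms of a \<open>k\<close>-graph\<close>

lemma merge_valid:
  assumes "\<And>i. i < k \<Longrightarrow> walk (A i) (u i) (w i)"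
  shows "valid u (merge k w)"
  unfolding valid_iff using colours_merge[of k w] assms by (simp add: proj_merge)

lemma factorization_quotient:
  assumes f: "f \<in> Mor \<Lambda>" and m: "m \<in> degrees k" and n: "n \<in> degrees k" and deg: "degree f = (\<lambda>i. m i + n i)"
  shows "\<exists>!(g, h). g \<in> Mor \<Lambda> \<and> h \<in> Mor \<Lambda> \<and> src \<Lambda> g = rng \<Lambda> h \<and> f = comp \<Lambda> g h \<and> degree g = m \<and> degree h = n"
proof -
  obtain u s where u: "u \<in> V" "valid u s" "f = cell u s" using f by (rule Mor_quotientE)
  have len: "length (proj i s) = m i + n i" for i
    using fun_cong[OF deg, of i] u by (simp add: degree_cell)
  have walks: "walk (A i) (u i) (proj i s)" if "i < k" for i using u(2) that unfolding valid_iff by blast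
  \<comment> \<open>In \<open>comp g h\<close> the path of \<open>h\<close> is walked first, so it
    takes the first \<open>n i\<close> steps of each walk and \<open>g\<close> the remaining
    \<open>m i\<close>.\<close>
  define t where "t = merge k (\<lambda>i. take (n i) (proj i s))"
  define r where "r = merge k (\<lambda>i. drop (n i) (proj i s))"
  have walk2: "walk (A i) (u i) (take (n i) (proj i s)) \<and>
      walk (A i) (last (u i # take (n i) (proj i s))) (drop (n i) (proj i s))" if "i < k" for i
    using walks[OF that] by (metis append_take_drop_id walk_append)
  have pt: "proj i t = take (n i) (proj i s)" and pr: "proj i r = drop (n i) (proj i s)" for i
    using valid_proj_eq_Nil[OF u(2), of i] by (auto simp: t_def r_def proj_merge)
  have t: "valid u t" unfolding t_def using walk2 by (intro merge_valid) blast
  have r: "valid (endpoint u t) r"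
    unfolding r_def using walk2 by (intro merge_valid) (simp add: endpoint_eq_last pt)
  have eq: "f = cell u (t @ r)"
    unfolding u(3) using u t r by (subst cell_eq_iff) (simp_all add: pt pr)
  note e = endpoint_in_V[OF u(1) t]
  show ?thesis
  proof (rule ex1I[of _ "(cell (endpoint u t) r, cell u t)"], goal_cases)
    case 1
    have "degree (cell (endpoint u t) r) = m" "degree (cell u t) = n"
      using u(1) t r e len by (auto simp: degree_cell pt pr)
    then show ?case
      using u(1) t r e eq by (simp add: cell_in_Mor src_cell rng_cell comp_cell)
  next
    case (2 gh)
    obtain g h where gh: "gh = (g, h)" by (cases gh)
    with 2 have g: "g \<in> Mor \<Lambda>" and h: "h \<in> Mor \<Lambda>" and comp: "src \<Lambda> g = rng \<Lambda> h" "f = comp \<Lambda> g h"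
      and dh: "degree h = n" by auto
    have "src \<Lambda> h = src \<Lambda> f"
      unfolding comp(2) using small_category.src_comp[OF small_category_quotient g h comp(1)] by simp
    then have "src \<Lambda> h = vtx u" using u by (simp add: src_cell)
    then obtain t' where t': "valid u t'" "h = cell u t'" using cell_lift[OF h u(1)] by blast
    have "src \<Lambda> g = vtx (endpoint u t')" using comp(1) t' u(1) by (simp add: rng_cell)
    then obtain r' where r': "valid (endpoint u t') r'" "g = cell (endpoint u t') r'"
      using cell_lift[OF g endpoint_in_V[OF u(1) t'(1)]] by blast
    have "cell u s = cell u (t' @ r')" using comp(2) comp_cell[OF u(1) t'(1) r'(1)] t' r' u(3) by simp
    then have p: "proj i s = proj i t' @ proj i r'" for i
      using u t' r' by (subst (asm) cell_eq_iff) simp_all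
    \<comment> \<open>The degree of \<open>h\<close> fixes where each walk is cut, and a list splits
      uniquely at a given length.\<close>
    have "length (proj i t') = n i" for i
      using fun_cong[OF dh, of i] t' u(1) by (simp add: degree_cell)
    then have "proj i t' = proj i t" "proj i r' = proj i r" for i
      using p[of i] by (simp_all add: pt pr)
    \<comment> \<open>The end points must agree before the second factors can be compared, since
      their lifts start there.\<close>
    moreover from this have "endpoint u t' = endpoint u t" by (intro endpoint_cong)
    ultimately show ?case
      using t t' r r' e u(1) unfolding gh by (simp add: cell_eq_iff)
  qed
qed

lemma k_graph_quotient: "k_graph k \<Lambda> degree"
proof (intro k_graph.intro small_category_quotient k_graph_axioms.intro countable_Mor_quotient factorization_quotient)
  fix f assume "f \<in> Mor \<Lambda>"
  then show "degree f \<in> degrees k" by (auto simp: degrees_def degree_def)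
next
  fix v assume "v \<in> Ob \<Lambda>"
  then show "degree (ident \<Lambda> v) = (\<lambda>_. 0)" by (auto simp: Ob_quotient ident_cell degree_cell)
next
  fix f g assume "f \<in> Mor \<Lambda>" "g \<in> Mor \<Lambda>" "src \<Lambda> f = rng \<Lambda> g"
  then obtain u s t where u: "u \<in> V" "valid u s" "valid (endpoint u s) t" "g = cell u s" "f = cell (endpoint u s) t"
    by (rule composableE)
  then show "degree (comp \<Lambda> f g) = (\<lambda>i. degree f i + degree g i)"
    using endpoint_in_V[OF u(1,2)] by (auto simp: comp_cell degree_cell)
qed

lemma bij_betw_ident: "bij_betw (ident \<Lambda>) (verts G) {f \<in> Mor \<Lambda>. degree f = (\<lambda>_. 0)}"
proof (rule bij_betw_imageI)
  show "inj_on (ident \<Lambda>) (verts G)"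
    using small_category.src_ident[OF small_category_quotient] by (metis Ob_quotient inj_on_inverseI verts_G)
  show "ident \<Lambda> ` verts G = {f \<in> Mor \<Lambda>. degree f = (\<lambda>_. 0)}"
  proof (intro equalityI subsetI)
    fix f assume "f \<in> ident \<Lambda> ` verts G"
    then show "f \<in> {f \<in> Mor \<Lambda>. degree f = (\<lambda>_. 0)}"
      by (auto simp: verts_G ident_cell cell_in_Mor degree_cell)
  next
    fix f assume f: "f \<in> {f \<in> Mor \<Lambda>. degree f = (\<lambda>_. 0)}"
    then obtain u s where u: "u \<in> V" "valid u s" "f = cell u s" using Mor_quotientE by blast
    have "length (proj i s) = 0" for i using f u degree_cell[OF u(1,2)] by (auto dest: fun_cong[of _ _ i])
    then have "s = []" by (intro all_proj_Nil) simp
    then have "f = ident \<Lambda> (vtx u)" using u by (simp add: ident_cell)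
    then show "f \<in> ident \<Lambda> ` verts G" using u(1) by (simp add: verts_G)
  qed
qed

section \<open>The 1-skeleton and row-finiteness\<close>

definition edge_cell :: "'e \<Rightarrow> ('o \<times> 'e list \<times> 'o) set" where
  "edge_cell e = cgr `` {(tail G e, [e], head G e)}"

lemma edge_cell:
  "u \<in> V \<Longrightarrow> i < k \<Longrightarrow> (u i, b) \<in> A i \<Longrightarrow> edge_cell (edge u i b) = cell u [(i, b)]"
  by (simp add: edge_cell_def cell_def mor_def tail_edge head_edge)

lemma edgeE:
  assumes "i < k" "e \<in> E i"
  obtains u b where "u \<in> V" "(u i, b) \<in> A i" "e = edge u i b"
  using tail_E[OF assms] edge_lift[OF assms] that by (metis imageE)

lemma src_rng_edge_cell:
  assumes "i < k" "e \<in> E i"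
  shows "src \<Lambda> (edge_cell e) = tail G e" "rng \<Lambda> (edge_cell e) = head G e"
proof -
  obtain u b where u: "u \<in> V" "(u i, b) \<in> A i" "e = edge u i b" using assms by (rule edgeE)
  then show "src \<Lambda> (edge_cell e) = tail G e" "rng \<Lambda> (edge_cell e) = head G e"
    using assms(1) by (simp_all add: edge_cell src_cell rng_cell tail_edge head_edge)
qed

lemma bij_betw_edge_cell:
  assumes i: "i < k"
  shows "bij_betw edge_cell (E i) {f \<in> Mor \<Lambda>. degree f = unit_degree i}"
proof (rule bij_betw_imageI)
  show "inj_on edge_cell (E i)"
  proof (rule inj_onI)
    fix x y assume xy: "x \<in> E i" "y \<in> E i" "edge_cell x = edge_cell y"
    obtain u b where u: "u \<in> V" "(u i, b) \<in> A i" "x = edge u i b" using i xy(1) by (rule edgeE)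
    \<comment> \<open>Equal classes have equal origins, so both edges lift at the same tuple and can
      be compared by projections.\<close>
    have "tail G y = vtx u"
      using src_rng_edge_cell(1)[OF i xy(1)] src_rng_edge_cell(1)[OF i xy(2)] xy(3) u i by (simp add: tail_edge)
    then obtain c where c: "(u i, c) \<in> A i" "y = edge u i c" using edge_lift[OF i xy(2) u(1)] by blast
    have "cell u [(i, b)] = cell u [(i, c)]" using xy(3) u c i by (simp add: edge_cell)
    then have "\<forall>j. proj j [(i, b)] = proj j [(i, c)]"
      using u c i by (subst (asm) cell_eq_iff) simp_all
    then have "b = c" by (auto dest: spec[of _ i])
    then show "x = y" using u c by simp
  qed
  show "edge_cell ` E i = {f \<in> Mor \<Lambda>. degree f = unit_degree i}"
  proof (intro equalityI subsetI)
    fix f assume "f \<in> edge_cell ` E i"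
    then obtain e where e: "e \<in> E i" "f = edge_cell e" by blast
    obtain u b where "u \<in> V" "(u i, b) \<in> A i" "e = edge u i b" using i e(1) by (rule edgeE)
    then show "f \<in> {f \<in> Mor \<Lambda>. degree f = unit_degree i}"
      using i e(2) by (auto simp: edge_cell cell_in_Mor degree_cell unit_degree_def)
  next
    fix f assume f: "f \<in> {f \<in> Mor \<Lambda>. degree f = unit_degree i}"
    then obtain u s where u: "u \<in> V" "valid u s" "f = cell u s" using Mor_quotientE by blast
    have len: "length (proj j s) = (if j = i then 1 else 0)" for j
      using f u degree_cell[OF u(1,2)] by (auto simp: unit_degree_def dest: fun_cong[of _ _ j])
    \<comment> \<open>A word whose projections have total length one is a single letter, here of
      colour \<open>i\<close>.\<close>
    have "s \<noteq> []" using len[of i] by auto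
    then obtain j b t where s: "s = (j, b) # t" by (metis list.exhaust surj_pair)
    have "j = i" using len[of j] unfolding s by (auto split: if_splits)
    have "proj l t = []" for l using len[of l] \<open>j = i\<close> unfolding s by (auto split: if_splits)
    then have "t = []" by (rule all_proj_Nil)
    with \<open>j = i\<close> have "f = edge_cell (edge u i b)" "edge u i b \<in> E i"
      using u i s by (simp_all add: edge_cell edge_E)
    then show "f \<in> edge_cell ` E i" by blast
  qed
qed

text \<open>A morphism of degree \<open>n\<close> is represented by a path whose length is the sum
  of the entries of \<open>n\<close>, and a finite set of arcs allows only finitely many of
  these.\<close>

lemma row_finite_quotient: "row_finite k \<Lambda> degree"
  unfolding row_finite_def
proof (intro ballI)
  fix v n assume n: "n \<in> degrees k"
  let ?W = "{xs. set xs \<subseteq> arcs G \<and> length xs = (\<Sum>i<k. n i)}"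
  have "{f \<in> Mor \<Lambda>. rng \<Lambda> f = v \<and> degree f = n} \<subseteq> (\<lambda>f. cgr `` {f}) ` (verts G \<times> ?W \<times> {v})"
  proof
    fix f assume f: "f \<in> {f \<in> Mor \<Lambda>. rng \<Lambda> f = v \<and> degree f = n}"
    then obtain u s where u: "u \<in> V" "valid u s" "f = cell u s" using Mor_quotientE by blast
    have "length (proj i s) = n i" for i using f u degree_cell[OF u(1,2)] by (auto dest: fun_cong[of _ _ i])
    moreover have "length (word u s) = length s" for u s
      by (induction s arbitrary: u) (auto simp: split_paired_all)
    ultimately have "length (word u s) = (\<Sum>i<k. n i)"
      using length_eq_sum_proj[of s k] u(2) unfolding valid_iff by simp
    moreover have "set (word u s) \<subseteq> arcs G"
      using mor_in_Mor[OF u(1,2)] by (simp add: mor_def F_simps pre_digraph.awalk_def)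
    moreover have "vtx (endpoint u s) = v" using f u by (simp add: rng_cell)
    ultimately have "mor u s \<in> verts G \<times> ?W \<times> {v}" using u(1) by (simp add: mor_def verts_G)
    then show "f \<in> (\<lambda>f. cgr `` {f}) ` (verts G \<times> ?W \<times> {v})" unfolding u(3) cell_def by (rule imageI)
  qed
  moreover have "finite (verts G \<times> ?W \<times> {v})"
    using finite_verts finite_lists_length_eq[OF finite_arcs] by simp
  ultimately show "finite {f \<in> Mor \<Lambda>. rng \<Lambda> f = v \<and> degree f = n}"
    using finite_surj by blast
qed

end

section \<open>The cover of a cube complex by a product of trees\<close>

declare One_nat_def [simp del]

section \<open>Cells of dimension at most two\<close>

definition product_vertex :: "nat \<Rightarrow> (nat \<Rightarrow> 'v) \<Rightarrow> nat \<Rightarrow> 'v \<Rightarrow> real" where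
  "product_vertex k u = (\<lambda>j\<in>{..<k}. indicator {u j})"

definition product_edge :: "nat \<Rightarrow> (nat \<Rightarrow> 'v) \<Rightarrow> nat \<Rightarrow> 'v \<Rightarrow> (nat \<Rightarrow> real) \<Rightarrow> nat \<Rightarrow> 'v \<Rightarrow> real" where
  "product_edge k u i b = (\<lambda>x\<in>cube 1. \<lambda>l\<in>{..<k}.
     if l = i then edge_point (u i) b (x 0) else indicator {u l})"

definition product_square ::
  "nat \<Rightarrow> (nat \<Rightarrow> 'v) \<Rightarrow> nat \<Rightarrow> 'v \<Rightarrow> nat \<Rightarrow> 'v \<Rightarrow> (nat \<Rightarrow> real) \<Rightarrow> nat \<Rightarrow> 'v \<Rightarrow> real" where
  "product_square k u i b j c = (\<lambda>x\<in>cube 2. \<lambda>l\<in>{..<k}.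
     if l = i then edge_point (u i) b (x 0) else if l = j then edge_point (u j) c (x 1) else indicator {u l})"

lemma lessThan_1: "{..<1::nat} = {0}" and lessThan_2: "{..<2::nat} = {0, 1}"
  by auto

lemma cube_0: "cube 0 = {\<lambda>_. undefined}"
  by (simp add: cube_def)

lemma product_cell_0: "product_cell k 0 \<iota> u w = (\<lambda>x\<in>cube 0. product_vertex k u)"
  by (simp add: product_cell_def product_vertex_def)

lemma product_cell_1: "product_cell k 1 \<iota> u w = product_edge k u (\<iota> 0) (w (\<iota> 0))"
proof -
  have "inv_into {0} \<iota> (\<iota> 0) = 0" by (rule inv_into_f_f) auto
  then show ?thesis
    unfolding product_cell_def product_edge_def lessThan_1 by (intro restrict_ext) auto
qed

lemma product_cell_2:
  assumes "\<iota> 0 \<noteq> \<iota> 1"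
  shows "product_cell k 2 \<iota> u w = product_square k u (\<iota> 0) (w (\<iota> 0)) (\<iota> 1) (w (\<iota> 1))"
proof -
  have "inj_on \<iota> {0, 1}" using assms by auto
  then have "inv_into {0, 1} \<iota> (\<iota> 0) = 0" "inv_into {0, 1} \<iota> (\<iota> 1) = 1"
    by (auto intro: inv_into_f_f)
  then show ?thesis
    unfolding product_cell_def product_square_def lessThan_2 by (intro restrict_ext) auto
qed

lemma product_vertex_inj:
  assumes "product_vertex k u = product_vertex k w" "j < k"
  shows "u j = w j"
  using fun_cong[OF assms(1), of j] assms(2) by (simp add: product_vertex_def)

text \<open>The function \<open>u\<close> describing a cell is arbitrary outside
  \<open>{..<k}\<close>, whereas members of \<open>tuples\<close> are extensional; restriction
  passes to the latter without changing the cell.\<close>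

lemma product_vertex_restrict [simp]: "product_vertex k (restrict u {..<k}) = product_vertex k u"
  by (auto simp: product_vertex_def)

lemma product_edge_restrict [simp]:
  "i < k \<Longrightarrow> product_edge k (restrict u {..<k}) i b = product_edge k u i b"
  unfolding product_edge_def by (intro restrict_ext) simp

lemma product_square_restrict [simp]:
  "i < k \<Longrightarrow> j < k \<Longrightarrow> product_square k (restrict u {..<k}) i b j c = product_square k u i b j c"
  unfolding product_square_def by (intro restrict_ext) simp

definition edge_end :: "real \<Rightarrow> nat \<Rightarrow> real" where
  "edge_end e = (\<lambda>i\<in>{..<1}. e)"

lemma edge_end_in_cube: "edge_end 0 \<in> cube 1" "edge_end 1 \<in> cube 1"
  by (auto simp: edge_end_def cube_def)

lemma product_edge_ends:
  assumes "i < k"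
  shows "product_edge k u i b (edge_end 0) = product_vertex k u"
    and "product_edge k u i b (edge_end 1) = product_vertex k (u(i := b))"
  using assms edge_end_in_cube
  by (auto simp: product_edge_def product_vertex_def edge_end_def intro!: restrict_ext)

lemma product_edge_apply:
  "x \<in> cube 1 \<Longrightarrow> product_edge k u i b x =
    (\<lambda>l\<in>{..<k}. if l = i then edge_point (u i) b (x 0) else indicator {u l})"
  by (simp add: product_edge_def)

lemma product_square_apply:
  "x \<in> cube 2 \<Longrightarrow> product_square k u i b j c x = (\<lambda>l\<in>{..<k}.
     if l = i then edge_point (u i) b (x 0) else if l = j then edge_point (u j) c (x 1) else indicator {u l})"
  by (simp add: product_square_def)

lemma restrict_in_cube_2:
  assumes "h 0 \<in> {0..1}" "h 1 \<in> {0..1}"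
  shows "(\<lambda>l\<in>{..<Suc 1}. h l) \<in> cube 2"
proof -
  have "{..<Suc 1} = {..<2::nat}" by auto
  then show ?thesis using assms unfolding cube_def restrict_PiE_iff by (simp add: lessThan_2)
qed

text \<open>The arguments are the face inclusions in the form in which \<open>cube_face 1\<close>
  unfolds. When coordinate 0 is fixed, the free coordinate 1 receives \<open>x (1 - 1)\<close>, that
  is \<open>x 0\<close>.\<close>

lemma product_square_face:
  assumes "x \<in> cube 1" "i \<noteq> j" "i < k" "j < k"
  shows "product_square k u i b j c (\<lambda>l\<in>{..<Suc 1}. if l < 1 then x l else if l = 1 then 0 else x (l - 1)) =
      product_edge k u i b x"
    and "product_square k u i b j c (\<lambda>l\<in>{..<Suc 1}. if l < 1 then x l else if l = 1 then 1 else x (l - 1)) =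
      product_edge k (u(j := c)) i b x"
    and "product_square k u i b j c (\<lambda>l\<in>{..<Suc 1}. if l < 0 then x l else if l = 0 then 0 else x (l - 1)) =
      product_edge k u j c x"
    and "product_square k u i b j c (\<lambda>l\<in>{..<Suc 1}. if l < 0 then x l else if l = 0 then 1 else x (l - 1)) =
      product_edge k (u(i := b)) j c x"
proof -
  let ?y = "\<lambda>m e l. (if l < m then x l else if l = m then e else x (l - 1))"
  let ?y1 = "\<lambda>l\<in>{..<Suc 1}. ?y 1 0 l" and ?y2 = "\<lambda>l\<in>{..<Suc 1}. ?y 1 1 l"
    and ?y3 = "\<lambda>l\<in>{..<Suc 1}. ?y 0 0 l" and ?y4 = "\<lambda>l\<in>{..<Suc 1}. ?y 0 1 l"
  have "x 0 \<in> {0..1}" using assms(1) unfolding cube_def by (rule PiE_mem) simp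
  then have y: "?y1 \<in> cube 2" "?y2 \<in> cube 2" "?y3 \<in> cube 2" "?y4 \<in> cube 2"
    by - (rule restrict_in_cube_2; simp)+
  show "product_square k u i b j c ?y1 = product_edge k u i b x"
    "product_square k u i b j c ?y2 = product_edge k (u(j := c)) i b x"
    "product_square k u i b j c ?y3 = product_edge k u j c x"
    "product_square k u i b j c ?y4 = product_edge k (u(i := b)) j c x"
    unfolding product_square_apply[OF y(1)] product_square_apply[OF y(2)] product_square_apply[OF y(3)]
      product_square_apply[OF y(4)] product_edge_apply[OF assms(1)]
    using assms(2-) by (auto intro!: restrict_ext)
qed

section \<open>Lifts of the cells of the complex\<close>

locale tree_cover =
  fixes k :: nat and X :: "'a::topological_space cube_complex"
    and T :: "nat \<Rightarrow> 'v pair_pre_digraph" and p :: "(nat \<Rightarrow> 'v \<Rightarrow> real) \<Rightarrow> 'a"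
  assumes k_cube_complex: "k_cube_complex k X T p"
begin

abbreviation "cover \<equiv> underlying (tree_product k T)"

definition tuples :: "(nat \<Rightarrow> 'v) set" where
  "tuples = (\<Pi>\<^sub>E j\<in>{..<k}. pverts (T j))"

definition vtx :: "(nat \<Rightarrow> 'v) \<Rightarrow> 'a" where
  "vtx u = p (product_vertex k u)"

definition edge :: "(nat \<Rightarrow> 'v) \<Rightarrow> nat \<Rightarrow> 'v \<Rightarrow> (nat \<Rightarrow> real) \<Rightarrow> 'a" where
  "edge u i b = compose (cube 1) p (product_edge k u i b)"

lemma complex: "is_cube_complex X"
  and covering: "covering_space cover p (underlying X)"
  and simply_connected_cover: "simply_connected cover"
  and charmaps_X: "charmaps X n = (\<lambda>q. compose (cube n) p q) ` charmaps (tree_product k T) n"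
  using k_cube_complex unfolding k_cube_complex_def universal_cover_def by simp_all

lemma deck_separates:
  assumes "deck_transformation cover p g" "i < k" "x \<in> cover" "y \<in> cover" "x i = y i"
  shows "g x i = g y i"
  using assms k_cube_complex unfolding k_cube_complex_def by meson

lemma arc:
  assumes "i < k" "(a, b) \<in> parcs (T i)"
  shows arc_verts: "a \<in> pverts (T i)" "b \<in> pverts (T i)"
    and arc_sym: "(b, a) \<in> parcs (T i)"
    and arc_neq: "a \<noteq> b"
proof -
  have "is_tree (T i)" using k_cube_complex assms(1) unfolding k_cube_complex_def by simp
  then interpret pair_bidirected_digraph "T i" by (simp add: is_tree_def)
  show "a \<in> pverts (T i)" "b \<in> pverts (T i)"
    using arc_fst_in_verts[OF assms(2)] arc_snd_in_verts[OF assms(2)] by simp_all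
  show "(b, a) \<in> parcs (T i)"
    using pair_sym_arcs assms(2) unfolding symmetric_def by (auto dest: symD)
  show "a \<noteq> b" using pair_no_loops[OF assms(2)] by simp
qed

lemma fun_upd_tuples: "u \<in> tuples \<Longrightarrow> i < k \<Longrightarrow> (a, b) \<in> parcs (T i) \<Longrightarrow> u(i := b) \<in> tuples"
  using arc_verts(2)[of i a b] unfolding tuples_def by (auto simp: PiE_iff extensional_def)

lemma charmap_tree_in_cover:
  assumes "q \<in> charmaps (tree_product k T) n" "x \<in> cube n"
  shows "q x \<in> cover"
  using assms(1)
proof (rule product_cellE)
  fix \<iota> u w assume q: "q = product_cell k n \<iota> u w" "inj_on \<iota> {..<n}"
    and "\<And>j. j \<in> \<iota> ` {..<n} \<Longrightarrow> (u j, w j) \<in> parcs (T j)"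
      "\<And>j. j \<in> {..<k} - \<iota> ` {..<n} \<Longrightarrow> u j \<in> pverts (T j)"
  then show "q x \<in> cover"
    unfolding q(1) using assms(2) by (intro product_cell_in_underlying)
qed

lemma charmap_tree_continuous: "q \<in> charmaps (tree_product k T) n \<Longrightarrow> continuous_on (cube n) q"
  by (elim product_cellE) (simp add: continuous_on_product_cell)

text \<open>The image \<open>L c\<close> of the centre lies in the open cell of some
  \<open>r\<close> in the product. The projection of \<open>r\<close> overlaps \<open>q\<close>, so
  \<open>q\<close> is that projection composed with a symmetry \<open>g\<close> of the cube. Hence
  \<open>L\<close> and \<open>r\<close> composed with \<open>g\<close> both lift \<open>q\<close>;
  they agree at \<open>c\<close>, and so on the connected cube.\<close>

lemma lift_of_charmap:
  assumes q: "q \<in> charmaps X n" and L: "continuous_on (cube n) L" "L \<in> cube n \<rightarrow> cover"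
    and pL: "\<And>x. x \<in> cube n \<Longrightarrow> p (L x) = q x"
  shows "restrict L (cube n) \<in> charmaps (tree_product k T) n"
proof -
  define c where "c = (\<lambda>i\<in>{..<n}. 1 / 2 :: real)"
  have c: "c \<in> open_cube n" "c \<in> cube n" by (auto simp: c_def open_cube_def cube_def)
  have "L c \<in> cover" using L(2) c by blast
  then obtain m r y where r: "r \<in> charmaps (tree_product k T) m" "y \<in> open_cube m" "r y = L c"
    by (rule tree_product_open_cells_cover) (auto dest: arc_verts)
  have y: "y \<in> cube m" using r open_cube_subset_cube by blast
  have pr: "compose (cube m) p r \<in> charmaps X m" using r charmaps_X by blast
  have "compose (cube m) p r y = q c" using y r pL c by (simp add: compose_def)
  then have "compose (cube m) p r ` open_cube m \<inter> q ` open_cube n \<noteq> {}"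
    using r(2) c(1) by blast
  from charmap_overlap[OF complex pr q this]
  obtain g where m: "m = n" and g: "g \<in> cube_syms n" "q = compose (cube n) (compose (cube m) p r) g" by blast
  obtain \<pi> F where \<pi>: "\<pi> permutes {..<n}" "g = cube_sym n \<pi> F" using g unfolding cube_syms_eq by blast
  have gx: "g x \<in> cube n" if "x \<in> cube n" for x using cube_sym_in_cube \<pi> that by blast
  have gc: "g c \<in> open_cube n" using cube_sym_in_open_cube \<pi> c by blast
  let ?M = "compose (cube n) r g"
  have M: "?M \<in> charmaps (tree_product k T) n"
    using r(1) g(1) unfolding m by (rule tree_product_charmaps_cube_syms) (rule arc_sym)
  have pM: "p (?M x) = q x" if "x \<in> cube n" for x
    using that gx[OF that] unfolding g(2) m compose_def by simp
  \<comment> \<open>The projection of \<open>r\<close> takes equal values at \<open>g c\<close> and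
    \<open>y\<close> and is injective on the open cube, so \<open>g c = y\<close>: the two lifts
    meet at the centre.\<close>
  have "compose (cube n) p r (g c) = compose (cube n) p r y"
    using pM[OF c(2)] c gc gx r(3) pL y m by (simp add: compose_def)
  then have "g c = y"
    using inj_onD[OF charmap_inj[OF complex pr]] gc r(2) m by blast
  then have "?M c = L c" using c r(3) by (simp add: compose_def)
  then have "L x = ?M x" if "x \<in> cube n" for x
    using covering_space_lifts_agree[OF covering connected_cube L charmap_tree_continuous[OF M], of c x]
      charmap_tree_in_cover[OF M] pL pM c(2) that by simp
  then have "restrict L (cube n) = ?M" by (auto simp: compose_def)
  then show ?thesis using M by simp
qed

lemma product_vertex_charmap: "u \<in> tuples \<Longrightarrow> (\<lambda>x\<in>cube 0. product_vertex k u) \<in> charmaps (tree_product k T) 0"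
  unfolding product_cell_0[symmetric, of _ _ id u] tuples_def
  by (rule product_cell_in_charmaps) auto

lemma tuples_verts: "u \<in> tuples \<Longrightarrow> j < k \<Longrightarrow> u j \<in> pverts (T j)"
  by (simp add: tuples_def PiE_iff)

lemma product_vertex_charmapE:
  assumes "q \<in> charmaps (tree_product k T) 0"
  obtains u where "u \<in> tuples" "q = (\<lambda>x\<in>cube 0. product_vertex k u)"
proof -
  from assms obtain \<iota> u w where "q = product_cell k 0 \<iota> u w" "\<And>j. j \<in> {..<k} \<Longrightarrow> u j \<in> pverts (T j)"
    by (elim product_cellE) simp
  then show thesis
    using that[of "restrict u {..<k}"] by (simp add: product_cell_0 tuples_def)
qed

lemma product_edge_charmap:
  assumes "u \<in> tuples" "i < k" "(u i, b) \<in> parcs (T i)"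
  shows "product_edge k u i b \<in> charmaps (tree_product k T) 1"
proof -
  have "product_cell k 1 (\<lambda>_. i) u (\<lambda>_. b) \<in> charmaps (tree_product k T) 1"
  proof (rule product_cell_in_charmaps, unfold lessThan_1)
    show "u l \<in> pverts (T l)" if "l \<in> {..<k} - (\<lambda>_. i) ` {0}" for l
      using that tuples_verts[OF assms(1), of l] by simp
  qed (use assms in auto)
  then show ?thesis by (simp add: product_cell_1)
qed

lemma product_edge_charmapE:
  assumes "q \<in> charmaps (tree_product k T) 1"
  obtains u i b where "u \<in> tuples" "i < k" "(u i, b) \<in> parcs (T i)" "q = product_edge k u i b"
proof -
  obtain \<iota> u w where q: "q = product_cell k 1 \<iota> u w" "\<iota> ` {..<1} \<subseteq> {..<k}"
    "\<And>j. j \<in> \<iota> ` {..<1} \<Longrightarrow> (u j, w j) \<in> parcs (T j)" "\<And>j. j \<in> {..<k} - \<iota> ` {..<1} \<Longrightarrow> u j \<in> pverts (T j)"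
    using assms by (rule product_cellE) blast
  have \<iota>: "\<iota> 0 < k" "(u (\<iota> 0), w (\<iota> 0)) \<in> parcs (T (\<iota> 0))" using q(2,3) unfolding lessThan_1 by auto
  have "u j \<in> pverts (T j)" if "j < k" for j
    using q(4)[unfolded lessThan_1, of j] arc_verts[OF \<iota>] that by (cases "j = \<iota> 0") auto
  then have "restrict u {..<k} \<in> tuples" by (simp add: tuples_def)
  then show thesis
    using that[of "restrict u {..<k}" "\<iota> 0" "w (\<iota> 0)"] \<iota> q(1) by (simp add: product_cell_1)
qed

lemma product_square_charmap:
  assumes "u \<in> tuples" "i < k" "j < k" "i \<noteq> j" "(u i, b) \<in> parcs (T i)" "(u j, c) \<in> parcs (T j)"
  shows "product_square k u i b j c \<in> charmaps (tree_product k T) 2"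
proof -
  let ?\<iota> = "\<lambda>l. if l = (0::nat) then i else j" and ?w = "\<lambda>l. if l = i then b else c"
  have "product_cell k 2 ?\<iota> u ?w \<in> charmaps (tree_product k T) 2"
  proof (rule product_cell_in_charmaps, unfold lessThan_2)
    show "inj_on ?\<iota> {0, 1}" "?\<iota> ` {0, 1} \<subseteq> {..<k}" using assms by auto
    have img: "?\<iota> ` {0, 1} = {i, j}" by auto
    show "(u l, ?w l) \<in> parcs (T l)" if "l \<in> ?\<iota> ` {0, 1}" for l
      using that assms unfolding img by (elim insertE) simp_all
    show "u l \<in> pverts (T l)" if "l \<in> {..<k} - ?\<iota> ` {0, 1}" for l
      using that tuples_verts[OF assms(1), of l] by simp
  qed
  then show ?thesis using assms(4) by (simp add: product_cell_2)
qed

lemma product_square_charmapE: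
  assumes "q \<in> charmaps (tree_product k T) 2"
  obtains u i b j c where "u \<in> tuples" "i < k" "j < k" "i \<noteq> j" "(u i, b) \<in> parcs (T i)"
    "(u j, c) \<in> parcs (T j)" "q = product_square k u i b j c"
proof -
  obtain \<iota> u w where q: "q = product_cell k 2 \<iota> u w" "inj_on \<iota> {..<2}" "\<iota> ` {..<2} \<subseteq> {..<k}"
    "\<And>j. j \<in> \<iota> ` {..<2} \<Longrightarrow> (u j, w j) \<in> parcs (T j)" "\<And>j. j \<in> {..<k} - \<iota> ` {..<2} \<Longrightarrow> u j \<in> pverts (T j)"
    using assms by (rule product_cellE) blast
  have \<iota>: "\<iota> 0 < k" "(u (\<iota> 0), w (\<iota> 0)) \<in> parcs (T (\<iota> 0))" "\<iota> 1 < k" "(u (\<iota> 1), w (\<iota> 1)) \<in> parcs (T (\<iota> 1))"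
    "\<iota> 0 \<noteq> \<iota> 1"
    using q(2,3,4) unfolding lessThan_2 by auto
  have "u j \<in> pverts (T j)" if "j < k" for j
    using q(5)[unfolded lessThan_2, of j] arc_verts[OF \<iota>(1,2)] arc_verts[OF \<iota>(3,4)] that
    by (cases "j = \<iota> 0"; cases "j = \<iota> 1") auto
  then have "restrict u {..<k} \<in> tuples" by (simp add: tuples_def)
  then show thesis
    using that[of "restrict u {..<k}" "\<iota> 0" "\<iota> 1" "w (\<iota> 0)" "w (\<iota> 1)"] \<iota> q(1) by (simp add: product_cell_2)
qed

lemma vertices_X: "vertices X = vtx ` tuples"
proof -
  have "vertices X = (\<lambda>q. p (q (\<lambda>_. undefined))) ` charmaps (tree_product k T) 0"
    unfolding vertices_def charmaps_X image_image by (simp add: compose_def cube_0)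
  also have "charmaps (tree_product k T) 0 = (\<lambda>u. \<lambda>x\<in>cube 0. product_vertex k u) ` tuples"
    using product_vertex_charmap by (auto elim: product_vertex_charmapE)
  finally show ?thesis unfolding image_image by (simp add: vtx_def cube_0)
qed

lemma oriented_edges_eq:
  assumes "i < k"
  shows "oriented_edges k T p i = {edge u i b | u b. u \<in> tuples \<and> (u i, b) \<in> parcs (T i)}"
proof -
  have eq: "tree_product_edges k T i = {product_edge k u i b | u b. u \<in> tuples \<and> (u i, b) \<in> parcs (T i)}"
  proof (intro equalityI subsetI)
    fix e assume "e \<in> tree_product_edges k T i"
    then have "e \<in> charmaps (tree_product k T) 1 \<and>
        (\<forall>x\<in>cube 1. \<forall>y\<in>cube 1. \<forall>j\<in>{..<k} - {i}. e x j = e y j)"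
      unfolding tree_product_edges_def mem_Collect_eq .
    note e = conjunct1[OF this] and const = conjunct2[OF this]
    obtain u i' b where u: "u \<in> tuples" "i' < k" "(u i', b) \<in> parcs (T i')" "e = product_edge k u i' b"
      using e by (rule product_edge_charmapE)
    \<comment> \<open>An edge joins distinct vertices in the coordinate that it moves, so constancy
      outside \<open>i\<close> forces its direction to be \<open>i\<close>.\<close>
    have "i' = i"
    proof (rule ccontr)
      assume "i' \<noteq> i"
      then have "i' \<in> {..<k} - {i}" using u(2) by simp
      with const edge_end_in_cube have "e (edge_end 0) i' = e (edge_end 1) i'" by (metis (no_types))
      then have "u i' = b"
        unfolding u(4) product_edge_ends[OF u(2)] using u(2) by (simp add: product_vertex_def)
      then show False using arc_neq[OF u(2,3)] by simp
    qed
    then show "e \<in> {product_edge k u i b | u b. u \<in> tuples \<and> (u i, b) \<in> parcs (T i)}" using u by blast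
  next
    fix e assume "e \<in> {product_edge k u i b | u b. u \<in> tuples \<and> (u i, b) \<in> parcs (T i)}"
    then obtain u b where u: "u \<in> tuples" "(u i, b) \<in> parcs (T i)" "e = product_edge k u i b" by blast
    have const: "e x j = e y j" if "x \<in> cube 1" "y \<in> cube 1" "j \<in> {..<k} - {i}" for x y j
      using that(3) unfolding u(3) product_edge_apply[OF that(1)] product_edge_apply[OF that(2)] by simp
    have "e \<in> charmaps (tree_product k T) 1"
      unfolding u(3) by (rule product_edge_charmap[OF u(1) assms u(2)])
    then show "e \<in> tree_product_edges k T i"
      unfolding tree_product_edges_def mem_Collect_eq by (intro conjI ballI const)
  qed
  show ?thesis unfolding oriented_edges_def edge_def eq by blast
qed

lemma origin_edge: "i < k \<Longrightarrow> origin (edge u i b) = vtx u"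
  and terminus_edge: "i < k \<Longrightarrow> terminus (edge u i b) = vtx (u(i := b))"
  unfolding origin_def terminus_def edge_def edge_end_def[symmetric] vtx_def
  by (simp_all add: compose_def product_edge_ends edge_end_in_cube)

text \<open>Two lifts of one edge with the same origin coincide by uniqueness of lifts, so they end
  at the same tuple. That tuple differs from \<open>u\<close> in exactly one coordinate, as trees
  have no loops, which identifies colour and target.\<close>

lemma edge_inj:
  assumes "u \<in> tuples" "i < k" "(u i, b) \<in> parcs (T i)" "i' < k" "(u i', b') \<in> parcs (T i')"
    and eq: "edge u i b = edge u i' b'"
  shows "i = i' \<and> b = b'"
proof -
  have e: "product_edge k u i b \<in> charmaps (tree_product k T) 1" "product_edge k u i' b' \<in> charmaps (tree_product k T) 1"
    using assms product_edge_charmap by blast+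
  have "p (product_edge k u i b x) = p (product_edge k u i' b' x)" if "x \<in> cube 1" for x
    using fun_cong[OF eq, of x] that unfolding edge_def by (simp add: compose_def)
  then have "product_edge k u i b (edge_end 1) = product_edge k u i' b' (edge_end 1)"
    using covering_space_lifts_agree[OF covering connected_cube charmap_tree_continuous[OF e(1)] _
      charmap_tree_continuous[OF e(2)], of "edge_end 0" "edge_end 1"]
      charmap_tree_in_cover[OF e(1)] charmap_tree_in_cover[OF e(2)] edge_end_in_cube assms
    by (simp add: product_edge_ends)
  then have eq: "product_vertex k (u(i := b)) = product_vertex k (u(i' := b'))"
    using assms by (simp add: product_edge_ends)
  have "b = (u(i' := b')) i" using product_vertex_inj[OF eq assms(2)] by simp
  then show ?thesis using arc_neq[OF assms(2,3)] by (auto split: if_splits)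
qed

section \<open>Deck transformations as families of tree maps\<close>

definition act :: "(nat \<Rightarrow> 'v \<Rightarrow> 'v) \<Rightarrow> (nat \<Rightarrow> 'v) \<Rightarrow> nat \<Rightarrow> 'v" where
  "act \<gamma> w = (\<lambda>j\<in>{..<k}. \<gamma> j (w j))"

lemma act_upd: "i < k \<Longrightarrow> act \<gamma> (w(i := b)) = (act \<gamma> w)(i := \<gamma> i b)"
  by (auto simp: act_def)

text \<open>The combinatorial trace of a deck transformation: one vertex map per tree, compatible
  with the projection of edges to \<open>X\<close>.\<close>

definition automorphism :: "(nat \<Rightarrow> 'v \<Rightarrow> 'v) \<Rightarrow> bool" where
  "automorphism \<gamma> \<longleftrightarrow> (\<forall>w\<in>tuples. act \<gamma> w \<in> tuples \<and> (\<forall>i<k. \<forall>b. (w i, b) \<in> parcs (T i) \<longrightarrow>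
     (\<gamma> i (w i), \<gamma> i b) \<in> parcs (T i) \<and> edge (act \<gamma> w) i (\<gamma> i b) = edge w i b))"

lemma product_vertex_in_cover: "u \<in> tuples \<Longrightarrow> product_vertex k u \<in> cover"
  using charmap_tree_in_cover[OF product_vertex_charmap, of u "\<lambda>_. undefined"] by (simp add: cube_0)

text \<open>Some deck transformation carries the first lift to the second. Composed with a
  characteristic map of the product it lifts a characteristic map of \<open>X\<close>, so by
  \<open>lift_of_charmap\<close> it sends vertices to vertices and edges to edges.\<close>

lemma automorphism_exists:
  assumes u: "u \<in> tuples" "u' \<in> tuples" "vtx u = vtx u'"
  obtains \<gamma> where "automorphism \<gamma>" "act \<gamma> u = u'"
proof -
  have "p (product_vertex k u) = p (product_vertex k u')" using u(3) by (simp add: vtx_def)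
  then obtain g where g: "deck_transformation cover p g" "continuous_on cover g" "g \<in> cover \<rightarrow> cover"
    "g (product_vertex k u) = product_vertex k u'"
    by (rule simply_connected_cover_deck_transitive[OF covering simply_connected_cover
      cube_complex_locally_path_connected[OF complex] product_vertex_in_cover[OF u(1)]
      product_vertex_in_cover[OF u(2)]])
  have pg: "p (g x) = p x" if "x \<in> cover" for x
    using g(1) that unfolding deck_transformation_def by blast
  have lift: "compose (cube n) g q \<in> charmaps (tree_product k T) n"
    if q: "q \<in> charmaps (tree_product k T) n" for n q
  proof -
    have "restrict (\<lambda>x. g (q x)) (cube n) \<in> charmaps (tree_product k T) n"
    proof (rule lift_of_charmap)
      show "compose (cube n) p q \<in> charmaps X n" using q charmaps_X by blast
      show "continuous_on (cube n) (\<lambda>x. g (q x))"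
        by (rule continuous_on_compose2[OF g(2) charmap_tree_continuous[OF q]])
          (use charmap_tree_in_cover[OF q] in blast)
    qed (use g(3) pg charmap_tree_in_cover[OF q] in \<open>auto simp: compose_def Pi_iff\<close>)
    then show ?thesis by (simp add: compose_def)
  qed
  have vertex: "\<exists>w'\<in>tuples. g (product_vertex k w) = product_vertex k w'" if w: "w \<in> tuples" for w
  proof -
    obtain w' where w': "w' \<in> tuples"
      and eq: "compose (cube 0) g (\<lambda>x\<in>cube 0. product_vertex k w) = (\<lambda>x\<in>cube 0. product_vertex k w')"
      using lift[OF product_vertex_charmap[OF w]] by (rule product_vertex_charmapE)
    show ?thesis
      using w' fun_cong[OF eq, of "\<lambda>_. undefined"] by (auto simp: compose_def cube_0)
  qed
  \<comment> \<open>The coordinates other than \<open>j\<close> are frozen at those of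
    \<open>u\<close>. By \<open>deck_separates\<close>, coordinate \<open>j\<close> of the image
    depends on coordinate \<open>j\<close> alone, so the value found here serves every
    tuple.\<close>
  define \<gamma> where "\<gamma> j a = (SOME c. g (product_vertex k (u(j := a))) j = indicator {c})" for j a
  have \<gamma>: "g (product_vertex k w) = product_vertex k (act \<gamma> w)" "act \<gamma> w \<in> tuples" if w: "w \<in> tuples" for w
  proof -
    obtain w' where w': "w' \<in> tuples" "g (product_vertex k w) = product_vertex k w'" using vertex[OF w] by blast
    have "\<gamma> j (w j) = w' j" if j: "j < k" for j
    proof -
      have "w j \<in> pverts (T j)" using w j by (auto simp: tuples_def)
      then have uj: "u(j := w j) \<in> tuples" using u(1) j by (auto simp: tuples_def PiE_iff extensional_def)
      have "g (product_vertex k (u(j := w j))) j = g (product_vertex k w) j"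
        using j by (intro deck_separates[OF g(1) j] product_vertex_in_cover w uj) (simp add: product_vertex_def)
      also have "\<dots> = indicator {w' j}" using w'(2) j by (simp add: product_vertex_def)
      finally show ?thesis unfolding \<gamma>_def by simp
    qed
    then have "act \<gamma> w = w'"
      using w'(1) by (auto simp: act_def tuples_def PiE_iff extensional_def)
    then show "g (product_vertex k w) = product_vertex k (act \<gamma> w)" "act \<gamma> w \<in> tuples" using w' by simp_all
  qed
  have "(\<gamma> i (w i), \<gamma> i b) \<in> parcs (T i) \<and> edge (act \<gamma> w) i (\<gamma> i b) = edge w i b"
    if w: "w \<in> tuples" "i < k" "(w i, b) \<in> parcs (T i)" for w i b
  proof -
    note e = product_edge_charmap[OF w]
    obtain w' i' b' where w': "w' \<in> tuples" "i' < k" "(w' i', b') \<in> parcs (T i')"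
      "compose (cube 1) g (product_edge k w i b) = product_edge k w' i' b'"
      using lift[OF e] by (rule product_edge_charmapE)
    have val: "g (product_edge k w i b x) = product_edge k w' i' b' x" if "x \<in> cube 1" for x
      using fun_cong[OF w'(4), of x] that by (simp add: compose_def)
    have 0: "product_vertex k (act \<gamma> w) = product_vertex k w'"
      using val[OF edge_end_in_cube(1)] \<gamma>(1)[OF w(1)] w w' by (simp add: product_edge_ends)
    have 1: "product_vertex k ((act \<gamma> w)(i := \<gamma> i b)) = product_vertex k (w'(i' := b'))"
      using val[OF edge_end_in_cube(2)] \<gamma>(1)[OF fun_upd_tuples[OF w]] w w' by (simp add: product_edge_ends act_upd)
    have act: "act \<gamma> w = w'"
      using product_vertex_inj[OF 0] \<gamma>(2)[OF w(1)] w'(1) unfolding tuples_def by (intro PiE_ext) auto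
    \<comment> \<open>The image edge moves coordinate \<open>i'\<close>, while its two end tuples
      differ at most at \<open>i\<close>; as edges are not loops, \<open>i' = i\<close>.\<close>
    have "((act \<gamma> w)(i := \<gamma> i b)) i' = b'" using product_vertex_inj[OF 1 w'(2)] by simp
    then have i: "i' = i" "\<gamma> i b = b'" using act arc_neq[OF w'(2,3)] by (auto split: if_splits)
    have "w' i = \<gamma> i (w i)" using act w(2) by (auto simp: act_def)
    moreover have "edge w' i b' = edge w i b"
      unfolding edge_def using val pg[OF charmap_tree_in_cover[OF e]] i(1) by (auto simp: compose_def)
    ultimately show ?thesis using w'(3) i act by simp
  qed
  then have "automorphism \<gamma>" unfolding automorphism_def using \<gamma>(2) by blast
  moreover have "act \<gamma> u = u'"
    using product_vertex_inj[of k "act \<gamma> u" u'] \<gamma>[OF u(1)] g(4) u(2) unfolding tuples_def by (intro PiE_ext) auto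
  ultimately show thesis by (rule that)
qed

text \<open>Moving one origin to the other already matches direction and target, because by
  \<open>edge_inj\<close> an edge leaving a given tuple is determined by its projection.\<close>

lemma edge_match:
  assumes u: "u \<in> tuples" "i < k" "(u i, b) \<in> parcs (T i)"
    and u': "u' \<in> tuples" "i' < k" "(u' i', b') \<in> parcs (T i')"
    and eq: "edge u' i' b' = edge u i b"
  obtains \<gamma> where "automorphism \<gamma>" "act \<gamma> u' = u" "i' = i" "\<gamma> i b' = b"
proof -
  have "vtx u' = vtx u" using arg_cong[OF eq, of origin] u u' by (simp add: origin_edge)
  then obtain \<gamma> where \<gamma>: "automorphism \<gamma>" "act \<gamma> u' = u" by (rule automorphism_exists[OF u'(1) u(1)])
  have "(\<gamma> i' (u' i'), \<gamma> i' b') \<in> parcs (T i')" "edge u i' (\<gamma> i' b') = edge u' i' b'"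
    using \<gamma> u' unfolding automorphism_def by blast+
  moreover have "u i' = \<gamma> i' (u' i')" using \<gamma>(2) u'(2) by (auto simp: act_def)
  ultimately have "i' = i \<and> \<gamma> i' b' = b"
    using edge_inj[OF u(1) u'(2) _ u(2,3), of "\<gamma> i' b'"] eq by auto
  then show thesis using that \<gamma> by blast
qed

text \<open>Some lift of \<open>e\<close> starts at a tuple \<open>u'\<close> above the same vertex.
  An automorphism taking \<open>u'\<close> to \<open>u\<close> moves this lift without changing its
  colour or its projection.\<close>

lemma edge_lift:
  assumes "i < k" "e \<in> oriented_edges k T p i" "u \<in> tuples" "origin e = vtx u"
  shows "\<exists>b. (u i, b) \<in> parcs (T i) \<and> e = edge u i b"
proof -
  obtain u' b' where u': "u' \<in> tuples" "(u' i, b') \<in> parcs (T i)" "e = edge u' i b'"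
    using assms(2) unfolding oriented_edges_eq[OF assms(1)] by blast
  have "vtx u' = vtx u" using assms(4) u' origin_edge[OF assms(1)] by simp
  then obtain \<gamma> where \<gamma>: "automorphism \<gamma>" "act \<gamma> u' = u" by (rule automorphism_exists[OF u'(1) assms(3)])
  have "(\<gamma> i (u' i), \<gamma> i b') \<in> parcs (T i)" "edge u i (\<gamma> i b') = edge u' i b'"
    using \<gamma> u' assms(1) unfolding automorphism_def by blast+
  moreover have "u i = \<gamma> i (u' i)" using \<gamma>(2) assms(1) by (auto simp: act_def)
  ultimately show ?thesis using u'(3) by auto
qed

lemma square_faces:
  assumes "i < k" "j < k" "i \<noteq> j"
    and q_def: "q = compose (cube 2) p (product_square k u i b j c)"
  shows "cube_face 1 q 1 0 = edge u i b" "cube_face 1 q 0 1 = edge (u(i := b)) j c"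
    "cube_face 1 q 0 0 = edge u j c" "cube_face 1 q 1 1 = edge (u(j := c)) i b"
proof -
  have "x 0 \<in> {0..1}" if "x \<in> cube 1" for x :: "nat \<Rightarrow> real"
    using that unfolding cube_def by (rule PiE_mem) simp
  then have y: "(\<lambda>l\<in>{..<Suc 1}. if l < m then x l else if l = m then e else x (l - 1)) \<in> cube 2"
    if "x \<in> cube 1" "m \<le> 1" "e \<in> {0, 1}" for x m and e :: real
    using that by (intro restrict_in_cube_2) (cases "m = 0"; auto)+
  show "cube_face 1 q 1 0 = edge u i b" "cube_face 1 q 0 1 = edge (u(i := b)) j c"
    "cube_face 1 q 0 0 = edge u j c" "cube_face 1 q 1 1 = edge (u(j := c)) i b"
    unfolding cube_face_def edge_def compose_def q_def
    by (intro restrict_ext; subst restrict_apply', rule y;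
      simp add: product_square_face[OF _ assms(3,1,2), simplified])+
qed

text \<open>The product square at \<open>u\<close> gives existence. Any other square of
  \<open>X\<close> with these two sides lifts to a product square at some \<open>u'\<close>. An
  automorphism moves it to \<open>u\<close> along the first side, after which
  \<open>edge_inj\<close> at \<open>u(i := b)\<close> matches the second side; the opposite sides
  then have equal projections.\<close>

lemma DG_phi_edge:
  assumes u: "u \<in> tuples" "i < k" "j < k" "i \<noteq> j" "(u i, b) \<in> parcs (T i)" "(u j, c) \<in> parcs (T j)"
  shows "DG_phi X (edge u i b) (edge (u(i := b)) j c) = (edge u j c, edge (u(j := c)) i b)"
  unfolding DG_phi_def
proof (rule the_equality, goal_cases)
  case 1
  have "compose (cube 2) p (product_square k u i b j c) \<in> charmaps X 2"
    unfolding charmaps_X by (intro imageI product_square_charmap u)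
  then show ?case
    unfolding case_prod_conv by (rule bexI[rotated]) (intro conjI square_faces[OF u(2-4) HOL.refl])
next
  case (2 z)
  obtain y' x' where z: "z = (y', x')" by (cases z)
  obtain q where q: "q \<in> charmaps X 2" "cube_face 1 q 1 0 = edge u i b" "cube_face 1 q 0 1 = edge (u(i := b)) j c"
    "cube_face 1 q 0 0 = y'" "cube_face 1 q 1 1 = x'"
    using 2 unfolding z case_prod_conv by blast
  obtain r where r: "r \<in> charmaps (tree_product k T) 2" "q = compose (cube 2) p r"
    using q(1) unfolding charmaps_X by blast
  obtain u' i' b' j' c' where u': "u' \<in> tuples" "i' < k" "j' < k" "i' \<noteq> j'" "(u' i', b') \<in> parcs (T i')"
    "(u' j', c') \<in> parcs (T j')" "r = product_square k u' i' b' j' c'"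
    using r(1) by (rule product_square_charmapE)
  note faces = square_faces[OF u'(2-4) r(2)[unfolded u'(7)]]
  have e1: "edge u' i' b' = edge u i b" and e2: "edge (u'(i' := b')) j' c' = edge (u(i := b)) j c"
    using faces(1,2) q(2,3) by simp_all
  obtain \<gamma> where \<gamma>: "automorphism \<gamma>" "act \<gamma> u' = u" "i' = i" "\<gamma> i b' = b"
    using u(1,2,5) u'(1,2,5) e1 by (rule edge_match)
  have act: "edge (act \<gamma> w) l (\<gamma> l a) = edge w l a" "(\<gamma> l (w l), \<gamma> l a) \<in> parcs (T l)"
    if "w \<in> tuples" "l < k" "(w l, a) \<in> parcs (T l)" for w l a
    using \<gamma>(1) that unfolding automorphism_def by blast+
  have ui: "u(i := b) \<in> tuples" "u'(i' := b') \<in> tuples" using u u' by (blast intro: fun_upd_tuples)+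
  have uj: "u'(j' := c') \<in> tuples" using u' by (blast intro: fun_upd_tuples)
  have ubj: "((u'(i' := b')) j', c') \<in> parcs (T j')" and ucj: "((u'(j' := c')) i', b') \<in> parcs (T i')"
    using u' by auto
  have "edge (act \<gamma> (u'(i' := b'))) j' (\<gamma> j' c') = edge (u'(i' := b')) j' c'"
    using ui(2) u'(3) ubj by (rule act(1))
  moreover have "act \<gamma> (u'(i' := b')) = u(i := b)" using \<gamma> u(2) by (simp add: act_upd)
  ultimately have "edge (u(i := b)) j' (\<gamma> j' c') = edge (u(i := b)) j c" using e2 by simp
  moreover have uj': "u j' = \<gamma> j' (u' j')" using \<gamma>(2) u'(3) by (auto simp: act_def)
  have "(u j', \<gamma> j' c') \<in> parcs (T j')" using act(2)[OF u'(1,3,6)] uj' by simp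
  ultimately have j: "j' = j" "\<gamma> j c' = c"
    using edge_inj[OF ui(1) u'(3) _ u(3), of "\<gamma> j' c'" c] u u' \<gamma>(3) by auto
  have "y' = edge u j c" using act(1)[OF u'(1,3,6)] faces(3) q(4) \<gamma>(2) j by simp
  moreover have "edge (act \<gamma> (u'(j' := c'))) i' (\<gamma> i' b') = edge (u'(j' := c')) i' b'"
    using uj u'(2) ucj by (rule act(1))
  moreover have "act \<gamma> (u'(j' := c')) = u(j := c)" using \<gamma>(2) j u(3) by (simp add: act_upd)
  ultimately show ?case using faces(4) q(5) \<gamma>(3,4) z by simp
qed

section \<open>Orientation reversal and geometric edges\<close>

lemma edge_in_charmaps:
  "u \<in> tuples \<Longrightarrow> i < k \<Longrightarrow> (u i, b) \<in> parcs (T i) \<Longrightarrow> edge u i b \<in> charmaps X 1"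
  unfolding edge_def charmaps_X by (intro imageI product_edge_charmap)

lemma charmaps_X_1E:
  assumes "x \<in> charmaps X 1"
  obtains u i b where "u \<in> tuples" "i < k" "(u i, b) \<in> parcs (T i)" "x = edge u i b"
proof -
  obtain q where q: "q \<in> charmaps (tree_product k T) 1" "x = compose (cube 1) p q"
    using assms unfolding charmaps_X by blast
  from q(1) obtain u i b where "u \<in> tuples" "i < k" "(u i, b) \<in> parcs (T i)" "q = product_edge k u i b"
    by (rule product_edge_charmapE)
  then show thesis using that q(2) by (simp add: edge_def)
qed

lemma flip_in_cube: "x \<in> cube 1 \<Longrightarrow> (\<lambda>i\<in>{..<1}. 1 - x i) \<in> cube 1"
  and flip_in_open_cube: "x \<in> open_cube 1 \<Longrightarrow> (\<lambda>i\<in>{..<1}. 1 - x i) \<in> open_cube 1"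
  by (auto simp: cube_def open_cube_def PiE_iff)

lemma reverse_edge:
  assumes "i < k"
  shows "reverse (edge u i b) = edge (u(i := b)) i (u i)"
proof -
  have "product_edge k u i b (\<lambda>i\<in>{..<1}. 1 - x i) = product_edge k (u(i := b)) i (u i) x"
    if x: "x \<in> cube 1" for x
    unfolding product_edge_apply[OF x] product_edge_apply[OF flip_in_cube[OF x]]
    by (intro restrict_ext) (simp add: edge_point_flip)
  then show ?thesis
    unfolding reverse_def edge_def compose_def using flip_in_cube by (intro restrict_ext) simp
qed

lemma reverse_neq:
  assumes "x \<in> charmaps X 1"
  shows "reverse x \<noteq> x"
proof
  assume eq: "reverse x = x"
  \<comment> \<open>The flip exchanges the interior points 1/4 and 3/4, so an edge equal to its
    reverse would fail to be injective on the open cube.\<close>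
  define a where "a = (\<lambda>i\<in>{..<1::nat}. 1 / 4 :: real)"
  define b where "b = (\<lambda>i\<in>{..<1::nat}. 3 / 4 :: real)"
  have ab: "a \<in> open_cube 1" "b \<in> open_cube 1" "a \<in> cube 1" by (auto simp: a_def b_def open_cube_def cube_def)
  have "(\<lambda>i\<in>{..<1}. 1 - a i) = b" by (auto simp: a_def b_def)
  then have "x a = x b" using fun_cong[OF eq, of a] ab by (simp add: reverse_def compose_def)
  then have "a = b" using inj_onD[OF charmap_inj[OF complex assms]] ab by blast
  then have "a 0 = b 0" by simp
  then show False by (simp add: a_def b_def)
qed

lemma reverse_image: "reverse x ` open_cube 1 = x ` open_cube 1"
proof -
  have "(\<lambda>y. \<lambda>i\<in>{..<1}. 1 - y i) ` open_cube 1 = open_cube 1"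
  proof (intro equalityI subsetI)
    fix y assume y: "y \<in> open_cube 1"
    have "(\<lambda>i\<in>{..<1}. 1 - (\<lambda>i\<in>{..<1}. 1 - y i) i) = restrict y {..<1}"
      by (intro restrict_ext) simp
    also have "\<dots> = y" using y unfolding open_cube_def by (rule PiE_restrict)
    finally have "y = (\<lambda>i\<in>{..<1}. 1 - (\<lambda>i\<in>{..<1}. 1 - y i) i)" ..
    then show "y \<in> (\<lambda>y. \<lambda>i\<in>{..<1}. 1 - y i) ` open_cube 1" using flip_in_open_cube[OF y] by blast
  qed (use flip_in_open_cube in blast)
  moreover have "reverse x ` open_cube 1 = x ` ((\<lambda>y. \<lambda>i\<in>{..<1}. 1 - y i) ` open_cube 1)"
    unfolding image_image reverse_def compose_def using open_cube_subset_cube[of 1] by (intro image_cong) auto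
  ultimately show ?thesis by simp
qed

text \<open>The 1-cube has two symmetries: the permutation is trivial, and whether 0 lies in
  \<open>F\<close> decides between the identity and the flip. Characteristic maps with the same open
  edge differ by one of these.\<close>

lemma charmaps_of_open_edge:
  assumes x: "x \<in> charmaps X 1" "reverse x \<in> charmaps X 1"
  shows "{y \<in> charmaps X 1. y ` open_cube 1 = x ` open_cube 1} = {x, reverse x}"
proof (intro equalityI subsetI)
  fix y assume y: "y \<in> {y \<in> charmaps X 1. y ` open_cube 1 = x ` open_cube 1}"
  have "(\<lambda>i\<in>{..<1::nat}. 1 / 2 :: real) \<in> open_cube 1" by (auto simp: open_cube_def)
  then have "x ` open_cube 1 \<inter> y ` open_cube 1 \<noteq> {}" using y by blast
  then obtain g where g: "g \<in> cube_syms 1" "y = compose (cube 1) x g"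
    using charmap_overlap[OF complex x(1), of y 1] y by blast
  then obtain \<pi> F where \<pi>: "\<pi> permutes {..<1}" "g = cube_sym 1 \<pi> F" unfolding cube_syms_eq by blast
  have "\<pi> 0 = 0" using permutes_in_image[OF \<pi>(1), of 0] by simp
  then have gz: "g z = (\<lambda>i\<in>{..<1}. if 0 \<in> F then 1 - z i else z i)" if "z \<in> cube 1" for z
    using that unfolding \<pi>(2) cube_sym_def lessThan_1 by (auto intro!: restrict_ext)
  show "y \<in> {x, reverse x}"
  proof (cases "0 \<in> F")
    case True
    then have "y = reverse x" using gz unfolding g(2) reverse_def compose_def by (intro restrict_ext) simp
    then show ?thesis by simp
  next
    case False
    have "g z = z" if z: "z \<in> cube 1" for z
    proof -
      have "g z = restrict z {..<1}" using gz[OF z] False by simp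
      also have "\<dots> = z" using z unfolding cube_def by (rule PiE_restrict)
      finally show ?thesis .
    qed
    then have "y = restrict x (cube 1)" unfolding g(2) compose_def by (intro restrict_ext) simp
    then show ?thesis using charmap_PiE[OF complex x(1)] by (simp add: PiE_def extensional_restrict)
  qed
next
  fix y assume "y \<in> {x, reverse x}"
  then show "y \<in> {y \<in> charmaps X 1. y ` open_cube 1 = x ` open_cube 1}"
    by (elim insertE emptyE) (simp_all add: x reverse_image)
qed

lemma DG_simps: "verts (DG k X T p) = vtx ` tuples" "arcs (DG k X T p) = (\<Union>i<k. oriented_edges k T p i)"
  "tail (DG k X T p) = origin" "head (DG k X T p) = terminus"
  by (simp_all add: DG_def vertices_X)

text \<open>The relation axioms come from \<open>DG_phi_edge\<close>. Seen from a tuple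
  \<open>u\<close>, the first edge of a relation lifts at \<open>u\<close> and the second at the
  tuple so reached. Their colours differ, so the pair spans a product square, and
  \<open>DG_phi\<close> returns its opposite sides.\<close>

lemma coloured_cover_DG:
  assumes "finite_cube_complex X"
  shows "coloured_cover k (\<lambda>i. parcs (T i)) tuples vtx edge (DG k X T p) (oriented_edges k T p) (DG_relations k X T p)"
proof
  have fin: "finite (charmaps X n)" for n
  proof (rule finite_subset)
    show "charmaps X n \<subseteq> snd ` (SIGMA n:UNIV. charmaps X n)" by force
    show "finite (snd ` (SIGMA n:UNIV. charmaps X n))"
      using assms unfolding finite_cube_complex_def by (rule finite_imageI)
  qed
  show "finite (verts (DG k X T p))" using fin by (simp add: DG_def vertices_def)
  have "oriented_edges k T p i \<subseteq> charmaps X 1" if "i < k" for i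
    unfolding oriented_edges_eq[OF that] using edge_in_charmaps[OF _ that] by blast
  then show "finite (arcs (DG k X T p))"
    unfolding DG_simps using fin[of 1] by (intro finite_UN_I) (auto intro: finite_subset)
next
  fix u i b assume u: "u \<in> tuples" "i < k" "(u i, b) \<in> parcs (T i)"
  show "u(i := b) \<in> tuples" using u by (rule fun_upd_tuples)
  show "edge u i b \<in> oriented_edges k T p i" unfolding oriented_edges_eq[OF u(2)] using u by blast
  show "tail (DG k X T p) (edge u i b) = vtx u" "head (DG k X T p) (edge u i b) = vtx (u(i := b))"
    using u by (simp_all add: DG_simps origin_edge terminus_edge)
  show "i = i' \<and> b = b'" if "i' < k" "(u i', b') \<in> parcs (T i')" "edge u i b = edge u i' b'" for i' b'
    using u that by (rule edge_inj)
next
  fix i e u assume "i < k" "e \<in> oriented_edges k T p i" "u \<in> tuples" "tail (DG k X T p) e = vtx u"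
  then show "\<exists>b. (u i, b) \<in> parcs (T i) \<and> e = edge u i b" unfolding DG_simps by (rule edge_lift)
next
  fix i e assume i: "i < k" and e: "e \<in> oriented_edges k T p i"
  show "tail (DG k X T p) e \<in> vtx ` tuples"
    using e unfolding oriented_edges_eq[OF i] DG_simps by (auto simp: origin_edge[OF i])
next
  fix u i j b c
  assume u: "u \<in> tuples" "i < k" "j < k" "i \<noteq> j" "(u i, b) \<in> parcs (T i)" "(u j, c) \<in> parcs (T j)"
  have ui: "u(i := b) \<in> tuples" "((u(i := b)) j, c) \<in> parcs (T j)" using u fun_upd_tuples by auto
  have E: "edge u i b \<in> oriented_edges k T p i" "edge (u(i := b)) j c \<in> oriented_edges k T p j"
    unfolding oriented_edges_eq[OF u(2)] oriented_edges_eq[OF u(3)] using u ui by blast+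
  show "((vtx u, [edge u i b, edge (u(i := b)) j c], vtx (u(i := b, j := c))),
      (vtx u, [edge u j c, edge (u(j := c)) i b], vtx (u(i := b, j := c)))) \<in> DG_relations k X T p"
    unfolding DG_relations_def mem_Collect_eq
    by (rule exI[of _ "edge u i b"], rule exI[of _ "edge (u(i := b)) j c"], rule exI[of _ "edge u j c"],
      rule exI[of _ "edge (u(j := c)) i b"], rule exI[of _ i], rule exI[of _ j])
      (use u E DG_phi_edge[OF u] in \<open>simp add: origin_edge terminus_edge\<close>)
next
  fix r assume r: "r \<in> DG_relations k X T p"
  then obtain x y y' x' i j where xy: "r = ((origin x, [x, y], terminus y), (origin x, [y', x'], terminus y))"
    "i < k" "j < k" "i \<noteq> j" "x \<in> oriented_edges k T p i" "y \<in> oriented_edges k T p j"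
    "terminus x = origin y" "(y', x') = DG_phi X x y"
    unfolding DG_relations_def by blast
  show "fst (fst r) \<in> vtx ` tuples"
    using xy(5) unfolding xy(1) oriented_edges_eq[OF xy(2)] by (auto simp: origin_edge[OF xy(2)])
  fix u assume u: "u \<in> tuples" "fst (fst r) = vtx u"
  then obtain b where b: "(u i, b) \<in> parcs (T i)" "x = edge u i b"
    using edge_lift[OF xy(2,5), of u] xy(1) by auto
  have ui: "u(i := b) \<in> tuples" using u(1) xy(2) b(1) by (rule fun_upd_tuples)
  have "origin y = vtx (u(i := b))" using xy(7) b xy(2) by (simp add: terminus_edge)
  then obtain c where "((u(i := b)) j, c) \<in> parcs (T j)" and y: "y = edge (u(i := b)) j c"
    using edge_lift[OF xy(3,6) ui] by blast
  then have c: "(u j, c) \<in> parcs (T j)" using xy(4) by simp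
  have "y' = edge u j c" "x' = edge (u(j := c)) i b"
    using DG_phi_edge[OF u(1) xy(2,3,4) b(1) c] xy(8) b(2) y by simp_all
  then have "r = ((vtx u, [edge u i b, edge (u(i := b)) j c], vtx (u(i := b, j := c))),
       (vtx u, [edge u j c, edge (u(j := c)) i b], vtx (u(i := b, j := c))))"
    using xy(1-3) b(2) y by (simp add: origin_edge terminus_edge)
  then show "\<exists>i j b c. i < k \<and> j < k \<and> i \<noteq> j \<and> (u i, b) \<in> parcs (T i) \<and> (u j, c) \<in> parcs (T j) \<and>
      r = ((vtx u, [edge u i b, edge (u(i := b)) j c], vtx (u(i := b, j := c))),
       (vtx u, [edge u j c, edge (u(j := c)) i b], vtx (u(i := b, j := c))))"
    using xy(2-4) b(1) c by blast
qed (simp_all add: DG_simps)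

end

theorem corollary3p4:
  fixes k :: nat
    and X :: "'a::topological_space cube_complex"
    and T :: "nat \<Rightarrow> 'v pair_pre_digraph"
    and p :: "(nat \<Rightarrow> 'v \<Rightarrow> real) \<Rightarrow> 'a"
  assumes "2 \<le> k"
    and "k_cube_complex k X T p"
    and "finite_cube_complex X"
  shows "\<exists>d. k_graph k (Lambda_DG k X T p) d \<and>
      Ob (Lambda_DG k X T p) = vertices X \<and>
      bij_betw (ident (Lambda_DG k X T p)) (vertices X)
        {f \<in> Mor (Lambda_DG k X T p). d f = (\<lambda>_. 0)} \<and>
      (\<forall>i<k. bij_betw (edge_class k X T p) (oriented_edges k T p i)
        {f \<in> Mor (Lambda_DG k X T p). d f = unit_degree i}) \<and>
      (\<forall>i<k. \<forall>x\<in>oriented_edges k T p i.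
        src (Lambda_DG k X T p) (edge_class k X T p x) = origin x \<and>
        rng (Lambda_DG k X T p) (edge_class k X T p x) = terminus x) \<and>
      (\<forall>e\<in>open_cells X 1. \<exists>i<k. \<exists>x.
        x \<in> oriented_edges k T p i \<and> reverse x \<in> oriented_edges k T p i \<and>
        {y \<in> charmaps X 1. y ` open_cube 1 = e} = {x, reverse x} \<and>
        edge_class k X T p x \<noteq> edge_class k X T p (reverse x) \<and>
        src (Lambda_DG k X T p) (edge_class k X T p (reverse x)) =
          rng (Lambda_DG k X T p) (edge_class k X T p x) \<and>
        rng (Lambda_DG k X T p) (edge_class k X T p (reverse x)) =
          src (Lambda_DG k X T p) (edge_class k X T p x)) \<and>
      row_finite k (Lambda_DG k X T p) d"
proof -
  interpret tree_cover k X T p by standard (rule assms(2))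
  interpret cc: coloured_cover k "\<lambda>i. parcs (T i)" tuples vtx edge "DG k X T p" "oriented_edges k T p"
    "DG_relations k X T p"
    using assms(3) by (rule coloured_cover_DG)
  let ?L = "Lambda_DG k X T p" and ?c = "edge_class k X T p" and ?E = "oriented_edges k T p"
  have L: "?L = cc.\<Lambda>" by (simp add: Lambda_DG_def DG_congruence_def)
  have c: "?c = cc.edge_cell"
    by (rule ext) (simp add: edge_class_def cc.edge_cell_def DG_congruence_def DG_simps)
  have V: "vertices X = verts (DG k X T p)" by (simp add: DG_simps vertices_X)
  have ends: "src ?L (?c x) = origin x" "rng ?L (?c x) = terminus x" if "i < k" "x \<in> ?E i" for i x
    using cc.src_rng_edge_cell[OF that] unfolding L c DG_simps by simp_all
  have bij: "bij_betw ?c (?E i) {f \<in> Mor ?L. cc.degree f = unit_degree i}" if "i < k" for i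
    unfolding L c using that by (rule cc.bij_betw_edge_cell)
  have cells: "\<exists>i<k. \<exists>x. x \<in> ?E i \<and> reverse x \<in> ?E i \<and>
        {y \<in> charmaps X 1. y ` open_cube 1 = e} = {x, reverse x} \<and> ?c x \<noteq> ?c (reverse x) \<and>
        src ?L (?c (reverse x)) = rng ?L (?c x) \<and> rng ?L (?c (reverse x)) = src ?L (?c x)"
    if e: "e \<in> open_cells X 1" for e
  proof -
    obtain x where x: "x \<in> charmaps X 1" "e = x ` open_cube 1" using e unfolding open_cells_def by blast
    obtain u i b where u: "u \<in> tuples" "i < k" "(u i, b) \<in> parcs (T i)" "x = edge u i b"
      using x(1) by (rule charmaps_X_1E)
    have u': "u(i := b) \<in> tuples" "((u(i := b)) i, u i) \<in> parcs (T i)"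
      using fun_upd_tuples[OF u(1-3)] arc_sym[OF u(2,3)] by simp_all
    have rev: "reverse x = edge (u(i := b)) i (u i)" using u by (simp add: reverse_edge)
    have E: "x \<in> ?E i" "reverse x \<in> ?E i"
      using cc.edge_E[OF u(1-3)] cc.edge_E[OF u'(1) u(2) u'(2)] unfolding u(4)[symmetric] rev[symmetric] .
    \<comment> \<open>Both orientations have colour \<open>i\<close>, and the edge classes are
      injective on that colour, so it is enough that the oriented edges differ.\<close>
    have "?c x \<noteq> ?c (reverse x)"
      using bij_betw_imp_inj_on[OF bij[OF u(2)]] E reverse_neq[OF x(1)] by (metis inj_onD)
    moreover have "reverse x \<in> charmaps X 1" unfolding rev using u' u(2) by (intro edge_in_charmaps)
    then have "{y \<in> charmaps X 1. y ` open_cube 1 = e} = {x, reverse x}"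
      unfolding x(2) by (rule charmaps_of_open_edge[OF x(1)])
    moreover have "origin (reverse x) = terminus x" "terminus (reverse x) = origin x"
      using u(2) unfolding u(4) by (simp_all add: reverse_edge origin_edge terminus_edge)
    ultimately show ?thesis
      using E u(2) ends[OF u(2)]
      by - (rule exI[of _ i], rule conjI, assumption, rule exI[of _ x], simp)
  qed
  show ?thesis
  proof (intro exI[of _ cc.degree] conjI allI impI ballI)
    show "k_graph k ?L cc.degree" unfolding L by (rule cc.k_graph_quotient)
    show "Ob ?L = vertices X" unfolding L by (simp add: cc.Ob_quotient vertices_X)
    show "bij_betw (ident ?L) (vertices X) {f \<in> Mor ?L. cc.degree f = (\<lambda>_. 0)}"
      unfolding L V by (rule cc.bij_betw_ident)
    show "row_finite k ?L cc.degree" unfolding L by (rule cc.row_finite_quotient)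
  qed (use bij ends cells in blast)+
qed

end
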